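(* Let $R \to S$ be a faithfully flat map of commutative rings (not assumed noetherian), and let $P$ be an $R$-module (not assumed finitely generated). Then $P$ is projective over $R$ if and only if the $S$-module $S\otimes_R P$ is projective over $S$. *)

theory Defs
  imports "HOL-Algebra.Module" "HOL-Algebra.Free_Abelian_Groups"
begin

section \<open>Linear maps\<close>

definition linear_maps ::
    "('r, 'c) ring_scheme \<Rightarrow> ('r, 'm, 'd) module_scheme \<Rightarrow> ('r, 'n, 'e) module_scheme \<Rightarrow> ('m \<Rightarrow> 'n) set"
  where "linear_maps R M N =
    {f. f \<in> carrier M \<rightarrow> carrier N \<and>
        (\<forall>x\<in>carrier M. \<forall>y\<in>carrier M. f (x \<oplus>\<^bsub>M\<^esub> y) = f x \<oplus>\<^bsub>N\<^esub> f y) \<and>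
        (\<forall>r\<in>carrier R. \<forall>x\<in>carrier M. f (r \<odot>\<^bsub>M\<^esub> x) = r \<odot>\<^bsub>N\<^esub> f x)}"

text \<open>The record type \<^typ>\<open>('r, 'm) module\<close> extends the one of rings, but the locale
  \<^locale>\<open>module\<close> ignores the fields for ring multiplication and unit; they are left
  unspecified.\<close>

definition module_of_group :: "('m, 'c) monoid_scheme \<Rightarrow> ('r \<Rightarrow> 'm \<Rightarrow> 'm) \<Rightarrow> ('r, 'm) module"
  where "module_of_group G act =
    \<lparr>carrier = carrier G, monoid.mult = undefined, one = undefined,
     ring.zero = \<one>\<^bsub>G\<^esub>, ring.add = (\<otimes>\<^bsub>G\<^esub>), smult = act\<rparr>"


section \<open>Tensor products and base change\<close>

text \<open>\<open>A \<otimes>\<^sub>R M\<close> as an abelian group: the free abelian group on \<open>A \<times> M\<close> modulo the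
  subgroup generated by the usual relations.\<close>

definition tensor_rels ::
    "('r, 'c) ring_scheme \<Rightarrow> ('r, 'a, 'd) module_scheme \<Rightarrow> ('r, 'm, 'e) module_scheme \<Rightarrow> ('a \<times> 'm \<Rightarrow>\<^sub>0 int) set"
  where "tensor_rels R A M =
     {frag_of (a \<oplus>\<^bsub>A\<^esub> b, m) - frag_of (a, m) - frag_of (b, m) | a b m.
        a \<in> carrier A \<and> b \<in> carrier A \<and> m \<in> carrier M} \<union>
     {frag_of (a, m \<oplus>\<^bsub>M\<^esub> n) - frag_of (a, m) - frag_of (a, n) | a m n.
        a \<in> carrier A \<and> m \<in> carrier M \<and> n \<in> carrier M} \<union>
     {frag_of (r \<odot>\<^bsub>A\<^esub> a, m) - frag_of (a, r \<odot>\<^bsub>M\<^esub> m) | r a m.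
        r \<in> carrier R \<and> a \<in> carrier A \<and> m \<in> carrier M}"

definition tensor_null ::
    "('r, 'c) ring_scheme \<Rightarrow> ('r, 'a, 'd) module_scheme \<Rightarrow> ('r, 'm, 'e) module_scheme \<Rightarrow> ('a \<times> 'm \<Rightarrow>\<^sub>0 int) set"
  where "tensor_null R A M =
    generate (free_Abelian_group (carrier A \<times> carrier M)) (tensor_rels R A M)"

definition tensor_group ::
    "('r, 'c) ring_scheme \<Rightarrow> ('r, 'a, 'd) module_scheme \<Rightarrow> ('r, 'm, 'e) module_scheme \<Rightarrow> ('a \<times> 'm \<Rightarrow>\<^sub>0 int) set monoid"
  where "tensor_group R A M =
    free_Abelian_group (carrier A \<times> carrier M) Mod tensor_null R A M"

definition tensor_class ::
    "('r, 'c) ring_scheme \<Rightarrow> ('r, 'a, 'd) module_scheme \<Rightarrow> ('r, 'm, 'e) module_scheme \<Rightarrow> ('a \<times> 'm \<Rightarrow>\<^sub>0 int) \<Rightarrow> ('a \<times> 'm \<Rightarrow>\<^sub>0 int) set"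
  where "tensor_class R A M x =
    tensor_null R A M #>\<^bsub>free_Abelian_group (carrier A \<times> carrier M)\<^esub> x"

definition frag_tensor :: "('a \<Rightarrow> 'b) \<Rightarrow> ('m \<Rightarrow> 'n) \<Rightarrow> ('a \<times> 'm \<Rightarrow>\<^sub>0 int) \<Rightarrow> ('b \<times> 'n \<Rightarrow>\<^sub>0 int)"
  where "frag_tensor u f = frag_extend (\<lambda>(a, m). frag_of (u a, f m))"

text \<open>\<open>u \<otimes> f\<close>, with target \<open>B \<otimes>\<^sub>R N\<close>. The argument is a coset; for linear \<open>u\<close> and \<open>f\<close> the
  cosets in the union coincide, see \<open>tensor_map_class\<close> below.\<close>

definition tensor_map ::
    "('r, 'c) ring_scheme \<Rightarrow> ('r, 'b, 'd) module_scheme \<Rightarrow> ('r, 'n, 'e) module_scheme \<Rightarrow>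
     ('a \<Rightarrow> 'b) \<Rightarrow> ('m \<Rightarrow> 'n) \<Rightarrow> ('a \<times> 'm \<Rightarrow>\<^sub>0 int) set \<Rightarrow> ('b \<times> 'n \<Rightarrow>\<^sub>0 int) set"
  where "tensor_map R B N u f C =
    (\<Union>x\<in>C. tensor_class R B N (frag_tensor u f x))"

text \<open>The ring \<open>S\<close> as an \<open>R\<close>-module along \<open>h\<close>.\<close>

definition restrict_scalars :: "('r \<Rightarrow> 's) \<Rightarrow> ('s, 'c) ring_scheme \<Rightarrow> ('r, 's) module"
  where "restrict_scalars h S = module_of_group (add_monoid S) (\<lambda>r s. h r \<otimes>\<^bsub>S\<^esub> s)"

text \<open>The \<open>S\<close>-module \<open>S \<otimes>\<^sub>R M\<close>, on which \<open>s\<close> acts as multiplication by \<open>s\<close> tensored with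
  the identity.\<close>

definition base_change ::
    "('r, 'c) ring_scheme \<Rightarrow> ('s, 'd) ring_scheme \<Rightarrow> ('r \<Rightarrow> 's) \<Rightarrow> ('r, 'm, 'e) module_scheme \<Rightarrow>
     ('s, ('s \<times> 'm \<Rightarrow>\<^sub>0 int) set) module"
  where "base_change R S h M =
    module_of_group (tensor_group R (restrict_scalars h S) M)
      (\<lambda>s. tensor_map R (restrict_scalars h S) M (\<lambda>t. s \<otimes>\<^bsub>S\<^esub> t) (\<lambda>m. m))"


section \<open>Faithful flatness\<close>

definition exact_at ::
    "('a, 'd) monoid_scheme \<Rightarrow> ('b, 'e) monoid_scheme \<Rightarrow> ('c, 'f) monoid_scheme \<Rightarrow> ('a \<Rightarrow> 'b) \<Rightarrow> ('b \<Rightarrow> 'c) \<Rightarrow> bool"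
  where "exact_at G H K f g \<longleftrightarrow> f ` carrier G = kernel H K g"

text \<open>A complex \<open>N\<^sub>1 \<rightarrow> N\<^sub>2 \<rightarrow> N\<^sub>3\<close> of \<open>R\<close>-modules is exact if and only if its tensor product with
  \<open>A\<close> is. A definition cannot quantify over modules on all types; the modules on
  \<^typ>\<open>(nat \<Rightarrow> 'r) set\<close> include, up to isomorphism, all submodules of finitely generated
  \<open>R\<close>-modules, and the property for these implies the property for modules on arbitrary types:
  see \<open>faithfully_flat_exact_iff\<close> below.\<close>

definition faithfully_flat_module :: "('r, 'c) ring_scheme \<Rightarrow> ('r, 'a, 'd) module_scheme \<Rightarrow> bool"
  where "faithfully_flat_module R A \<longleftrightarrow> module R A \<and>
    (\<forall>(N1 :: ('r, (nat \<Rightarrow> 'r) set) module) (N2 :: ('r, (nat \<Rightarrow> 'r) set) module)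
      (N3 :: ('r, (nat \<Rightarrow> 'r) set) module) f g.
      module R N1 \<and> module R N2 \<and> module R N3 \<and>
      f \<in> linear_maps R N1 N2 \<and> g \<in> linear_maps R N2 N3 \<and>
      (\<forall>x\<in>carrier N1. g (f x) = \<zero>\<^bsub>N3\<^esub>) \<longrightarrow>
      (exact_at (add_monoid N1) (add_monoid N2) (add_monoid N3) f g \<longleftrightarrow>
       exact_at (tensor_group R A N1) (tensor_group R A N2) (tensor_group R A N3)
         (tensor_map R A N2 (\<lambda>a. a) f) (tensor_map R A N3 (\<lambda>a. a) g)))"

definition faithfully_flat_ring_hom ::
    "('r, 'c) ring_scheme \<Rightarrow> ('s, 'd) ring_scheme \<Rightarrow> ('r \<Rightarrow> 's) \<Rightarrow> bool"
  where "faithfully_flat_ring_hom R S h \<longleftrightarrow>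
    h \<in> ring_hom R S \<and> faithfully_flat_module R (restrict_scalars h S)"


section \<open>Projectivity\<close>

text \<open>The lifting property against surjections. Again the types of \<open>M\<close> and \<open>N\<close> must be fixed;
  \<^typ>\<open>'p \<Rightarrow> 'r\<close> has room for the free module on the carrier of \<open>P\<close>, and lifting for modules on
  arbitrary types follows: see \<open>projective_module_lift\<close> below.\<close>

definition projective_module :: "('r, 'c) ring_scheme \<Rightarrow> ('r, 'p, 'd) module_scheme \<Rightarrow> bool"
  where "projective_module R P \<longleftrightarrow> module R P \<and>
    (\<forall>(M :: ('r, 'p \<Rightarrow> 'r) module) (N :: ('r, 'p) module) g f.
      module R M \<and> module R N \<and> g \<in> linear_maps R M N \<and> g ` carrier M = carrier N \<and>
      f \<in> linear_maps R P N \<longrightarrow>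
      (\<exists>t\<in>linear_maps R P M. \<forall>x\<in>carrier P. g (t x) = f x))"


section \<open>The definitions are well behaved\<close>

subsection \<open>Basic facts\<close>

lemma linear_mapsD:
  assumes "f \<in> linear_maps R M N"
  shows "x \<in> carrier M \<Longrightarrow> f x \<in> carrier N"
    and "x \<in> carrier M \<Longrightarrow> y \<in> carrier M \<Longrightarrow> f (x \<oplus>\<^bsub>M\<^esub> y) = f x \<oplus>\<^bsub>N\<^esub> f y"
    and "r \<in> carrier R \<Longrightarrow> x \<in> carrier M \<Longrightarrow> f (r \<odot>\<^bsub>M\<^esub> x) = r \<odot>\<^bsub>N\<^esub> f x"
  using assms by (auto simp: linear_maps_def)

lemma linear_mapsI:
  assumes "\<And>x. x \<in> carrier M \<Longrightarrow> f x \<in> carrier N"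
    and "\<And>x y. x \<in> carrier M \<Longrightarrow> y \<in> carrier M \<Longrightarrow> f (x \<oplus>\<^bsub>M\<^esub> y) = f x \<oplus>\<^bsub>N\<^esub> f y"
    and "\<And>r x. r \<in> carrier R \<Longrightarrow> x \<in> carrier M \<Longrightarrow> f (r \<odot>\<^bsub>M\<^esub> x) = r \<odot>\<^bsub>N\<^esub> f x"
  shows "f \<in> linear_maps R M N"
  using assms by (auto simp: linear_maps_def)

lemma linear_maps_zero:
  assumes "f \<in> linear_maps R M N" "module R M" "module R N"
  shows "f \<zero>\<^bsub>M\<^esub> = \<zero>\<^bsub>N\<^esub>"
proof -
  interpret M: module R M by fact
  interpret N: module R N by fact
  have "f (\<zero>\<^bsub>R\<^esub> \<odot>\<^bsub>M\<^esub> \<zero>\<^bsub>M\<^esub>) = \<zero>\<^bsub>R\<^esub> \<odot>\<^bsub>N\<^esub> f \<zero>\<^bsub>M\<^esub>"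
    using linear_mapsD(3)[OF assms(1)] by blast
  then show ?thesis
    using linear_mapsD(1)[OF assms(1), of "\<zero>\<^bsub>M\<^esub>"] by simp
qed

lemma linear_maps_comp:
  assumes "f \<in> linear_maps R M N" "g \<in> linear_maps R N K"
  shows "(\<lambda>x. g (f x)) \<in> linear_maps R M K"
  using assms by (auto simp: linear_maps_def Pi_iff)

lemma linear_maps_id: "(\<lambda>x. x) \<in> linear_maps R M M"
  by (auto simp: linear_maps_def)

lemma keys_frag_diff3:
  assumes "p \<in> S" "q \<in> S" "r \<in> S"
  shows "Poly_Mapping.keys (frag_of p - frag_of q - frag_of r) \<subseteq> S"
  using assms keys_diff[of "frag_of p - frag_of q" "frag_of r"] keys_diff[of "frag_of p" "frag_of q"]
  by (auto simp: keys_frag_of)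

lemma keys_frag_diff2:
  assumes "p \<in> S" "q \<in> S"
  shows "Poly_Mapping.keys (frag_of p - frag_of q) \<subseteq> S"
  using assms keys_diff[of "frag_of p" "frag_of q"] by (auto simp: keys_frag_of)

lemma tensor_relsI:
  "a \<in> carrier A \<Longrightarrow> b \<in> carrier A \<Longrightarrow> m \<in> carrier M \<Longrightarrow>
    frag_of (a \<oplus>\<^bsub>A\<^esub> b, m) - frag_of (a, m) - frag_of (b, m) \<in> tensor_rels R A M"
  "a \<in> carrier A \<Longrightarrow> m \<in> carrier M \<Longrightarrow> n \<in> carrier M \<Longrightarrow>
    frag_of (a, m \<oplus>\<^bsub>M\<^esub> n) - frag_of (a, m) - frag_of (a, n) \<in> tensor_rels R A M"
  "r \<in> carrier R \<Longrightarrow> a \<in> carrier A \<Longrightarrow> m \<in> carrier M \<Longrightarrow>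
    frag_of (r \<odot>\<^bsub>A\<^esub> a, m) - frag_of (a, r \<odot>\<^bsub>M\<^esub> m) \<in> tensor_rels R A M"
  unfolding tensor_rels_def by blast+

lemma tensor_relsE [consumes 1, case_names add_left add_right smult]:
  assumes "x \<in> tensor_rels R A M"
  obtains a b m where "x = frag_of (a \<oplus>\<^bsub>A\<^esub> b, m) - frag_of (a, m) - frag_of (b, m)"
      "a \<in> carrier A" "b \<in> carrier A" "m \<in> carrier M"
    | a m n where "x = frag_of (a, m \<oplus>\<^bsub>M\<^esub> n) - frag_of (a, m) - frag_of (a, n)"
      "a \<in> carrier A" "m \<in> carrier M" "n \<in> carrier M"
    | r a m where "x = frag_of (r \<odot>\<^bsub>A\<^esub> a, m) - frag_of (a, r \<odot>\<^bsub>M\<^esub> m)"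
      "r \<in> carrier R" "a \<in> carrier A" "m \<in> carrier M"
  using assms unfolding tensor_rels_def by blast

lemma tensor_rels_subset:
  assumes "module R A" "module R M"
  shows "tensor_rels R A M \<subseteq> carrier (free_Abelian_group (carrier A \<times> carrier M))"
proof -
  interpret A: module R A by fact
  interpret M: module R M by fact
  have "Poly_Mapping.keys x \<subseteq> carrier A \<times> carrier M" if "x \<in> tensor_rels R A M" for x
    using that
  proof (cases rule: tensor_relsE)
    case (add_left a b m)
    then show ?thesis by (simp only:, intro keys_frag_diff3) simp_all
  next
    case (add_right a m n)
    then show ?thesis by (simp only:, intro keys_frag_diff3) simp_all
  next
    case (smult r a m)
    then show ?thesis by (simp only:, intro keys_frag_diff2) simp_all
  qed
  then show ?thesis by (simp add: subset_iff)
qed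

lemma tensor_null_subgroup:
  assumes "module R A" "module R M"
  shows "subgroup (tensor_null R A M) (free_Abelian_group (carrier A \<times> carrier M))"
  unfolding tensor_null_def
  by (rule group.generate_is_subgroup[OF group_free_Abelian_group tensor_rels_subset[OF assms]])

lemma tensor_null_keys:
  assumes "module R A" "module R M" "x \<in> tensor_null R A M"
  shows "Poly_Mapping.keys x \<subseteq> carrier A \<times> carrier M"
  using subgroup.mem_carrier[OF tensor_null_subgroup[OF assms(1,2)] assms(3)] by simp

lemma tensor_null_0: "0 \<in> tensor_null R A M"
  unfolding tensor_null_def
  using generate.one[of "free_Abelian_group (carrier A \<times> carrier M)" "tensor_rels R A M"] by simp

lemma tensor_null_rels: "x \<in> tensor_rels R A M \<Longrightarrow> x \<in> tensor_null R A M"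
  unfolding tensor_null_def by (rule generate.incl)

lemma tensor_null_add: "x \<in> tensor_null R A M \<Longrightarrow> y \<in> tensor_null R A M \<Longrightarrow> x + y \<in> tensor_null R A M"
  unfolding tensor_null_def using generate.eng by fastforce

lemma tensor_null_uminus:
  assumes "module R A" "module R M" "x \<in> tensor_null R A M"
  shows "- x \<in> tensor_null R A M"
  using subgroup.m_inv_closed[OF tensor_null_subgroup[OF assms(1,2)] assms(3)]
    inv_free_Abelian_group[OF tensor_null_keys[OF assms]] by simp

lemma tensor_null_diff:
  assumes "module R A" "module R M" "x \<in> tensor_null R A M" "y \<in> tensor_null R A M"
  shows "x - y \<in> tensor_null R A M"
  using tensor_null_add[OF assms(3) tensor_null_uminus[OF assms(1,2,4)]] by simp

lemma tensor_null_induct [consumes 3, case_names zero rels add uminus]: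
  assumes "module R A" "module R M" "x \<in> tensor_null R A M"
    and "Q 0" and rels: "\<And>x. x \<in> tensor_rels R A M \<Longrightarrow> Q x"
    and "\<And>x y. x \<in> tensor_null R A M \<Longrightarrow> y \<in> tensor_null R A M \<Longrightarrow> Q x \<Longrightarrow> Q y \<Longrightarrow> Q (x + y)"
    and uminus: "\<And>x. x \<in> tensor_null R A M \<Longrightarrow> Q x \<Longrightarrow> Q (- x)"
  shows "Q x"
  using assms(3) unfolding tensor_null_def
proof (induction rule: generate.induct)
  case one
  then show ?case using assms(4) by simp
next
  case (incl h)
  then show ?case using rels by simp
next
  case (inv h)
  then have "Poly_Mapping.keys h \<subseteq> carrier A \<times> carrier M"
    using subsetD[OF tensor_rels_subset[OF assms(1,2)] inv] by simp
  then show ?case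
    using uminus[OF tensor_null_rels[OF inv] rels[OF inv]] by simp
next
  case (eng h1 h2)
  then show ?case using assms(6) by (simp add: tensor_null_def)
qed

lemma frag_tensor_0 [simp]: "frag_tensor u f 0 = 0"
  by (simp add: frag_tensor_def)

lemma frag_tensor_of [simp]: "frag_tensor u f (frag_of (a, m)) = frag_of (u a, f m)"
  by (simp add: frag_tensor_def)

lemma frag_tensor_add: "frag_tensor u f (x + y) = frag_tensor u f x + frag_tensor u f y"
  by (simp add: frag_tensor_def frag_extend_add)

lemma frag_tensor_diff: "frag_tensor u f (x - y) = frag_tensor u f x - frag_tensor u f y"
  by (simp add: frag_tensor_def frag_extend_diff)

lemma frag_tensor_uminus: "frag_tensor u f (- x) = - frag_tensor u f x"
  by (simp add: frag_tensor_def frag_extend_minus)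

lemma frag_tensor_keys:
  assumes "Poly_Mapping.keys x \<subseteq> A \<times> M" "\<And>a. a \<in> A \<Longrightarrow> u a \<in> B" "\<And>m. m \<in> M \<Longrightarrow> f m \<in> N"
  shows "Poly_Mapping.keys (frag_tensor u f x) \<subseteq> B \<times> N"
  using keys_frag_extend[of "\<lambda>(a, m). frag_of (u a, f m)" x] assms
  unfolding frag_tensor_def by (fastforce simp: keys_frag_of)

lemma frag_tensor_cong:
  assumes "Poly_Mapping.keys x \<subseteq> A \<times> M" "\<And>a. a \<in> A \<Longrightarrow> u a = v a" "\<And>m. m \<in> M \<Longrightarrow> f m = g m"
  shows "frag_tensor u f x = frag_tensor v g x"
  unfolding frag_tensor_def by (rule frag_extend_eq) (use assms in auto)

lemma frag_tensor_comp: "frag_tensor v g (frag_tensor u f x) = frag_tensor (\<lambda>a. v (u a)) (\<lambda>m. g (f m)) x"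
proof -
  have "Poly_Mapping.keys x \<subseteq> UNIV" by simp
  then show ?thesis
    by (induction x rule: frag_induction) (auto simp: frag_tensor_diff)
qed

lemma frag_tensor_id: "frag_tensor (\<lambda>a. a) (\<lambda>m. m) x = x"
proof -
  have "Poly_Mapping.keys x \<subseteq> UNIV" by simp
  then show ?thesis
    by (induction x rule: frag_induction) (auto simp: frag_tensor_diff)
qed

lemma frag_tensor_null:
  assumes "module R A" "module R M" "module R B" "module R N"
    and u: "u \<in> linear_maps R A B" and f: "f \<in> linear_maps R M N"
    and "x \<in> tensor_null R A M"
  shows "frag_tensor u f x \<in> tensor_null R B N"
  using assms(1,2,7)
proof (induction rule: tensor_null_induct)
  case zero
  then show ?case by (simp add: tensor_null_0)
next
  case (rels x)
  then have "frag_tensor u f x \<in> tensor_rels R B N"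
  proof (cases rule: tensor_relsE)
    case (add_left a b m)
    then show ?thesis
      using linear_mapsD[OF u] linear_mapsD[OF f] by (simp add: frag_tensor_diff tensor_relsI(1))
  next
    case (add_right a m n)
    then show ?thesis
      using linear_mapsD[OF u] linear_mapsD[OF f] by (simp add: frag_tensor_diff tensor_relsI(2))
  next
    case (smult r a m)
    then show ?thesis
      using linear_mapsD[OF u] linear_mapsD[OF f] by (simp add: frag_tensor_diff tensor_relsI(3))
  qed
  then show ?case by (rule tensor_null_rels)
next
  case (add x y)
  then show ?case by (simp add: frag_tensor_add tensor_null_add)
next
  case (uminus x)
  then show ?case by (simp add: frag_tensor_uminus tensor_null_uminus[OF assms(3,4)])
qed

lemma tensor_class_eq: "tensor_class R A M x = {n + x | n. n \<in> tensor_null R A M}"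
  by (auto simp: tensor_class_def r_coset_def)

lemma tensor_class_eq_iff:
  assumes "module R A" "module R M"
  shows "tensor_class R A M x = tensor_class R A M y \<longleftrightarrow> x - y \<in> tensor_null R A M"
proof
  assume "tensor_class R A M x = tensor_class R A M y"
  moreover have "0 + x \<in> tensor_class R A M x"
    using tensor_null_0 unfolding tensor_class_eq by blast
  ultimately have "x \<in> tensor_class R A M y" by simp
  then show "x - y \<in> tensor_null R A M"
    unfolding tensor_class_eq by auto
next
  have *: "tensor_class R A M x \<subseteq> tensor_class R A M y" if d: "x - y \<in> tensor_null R A M" for x y
  proof
    fix z assume "z \<in> tensor_class R A M x"
    then obtain n where "n \<in> tensor_null R A M" "z = n + x"
      unfolding tensor_class_eq by blast
    then have "z = (n + (x - y)) + y" "n + (x - y) \<in> tensor_null R A M"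
      using tensor_null_add[OF _ d] by simp_all
    then show "z \<in> tensor_class R A M y"
      unfolding tensor_class_eq by blast
  qed
  assume d: "x - y \<in> tensor_null R A M"
  then have "y - x \<in> tensor_null R A M"
    using tensor_null_uminus[OF assms d] by simp
  with d * show "tensor_class R A M x = tensor_class R A M y" by blast
qed

lemma tensor_class_0: "tensor_class R A M 0 = tensor_null R A M"
  by (simp add: tensor_class_eq)

lemma tensor_class_null_iff:
  assumes "module R A" "module R M"
  shows "tensor_class R A M x = tensor_null R A M \<longleftrightarrow> x \<in> tensor_null R A M"
  using tensor_class_eq_iff[OF assms, of x 0] by (simp add: tensor_class_0)

lemma tensor_map_class:
  assumes "module R A" "module R M" "module R B" "module R N"
    and u: "u \<in> linear_maps R A B" and f: "f \<in> linear_maps R M N"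
  shows "tensor_map R B N u f (tensor_class R A M x) = tensor_class R B N (frag_tensor u f x)"
proof -
  have "tensor_class R B N (frag_tensor u f (n + x)) = tensor_class R B N (frag_tensor u f x)"
    if "n \<in> tensor_null R A M" for n
    using frag_tensor_null[OF assms that] by (simp add: tensor_class_eq_iff[OF assms(3,4)] frag_tensor_add)
  moreover have "tensor_null R A M \<noteq> {}" using tensor_null_0 by blast
  ultimately show ?thesis
    unfolding tensor_map_def tensor_class_eq[of R A M] by blast
qed

lemma carrier_tensor_group:
  "carrier (tensor_group R A M) =
    tensor_class R A M ` {x. Poly_Mapping.keys x \<subseteq> carrier A \<times> carrier M}"
  unfolding tensor_group_def carrier_FactGroup tensor_class_def
  by (rule image_cong) (simp_all add: free_Abelian_group_def)

lemma one_tensor_group: "\<one>\<^bsub>tensor_group R A M\<^esub> = tensor_null R A M"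
  by (simp add: tensor_group_def)

lemma mult_tensor_group:
  assumes "module R A" "module R M"
  shows "tensor_class R A M x \<otimes>\<^bsub>tensor_group R A M\<^esub> tensor_class R A M y = tensor_class R A M (x + y)"
proof -
  have "{n + x | n. n \<in> tensor_null R A M} <#>\<^bsub>free_Abelian_group (carrier A \<times> carrier M)\<^esub>
      {n + y | n. n \<in> tensor_null R A M} = {n + (x + y) | n. n \<in> tensor_null R A M}"
    (is "?l = ?r")
  proof
    show "?l \<subseteq> ?r"
    proof
      fix z assume "z \<in> ?l"
      then obtain n m where "z = (n + x) + (m + y)" "n \<in> tensor_null R A M" "m \<in> tensor_null R A M"
        by (auto simp: set_mult_def)
      then have "z = (n + m) + (x + y)" "n + m \<in> tensor_null R A M"
        by (simp_all add: algebra_simps tensor_null_add)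
      then show "z \<in> ?r" by blast
    qed
    show "?r \<subseteq> ?l"
    proof
      fix z assume "z \<in> ?r"
      then obtain n where "z = (n + x) + (0 + y)" "n \<in> tensor_null R A M"
        by (auto simp: algebra_simps)
      then show "z \<in> ?l"
        using tensor_null_0[of R A M] unfolding set_mult_def mult_free_Abelian_group by blast
    qed
  qed
  then show ?thesis
    by (simp add: tensor_group_def tensor_class_eq)
qed

lemma tensor_group_comm_group:
  assumes "module R A" "module R M"
  shows "comm_group (tensor_group R A M)"
  unfolding tensor_group_def
  by (rule comm_group.abelian_FactGroup[OF abelian_free_Abelian_group tensor_null_subgroup[OF assms]])

lemma module_of_group_simps [simp]:
  "carrier (module_of_group G act) = carrier G"
  "\<zero>\<^bsub>module_of_group G act\<^esub> = \<one>\<^bsub>G\<^esub>"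
  "ring.add (module_of_group G act) = (\<otimes>\<^bsub>G\<^esub>)"
  "smult (module_of_group G act) = act"
  by (simp_all add: module_of_group_def)

lemma module_of_group_abelian_group:
  assumes "comm_group G"
  shows "abelian_group (module_of_group G act)"
proof -
  interpret comm_group G by fact
  show ?thesis
    by (rule abelian_groupI) (auto simp: m_ac intro: l_inv_ex)
qed

lemma restrict_scalars_module:
  assumes "cring R" "cring S" "h \<in> ring_hom R S"
  shows "module R (restrict_scalars h S)"
proof -
  interpret R: cring R by fact
  interpret S: cring S by fact
  interpret h: ring_hom_cring R S h
    using assms by unfold_locales (auto simp: ring_hom_cring_def)
  show ?thesis
    unfolding restrict_scalars_def
    by (rule moduleI)
      (auto intro!: module_of_group_abelian_group S.a_comm_group assms(1)
        simp: S.l_distr S.r_distr S.m_assoc)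
qed

lemma base_change_module:
  assumes "cring R" "cring S" "h \<in> ring_hom R S" "module R M"
  shows "module S (base_change R S h M)"
proof -
  interpret R: cring R by fact
  interpret S: cring S by fact
  define A where "A = restrict_scalars h S"
  have A: "module R A"
    unfolding A_def by (rule restrict_scalars_module) fact+
  have hc: "h r \<in> carrier S" if "r \<in> carrier R" for r
    using assms(3) that by (auto simp: ring_hom_def)
  have A_simps: "carrier A = carrier S" "ring.add A = ring.add S" "smult A = (\<lambda>r s. h r \<otimes>\<^bsub>S\<^esub> s)"
    by (auto simp: A_def restrict_scalars_def)
  have lin: "(\<lambda>t. s \<otimes>\<^bsub>S\<^esub> t) \<in> linear_maps R A A" if "s \<in> carrier S" for s
    using that hc by (auto intro!: linear_mapsI simp: A_simps S.r_distr S.m_lcomm)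
  have act: "tensor_map R A M (\<lambda>t. s \<otimes>\<^bsub>S\<^esub> t) (\<lambda>m. m) (tensor_class R A M x) =
      tensor_class R A M (frag_tensor (\<lambda>t. s \<otimes>\<^bsub>S\<^esub> t) (\<lambda>m. m) x)" if "s \<in> carrier S" for s x
    by (rule tensor_map_class[OF A assms(4) A assms(4) lin[OF that] linear_maps_id])
  have keys: "Poly_Mapping.keys (frag_tensor (\<lambda>t. s \<otimes>\<^bsub>S\<^esub> t) (\<lambda>m. m) x) \<subseteq> carrier A \<times> carrier M"
    if "s \<in> carrier S" "Poly_Mapping.keys x \<subseteq> carrier A \<times> carrier M" for s x
    by (rule frag_tensor_keys[OF that(2)]) (use that in \<open>auto simp: A_simps\<close>)
  have distr: "frag_tensor (\<lambda>t. (s \<oplus>\<^bsub>S\<^esub> s') \<otimes>\<^bsub>S\<^esub> t) (\<lambda>m. m) x -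
      (frag_tensor (\<lambda>t. s \<otimes>\<^bsub>S\<^esub> t) (\<lambda>m. m) x + frag_tensor (\<lambda>t. s' \<otimes>\<^bsub>S\<^esub> t) (\<lambda>m. m) x) \<in> tensor_null R A M"
    if s: "s \<in> carrier S" "s' \<in> carrier S" and x: "Poly_Mapping.keys x \<subseteq> carrier A \<times> carrier M" for s s' x
    using x
  proof (induction x rule: frag_induction)
    case zero
    then show ?case by (simp add: tensor_null_0)
  next
    case (one p)
    obtain a m where p: "p = (a, m)" by (cases p)
    with one have am: "a \<in> carrier S" "m \<in> carrier M" by (auto simp: A_simps)
    have "frag_of ((s \<otimes>\<^bsub>S\<^esub> a) \<oplus>\<^bsub>A\<^esub> (s' \<otimes>\<^bsub>S\<^esub> a), m) - frag_of (s \<otimes>\<^bsub>S\<^esub> a, m) - frag_of (s' \<otimes>\<^bsub>S\<^esub> a, m)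
      \<in> tensor_rels R A M"
      unfolding tensor_rels_def using s am A_simps by blast
    then show ?case
      using s am by (auto simp: p A_simps S.l_distr diff_diff_eq intro: tensor_null_rels)
  next
    case (diff x y)
    show ?case
      using tensor_null_diff[OF A assms(4) diff(1,2)] by (simp add: frag_tensor_diff algebra_simps)
  qed
  have "module S (module_of_group (tensor_group R A M) (\<lambda>s. tensor_map R A M (\<lambda>t. s \<otimes>\<^bsub>S\<^esub> t) (\<lambda>m. m)))"
  proof (rule moduleI, unfold module_of_group_simps)
    fix s C assume "s \<in> carrier S" "C \<in> carrier (tensor_group R A M)"
    then show "tensor_map R A M (\<lambda>t. s \<otimes>\<^bsub>S\<^esub> t) (\<lambda>m. m) C \<in> carrier (tensor_group R A M)"
      using keys by (auto simp: carrier_tensor_group act)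
  next
    fix s s' C assume s: "s \<in> carrier S" "s' \<in> carrier S" and "C \<in> carrier (tensor_group R A M)"
    then obtain x where x: "C = tensor_class R A M x" "Poly_Mapping.keys x \<subseteq> carrier A \<times> carrier M"
      by (auto simp: carrier_tensor_group)
    show "tensor_map R A M (\<lambda>t. (s \<oplus>\<^bsub>S\<^esub> s') \<otimes>\<^bsub>S\<^esub> t) (\<lambda>m. m) C =
      tensor_map R A M (\<lambda>t. s \<otimes>\<^bsub>S\<^esub> t) (\<lambda>m. m) C \<otimes>\<^bsub>tensor_group R A M\<^esub>
      tensor_map R A M (\<lambda>t. s' \<otimes>\<^bsub>S\<^esub> t) (\<lambda>m. m) C"
      using s distr[OF s x(2)]
      by (simp add: x(1) act mult_tensor_group[OF A assms(4)] tensor_class_eq_iff[OF A assms(4)])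
    have "frag_tensor (\<lambda>t. (s \<otimes>\<^bsub>S\<^esub> s') \<otimes>\<^bsub>S\<^esub> t) (\<lambda>m. m) x =
      frag_tensor (\<lambda>t. s \<otimes>\<^bsub>S\<^esub> (s' \<otimes>\<^bsub>S\<^esub> t)) (\<lambda>m. m) x"
      by (rule frag_tensor_cong[OF x(2)]) (use s in \<open>auto simp: A_simps S.m_assoc\<close>)
    then show "tensor_map R A M (\<lambda>t. (s \<otimes>\<^bsub>S\<^esub> s') \<otimes>\<^bsub>S\<^esub> t) (\<lambda>m. m) C =
      tensor_map R A M (\<lambda>t. s \<otimes>\<^bsub>S\<^esub> t) (\<lambda>m. m) (tensor_map R A M (\<lambda>t. s' \<otimes>\<^bsub>S\<^esub> t) (\<lambda>m. m) C)"
      using s by (simp add: x(1) act frag_tensor_comp)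
  next
    fix s C D assume s: "s \<in> carrier S"
      and "C \<in> carrier (tensor_group R A M)" "D \<in> carrier (tensor_group R A M)"
    then obtain x y where "C = tensor_class R A M x" "D = tensor_class R A M y"
      by (auto simp: carrier_tensor_group)
    with s show "tensor_map R A M (\<lambda>t. s \<otimes>\<^bsub>S\<^esub> t) (\<lambda>m. m) (C \<otimes>\<^bsub>tensor_group R A M\<^esub> D) =
      tensor_map R A M (\<lambda>t. s \<otimes>\<^bsub>S\<^esub> t) (\<lambda>m. m) C \<otimes>\<^bsub>tensor_group R A M\<^esub>
      tensor_map R A M (\<lambda>t. s \<otimes>\<^bsub>S\<^esub> t) (\<lambda>m. m) D"
      by (simp add: act mult_tensor_group[OF A assms(4)] frag_tensor_add)
  next
    fix C assume "C \<in> carrier (tensor_group R A M)"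
    then obtain x where x: "C = tensor_class R A M x" "Poly_Mapping.keys x \<subseteq> carrier A \<times> carrier M"
      by (auto simp: carrier_tensor_group)
    have "frag_tensor (\<lambda>t. \<one>\<^bsub>S\<^esub> \<otimes>\<^bsub>S\<^esub> t) (\<lambda>m. m) x = frag_tensor (\<lambda>t. t) (\<lambda>m. m) x"
      by (rule frag_tensor_cong[OF x(2)]) (auto simp: A_simps)
    then show "tensor_map R A M (\<lambda>t. \<one>\<^bsub>S\<^esub> \<otimes>\<^bsub>S\<^esub> t) (\<lambda>m. m) C = C"
      by (simp add: x(1) act frag_tensor_id)
  qed (auto intro: assms module_of_group_abelian_group tensor_group_comm_group A)
  then show ?thesis
    by (simp add: base_change_def A_def)
qed

subsection \<open>Lifting for modules on arbitrary types\<close>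

definition free_module :: "('r, 'c) ring_scheme \<Rightarrow> 'p set \<Rightarrow> ('r, 'p \<Rightarrow> 'r) module"
  where "free_module R B =
    module_of_group
      \<lparr>carrier = {c. range c \<subseteq> carrier R \<and> finite {p. c p \<noteq> \<zero>\<^bsub>R\<^esub>} \<and> {p. c p \<noteq> \<zero>\<^bsub>R\<^esub>} \<subseteq> B},
       monoid.mult = (\<lambda>c d p. c p \<oplus>\<^bsub>R\<^esub> d p), one = (\<lambda>p. \<zero>\<^bsub>R\<^esub>)\<rparr>
      (\<lambda>r c p. r \<otimes>\<^bsub>R\<^esub> c p)"

definition lincomb :: "('r, 'c) ring_scheme \<Rightarrow> ('r, 'm, 'd) module_scheme \<Rightarrow> ('p \<Rightarrow> 'm) \<Rightarrow> ('p \<Rightarrow> 'r) \<Rightarrow> 'm"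
  where "lincomb R M m c = (\<Oplus>\<^bsub>M\<^esub>p\<in>{p. c p \<noteq> \<zero>\<^bsub>R\<^esub>}. c p \<odot>\<^bsub>M\<^esub> m p)"

lemma free_module_simps:
  "carrier (free_module R B) =
    {c. range c \<subseteq> carrier R \<and> finite {p. c p \<noteq> \<zero>\<^bsub>R\<^esub>} \<and> {p. c p \<noteq> \<zero>\<^bsub>R\<^esub>} \<subseteq> B}"
  "c \<oplus>\<^bsub>free_module R B\<^esub> d = (\<lambda>p. c p \<oplus>\<^bsub>R\<^esub> d p)"
  "\<zero>\<^bsub>free_module R B\<^esub> = (\<lambda>p. \<zero>\<^bsub>R\<^esub>)"
  "r \<odot>\<^bsub>free_module R B\<^esub> c = (\<lambda>p. r \<otimes>\<^bsub>R\<^esub> c p)"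
  by (simp_all add: free_module_def)

lemma free_module_module:
  assumes "cring R"
  shows "module R (free_module R B)"
proof -
  interpret R: cring R by fact
  have cl: "c p \<in> carrier R" if "c \<in> carrier (free_module R B)" for c p
    using that by (auto simp: free_module_simps)
  have add: "c \<oplus>\<^bsub>free_module R B\<^esub> d \<in> carrier (free_module R B)"
    if "c \<in> carrier (free_module R B)" "d \<in> carrier (free_module R B)" for c d
  proof -
    have "{p. c p \<oplus>\<^bsub>R\<^esub> d p \<noteq> \<zero>\<^bsub>R\<^esub>} \<subseteq> {p. c p \<noteq> \<zero>\<^bsub>R\<^esub>} \<union> {p. d p \<noteq> \<zero>\<^bsub>R\<^esub>}" by auto
    moreover have "finite ({p. c p \<noteq> \<zero>\<^bsub>R\<^esub>} \<union> {p. d p \<noteq> \<zero>\<^bsub>R\<^esub>})"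
      using that by (auto simp: free_module_simps)
    ultimately show ?thesis
      using that cl[OF that(1)] cl[OF that(2)] finite_subset
      unfolding free_module_simps by blast
  qed
  have smult: "r \<odot>\<^bsub>free_module R B\<^esub> c \<in> carrier (free_module R B)"
    if "r \<in> carrier R" "c \<in> carrier (free_module R B)" for r c
  proof -
    have "{p. r \<otimes>\<^bsub>R\<^esub> c p \<noteq> \<zero>\<^bsub>R\<^esub>} \<subseteq> {p. c p \<noteq> \<zero>\<^bsub>R\<^esub>}" using that by auto
    moreover have "finite {p. c p \<noteq> \<zero>\<^bsub>R\<^esub>}" using that by (auto simp: free_module_simps)
    ultimately show ?thesis
      using that cl[OF that(2)] finite_subset
      unfolding free_module_simps by blast
  qed
  show ?thesis
  proof (rule moduleI)
    show "abelian_group (free_module R B)"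
    proof (rule abelian_groupI)
      fix c assume c: "c \<in> carrier (free_module R B)"
      show "\<exists>d\<in>carrier (free_module R B). d \<oplus>\<^bsub>free_module R B\<^esub> c = \<zero>\<^bsub>free_module R B\<^esub>"
        by (rule bexI[OF _ smult[of "\<ominus>\<^bsub>R\<^esub> \<one>\<^bsub>R\<^esub>", OF _ c]])
          (use cl[OF c] in \<open>auto simp: free_module_simps R.l_minus R.l_neg\<close>)
    qed (use add cl in \<open>auto simp: free_module_simps R.a_ac\<close>)
  qed (use assms add smult cl in \<open>auto simp: free_module_simps R.l_distr R.r_distr R.m_assoc\<close>)
qed

lemma lincomb_superset:
  assumes "module R M" "\<And>p. p \<in> B \<Longrightarrow> m p \<in> carrier M" "range c \<subseteq> carrier R"
    and "finite B" "{p. c p \<noteq> \<zero>\<^bsub>R\<^esub>} \<subseteq> B"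
  shows "lincomb R M m c = (\<Oplus>\<^bsub>M\<^esub>p\<in>B. c p \<odot>\<^bsub>M\<^esub> m p)"
proof -
  interpret M: module R M by fact
  have "c p \<in> carrier R" for p using assms(3) by auto
  then show ?thesis
    unfolding lincomb_def
    by (intro M.add.finprod_mono_neutral_cong_left) (use assms in auto)
qed

lemma lincomb_linear:
  assumes M: "module R M" and m: "\<And>p. p \<in> B \<Longrightarrow> m p \<in> carrier M"
  shows "lincomb R M m \<in> linear_maps R (free_module R B) M"
proof (rule linear_mapsI)
  interpret M: module R M by fact
  interpret F: module R "free_module R B" by (rule free_module_module[OF M.R.is_cring])
  fix c assume c: "c \<in> carrier (free_module R B)"
  then show "lincomb R M m c \<in> carrier M"
    unfolding lincomb_def using m
    by (intro M.finsum_closed) (auto simp: free_module_simps image_subset_iff subset_iff)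
  {
    fix d assume d: "d \<in> carrier (free_module R B)"
    define D where "D = {p. c p \<noteq> \<zero>\<^bsub>R\<^esub>} \<union> {p. d p \<noteq> \<zero>\<^bsub>R\<^esub>}"
    have D: "finite D" "D \<subseteq> B"
      using c d by (auto simp: D_def free_module_simps)
    have mD: "p \<in> D \<Longrightarrow> m p \<in> carrier M" for p using m D by auto
    have r: "range c \<subseteq> carrier R" "range d \<subseteq> carrier R" using c d by (auto simp: free_module_simps)
    then have r3: "range (\<lambda>p. c p \<oplus>\<^bsub>R\<^esub> d p) \<subseteq> carrier R" by auto
    have "lincomb R M m (\<lambda>p. c p \<oplus>\<^bsub>R\<^esub> d p) = (\<Oplus>\<^bsub>M\<^esub>p\<in>D. (c p \<oplus>\<^bsub>R\<^esub> d p) \<odot>\<^bsub>M\<^esub> m p)"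
      by (rule lincomb_superset[OF M mD r3 D(1)]) (auto simp: D_def)
    also have "\<dots> = (\<Oplus>\<^bsub>M\<^esub>p\<in>D. c p \<odot>\<^bsub>M\<^esub> m p \<oplus>\<^bsub>M\<^esub> d p \<odot>\<^bsub>M\<^esub> m p)"
      by (rule M.finsum_cong') (use mD r[THEN range_subsetD] in \<open>auto simp: M.smult_l_distr\<close>)
    also have "\<dots> = (\<Oplus>\<^bsub>M\<^esub>p\<in>D. c p \<odot>\<^bsub>M\<^esub> m p) \<oplus>\<^bsub>M\<^esub> (\<Oplus>\<^bsub>M\<^esub>p\<in>D. d p \<odot>\<^bsub>M\<^esub> m p)"
      by (rule M.finsum_addf) (use mD r[THEN range_subsetD] in auto)
    also have "(\<Oplus>\<^bsub>M\<^esub>p\<in>D. c p \<odot>\<^bsub>M\<^esub> m p) = lincomb R M m c"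
      by (rule lincomb_superset[OF M mD r(1) D(1), symmetric]) (auto simp: D_def)
    also have "(\<Oplus>\<^bsub>M\<^esub>p\<in>D. d p \<odot>\<^bsub>M\<^esub> m p) = lincomb R M m d"
      by (rule lincomb_superset[OF M mD r(2) D(1), symmetric]) (auto simp: D_def)
    finally show "lincomb R M m (c \<oplus>\<^bsub>free_module R B\<^esub> d) = lincomb R M m c \<oplus>\<^bsub>M\<^esub> lincomb R M m d"
      by (simp add: free_module_simps)
  }
  fix r assume s: "r \<in> carrier R"
  define D where "D = {p. c p \<noteq> \<zero>\<^bsub>R\<^esub>}"
  have D: "finite D" "D \<subseteq> B"
    using c by (auto simp: D_def free_module_simps)
  have mD: "p \<in> D \<Longrightarrow> m p \<in> carrier M" for p using m D by auto
  have r: "range c \<subseteq> carrier R" using c by (auto simp: free_module_simps)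
  then have r2: "range (\<lambda>p. r \<otimes>\<^bsub>R\<^esub> c p) \<subseteq> carrier R" using s by auto
  have "lincomb R M m (\<lambda>p. r \<otimes>\<^bsub>R\<^esub> c p) = (\<Oplus>\<^bsub>M\<^esub>p\<in>D. (r \<otimes>\<^bsub>R\<^esub> c p) \<odot>\<^bsub>M\<^esub> m p)"
    by (rule lincomb_superset[OF M mD r2 D(1)]) (use s in \<open>auto simp: D_def\<close>)
  also have "\<dots> = (\<Oplus>\<^bsub>M\<^esub>p\<in>D. r \<odot>\<^bsub>M\<^esub> (c p \<odot>\<^bsub>M\<^esub> m p))"
    by (rule M.finsum_cong') (use mD r[THEN range_subsetD] s in \<open>auto simp: M.smult_assoc1\<close>)
  also have "\<dots> = r \<odot>\<^bsub>M\<^esub> (\<Oplus>\<^bsub>M\<^esub>p\<in>D. c p \<odot>\<^bsub>M\<^esub> m p)"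
    by (rule M.finsum_smult_ldistr[symmetric]) (use mD r[THEN range_subsetD] s D in auto)
  finally show "lincomb R M m (r \<odot>\<^bsub>free_module R B\<^esub> c) = r \<odot>\<^bsub>M\<^esub> lincomb R M m c"
    by (simp add: free_module_simps lincomb_def D_def)
qed

lemma linear_maps_finsum:
  assumes "module R M" "module R N" and f: "f \<in> linear_maps R M N"
    and "finite B" "\<And>p. p \<in> B \<Longrightarrow> a p \<in> carrier M"
  shows "f (\<Oplus>\<^bsub>M\<^esub>p\<in>B. a p) = (\<Oplus>\<^bsub>N\<^esub>p\<in>B. f (a p))"
proof -
  interpret M: module R M by fact
  interpret N: module R N by fact
  show ?thesis
    using assms(4,5)
  proof (induction B rule: finite_induct)
    case empty
    then show ?case by (simp add: linear_maps_zero[OF f assms(1,2)])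
  next
    case (insert p B)
    then show ?case
      using linear_mapsD[OF f] by (simp add: Pi_iff)
  qed
qed

lemma linear_maps_lincomb:
  assumes "module R M" "module R N" and f: "f \<in> linear_maps R M N"
    and c: "c \<in> carrier (free_module R B)" and m: "\<And>p. p \<in> B \<Longrightarrow> m p \<in> carrier M"
  shows "f (lincomb R M m c) = lincomb R N (\<lambda>p. f (m p)) c"
proof -
  interpret M: module R M by fact
  interpret N: module R N by fact
  have "f (lincomb R M m c) = (\<Oplus>\<^bsub>N\<^esub>p\<in>{p. c p \<noteq> \<zero>\<^bsub>R\<^esub>}. f (c p \<odot>\<^bsub>M\<^esub> m p))"
    unfolding lincomb_def
    by (rule linear_maps_finsum[OF assms(1-3)]) (use c m in \<open>auto simp: free_module_simps image_subset_iff subset_iff\<close>)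
  also have "\<dots> = lincomb R N (\<lambda>p. f (m p)) c"
    unfolding lincomb_def
    by (rule N.finsum_cong')
      (use c m linear_mapsD[OF f] in \<open>auto simp: free_module_simps subset_iff\<close>)
  finally show ?thesis .
qed

theorem projective_module_lift:
  fixes P :: "('r, 'p, 'd) module_scheme" and M :: "('r, 'm, 'e) module_scheme"
    and N :: "('r, 'n, 'f) module_scheme"
  assumes "projective_module R P" and M: "module R M" and N: "module R N"
    and g: "g \<in> linear_maps R M N" "g ` carrier M = carrier N" and f: "f \<in> linear_maps R P N"
  shows "\<exists>t\<in>linear_maps R P M. \<forall>x\<in>carrier P. g (t x) = f x"
proof -
  have P: "module R P" using assms(1) by (simp add: projective_module_def)
  interpret P: module R P by fact
  interpret N: module R N by fact
  define F where "F = free_module R (carrier P)"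
  define P' :: "('r, 'p) module" where "P' = module_of_group (add_monoid P) (smult P)"
  have P'_simps: "carrier P' = carrier P" "\<zero>\<^bsub>P'\<^esub> = \<zero>\<^bsub>P\<^esub>" "ring.add P' = ring.add P" "smult P' = smult P"
    by (simp_all add: P'_def)
  have "abelian_group P'"
    unfolding P'_def by (rule module_of_group_abelian_group[OF P.a_comm_group])
  then have P': "module R P'"
    by (intro moduleI) (auto simp: P'_simps P.smult_l_distr P.smult_r_distr P.smult_assoc1 P.R.is_cring)
  have F: "module R F" unfolding F_def by (rule free_module_module[OF P.R.is_cring])
  have pi: "lincomb R P (\<lambda>p. p) \<in> linear_maps R F P"
    unfolding F_def by (rule lincomb_linear[OF P])
  have "p \<in> lincomb R P (\<lambda>p. p) ` carrier F" if p: "p \<in> carrier P" for p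
  proof (rule image_eqI)
    define c where "c = (\<lambda>q. if q = p then \<one>\<^bsub>R\<^esub> else \<zero>\<^bsub>R\<^esub>)"
    have s: "{q. c q \<noteq> \<zero>\<^bsub>R\<^esub>} \<subseteq> {p}" and r: "range c \<subseteq> carrier R" by (auto simp: c_def)
    with p show "c \<in> carrier F"
      using finite_subset[OF s] by (auto simp: F_def free_module_simps)
    have "lincomb R P (\<lambda>p. p) c = (\<Oplus>\<^bsub>P\<^esub>q\<in>{p}. c q \<odot>\<^bsub>P\<^esub> q)"
      by (rule lincomb_superset[OF P _ r _ s]) (use p in auto)
    then show "p = lincomb R P (\<lambda>p. p) c"
      using p by (simp add: c_def)
  qed
  note sur = this
  have pi': "lincomb R P (\<lambda>p. p) \<in> linear_maps R F P'"
    using pi by (simp add: linear_maps_def P'_simps)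
  have im: "lincomb R P (\<lambda>p. p) ` carrier F = carrier P'"
  proof (intro equalityI subsetI)
    fix x assume "x \<in> carrier P'"
    with sur show "x \<in> lincomb R P (\<lambda>p. p) ` carrier F" by (simp only: P'_simps)
  qed (use linear_mapsD(1)[OF pi'] in blast)
  have idm: "(\<lambda>x. x) \<in> linear_maps R P P'"
    by (simp add: linear_maps_def P'_simps)
  have "\<exists>t\<in>linear_maps R P F. \<forall>x\<in>carrier P. lincomb R P (\<lambda>p. p) (t x) = x"
    by (rule assms(1)[unfolded projective_module_def, THEN conjunct2, rule_format,
          where M = F and N = P' and g = "lincomb R P (\<lambda>p. p)" and f = "\<lambda>x. x"])
      (intro conjI F P' pi' im idm)
  then obtain s where s: "s \<in> linear_maps R P F" "\<forall>x\<in>carrier P. lincomb R P (\<lambda>p. p) (s x) = x"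
    by (elim bexE)
  have "\<forall>p\<in>carrier P. \<exists>x. x \<in> carrier M \<and> g x = f p"
  proof
    fix p assume "p \<in> carrier P"
    then have "f p \<in> g ` carrier M" using linear_mapsD(1)[OF f] g(2) by simp
    then show "\<exists>x. x \<in> carrier M \<and> g x = f p" by (elim imageE) metis
  qed
  then obtain m where m: "\<And>p. p \<in> carrier P \<Longrightarrow> m p \<in> carrier M \<and> g (m p) = f p"
    using bchoice by metis
  have lin: "lincomb R M m \<in> linear_maps R F M"
    unfolding F_def by (rule lincomb_linear[OF M]) (use m in blast)
  show ?thesis
  proof (rule bexI[of _ "\<lambda>x. lincomb R M m (s x)"], rule ballI)
    show "(\<lambda>x. lincomb R M m (s x)) \<in> linear_maps R P M"
      by (rule linear_maps_comp[OF s(1) lin])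
    fix x assume x: "x \<in> carrier P"
    have c: "s x \<in> carrier (free_module R (carrier P))"
      using linear_mapsD(1)[OF s(1) x] by (simp add: F_def)
    have "g (lincomb R M m (s x)) = lincomb R N (\<lambda>p. g (m p)) (s x)"
      by (rule linear_maps_lincomb[OF M N g(1) c]) (use m in blast)
    also have "\<dots> = lincomb R N f (s x)"
      unfolding lincomb_def
      by (rule N.finsum_cong')
        (use c m linear_mapsD[OF f] in \<open>auto simp: free_module_simps subset_iff\<close>)
    also have "\<dots> = f (lincomb R P (\<lambda>p. p) (s x))"
      by (rule linear_maps_lincomb[OF P N f c, symmetric])
    finally show "g (lincomb R M m (s x)) = f x"
      using s(2) x by simp
  qed
qed

subsection \<open>Faithful flatness for modules on arbitrary types\<close>

lemma submodule_module:
  assumes "module R M" "submodule H R M"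
  shows "module R (M\<lparr>carrier := H\<rparr>)"
  using submodule.submodule_is_module[OF assms(2,1)] .

definition transport :: "('m \<Rightarrow> 'n) \<Rightarrow> ('r, 'm, 'd) module_scheme \<Rightarrow> ('r, 'n) module"
  where "transport \<phi> M = module_of_group
    \<lparr>carrier = \<phi> ` carrier M,
     monoid.mult = (\<lambda>x y. \<phi> (inv_into (carrier M) \<phi> x \<oplus>\<^bsub>M\<^esub> inv_into (carrier M) \<phi> y)), one = \<phi> \<zero>\<^bsub>M\<^esub>\<rparr>
    (\<lambda>r x. \<phi> (r \<odot>\<^bsub>M\<^esub> inv_into (carrier M) \<phi> x))"

lemma transport_carrier: "carrier (transport \<phi> M) = \<phi> ` carrier M"
  by (simp add: transport_def)

lemma transport_zero: "\<zero>\<^bsub>transport \<phi> M\<^esub> = \<phi> \<zero>\<^bsub>M\<^esub>"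
  by (simp add: transport_def)

lemma transport_ops:
  assumes "inj_on \<phi> (carrier M)" "x \<in> carrier M"
  shows "y \<in> carrier M \<Longrightarrow> \<phi> x \<oplus>\<^bsub>transport \<phi> M\<^esub> \<phi> y = \<phi> (x \<oplus>\<^bsub>M\<^esub> y)"
    and "r \<odot>\<^bsub>transport \<phi> M\<^esub> \<phi> x = \<phi> (r \<odot>\<^bsub>M\<^esub> x)"
  using assms by (simp_all add: transport_def)

lemma transport_module:
  assumes "module R M" and inj: "inj_on \<phi> (carrier M)"
  shows "module R (transport \<phi> M)"
proof -
  interpret M: module R M by fact
  show ?thesis
  proof (rule moduleI)
    show "abelian_group (transport \<phi> M)"
    proof (rule abelian_groupI)
      fix x assume "x \<in> carrier (transport \<phi> M)"
      then obtain x' where x: "x = \<phi> x'" "x' \<in> carrier M" by (auto simp: transport_carrier)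
      show "\<exists>y\<in>carrier (transport \<phi> M). y \<oplus>\<^bsub>transport \<phi> M\<^esub> x = \<zero>\<^bsub>transport \<phi> M\<^esub>"
        by (rule bexI[of _ "\<phi> (\<ominus>\<^bsub>M\<^esub> x')"])
          (use x in \<open>simp_all add: transport_carrier transport_zero transport_ops[OF inj] M.M.l_neg\<close>)
    qed (auto simp: transport_carrier transport_zero transport_ops[OF inj] M.M.a_ac)
  qed (auto simp: transport_carrier transport_zero transport_ops[OF inj]
      M.smult_l_distr M.smult_r_distr M.smult_assoc1 M.R.is_cring)
qed

lemma transport_linear:
  assumes "inj_on \<phi> (carrier M)"
  shows "\<phi> \<in> linear_maps R M (transport \<phi> M)"
  by (rule linear_mapsI) (simp_all add: transport_carrier transport_ops[OF assms])

lemma transport_inv_linear: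
  assumes "module R M" "inj_on \<phi> (carrier M)"
  shows "inv_into (carrier M) \<phi> \<in> linear_maps R (transport \<phi> M) M"
proof -
  interpret M: module R M by fact
  show ?thesis
    by (rule linear_mapsI)
      (auto simp: transport_carrier transport_ops[OF assms(2)] assms(2))
qed

lemma frag_tensor_zero_map:
  assumes "module R A" "module R N" "Poly_Mapping.keys x \<subseteq> carrier A \<times> B"
  shows "frag_tensor (\<lambda>a. a) (\<lambda>_. \<zero>\<^bsub>N\<^esub>) x \<in> tensor_null R A N"
  using assms(3)
proof (induction x rule: frag_induction)
  case zero
  then show ?case by (simp add: tensor_null_0)
next
  case (one p)
  interpret N: module R N by fact
  obtain a m where p: "p = (a, m)" by (cases p)
  have "frag_of (a, \<zero>\<^bsub>N\<^esub> \<oplus>\<^bsub>N\<^esub> \<zero>\<^bsub>N\<^esub>) - frag_of (a, \<zero>\<^bsub>N\<^esub>) - frag_of (a, \<zero>\<^bsub>N\<^esub>) \<in> tensor_null R A N"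
    using one p by (intro tensor_null_rels tensor_relsI(2)) auto
  then have "- frag_of (a, \<zero>\<^bsub>N\<^esub>) \<in> tensor_null R A N" by simp
  from tensor_null_uminus[OF assms(1,2) this] show ?case by (simp add: p)
next
  case (diff x y)
  then show ?case by (simp add: frag_tensor_diff tensor_null_diff[OF assms(1,2)])
qed

lemma exact_at_add_monoid:
  "exact_at (add_monoid N1) (add_monoid N2) (add_monoid N3) f g \<longleftrightarrow>
    f ` carrier N1 = {x \<in> carrier N2. g x = \<zero>\<^bsub>N3\<^esub>}"
  by (simp add: exact_at_def kernel_def)

lemma tensor_exact_iff:
  assumes A: "module R A" and N1: "module R N1" and N2: "module R N2" and N3: "module R N3"
    and f: "f \<in> linear_maps R N1 N2" and g: "g \<in> linear_maps R N2 N3"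
    and gf: "\<forall>x\<in>carrier N1. g (f x) = \<zero>\<^bsub>N3\<^esub>"
  shows "exact_at (tensor_group R A N1) (tensor_group R A N2) (tensor_group R A N3)
         (tensor_map R A N2 (\<lambda>a. a) f) (tensor_map R A N3 (\<lambda>a. a) g) \<longleftrightarrow>
    (\<forall>y. Poly_Mapping.keys y \<subseteq> carrier A \<times> carrier N2 \<longrightarrow> frag_tensor (\<lambda>a. a) g y \<in> tensor_null R A N3 \<longrightarrow>
      (\<exists>x. Poly_Mapping.keys x \<subseteq> carrier A \<times> carrier N1 \<and> y - frag_tensor (\<lambda>a. a) f x \<in> tensor_null R A N2))"
    (is "?L \<longleftrightarrow> ?R")
proof -
  have tf: "tensor_map R A N2 (\<lambda>a. a) f (tensor_class R A N1 x) =
      tensor_class R A N2 (frag_tensor (\<lambda>a. a) f x)" for x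
    by (rule tensor_map_class[OF A N1 A N2 linear_maps_id f])
  have tg: "tensor_map R A N3 (\<lambda>a. a) g (tensor_class R A N2 x) =
      tensor_class R A N3 (frag_tensor (\<lambda>a. a) g x)" for x
    by (rule tensor_map_class[OF A N2 A N3 linear_maps_id g])
  have kf: "Poly_Mapping.keys (frag_tensor (\<lambda>a. a) f x) \<subseteq> carrier A \<times> carrier N2"
    if "Poly_Mapping.keys x \<subseteq> carrier A \<times> carrier N1" for x
    by (rule frag_tensor_keys[OF that]) (use linear_mapsD(1)[OF f] in auto)
  have cx: "frag_tensor (\<lambda>a. a) g (frag_tensor (\<lambda>a. a) f x) \<in> tensor_null R A N3"
    if "Poly_Mapping.keys x \<subseteq> carrier A \<times> carrier N1" for x
  proof -
    have "frag_tensor (\<lambda>a. a) (\<lambda>m. g (f m)) x = frag_tensor (\<lambda>a. a) (\<lambda>_. \<zero>\<^bsub>N3\<^esub>) x"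
      by (rule frag_tensor_cong[OF that]) (use gf in auto)
    then show ?thesis
      using frag_tensor_zero_map[OF A N3 that] by (simp add: frag_tensor_comp)
  qed
  let ?K = "\<lambda>N. {x. Poly_Mapping.keys x \<subseteq> carrier A \<times> carrier N}"
  have ker: "kernel (tensor_group R A N2) (tensor_group R A N3) (tensor_map R A N3 (\<lambda>a. a) g) =
    tensor_class R A N2 ` {y \<in> ?K N2. frag_tensor (\<lambda>a. a) g y \<in> tensor_null R A N3}"
  proof -
    have "(tensor_map R A N3 (\<lambda>a. a) g (tensor_class R A N2 y) = tensor_null R A N3) \<longleftrightarrow>
      frag_tensor (\<lambda>a. a) g y \<in> tensor_null R A N3" for y
      unfolding tg by (rule tensor_class_null_iff[OF A N3])
    then show ?thesis
      unfolding kernel_def carrier_tensor_group one_tensor_group by blast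
  qed
  have im: "tensor_map R A N2 (\<lambda>a. a) f ` carrier (tensor_group R A N1) =
    tensor_class R A N2 ` frag_tensor (\<lambda>a. a) f ` ?K N1"
    unfolding carrier_tensor_group image_image tf ..
  have "tensor_class R A N2 ` frag_tensor (\<lambda>a. a) f ` ?K N1 \<subseteq>
    tensor_class R A N2 ` {y \<in> ?K N2. frag_tensor (\<lambda>a. a) g y \<in> tensor_null R A N3}"
    using kf cx by (intro image_mono) auto
  then have "?L \<longleftrightarrow> tensor_class R A N2 ` {y \<in> ?K N2. frag_tensor (\<lambda>a. a) g y \<in> tensor_null R A N3}
    \<subseteq> tensor_class R A N2 ` frag_tensor (\<lambda>a. a) f ` ?K N1"
    unfolding exact_at_def ker im by blast
  also have "\<dots> \<longleftrightarrow> ?R"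
    unfolding image_subset_iff image_iff bex_simps
    by (simp add: image_iff tensor_class_eq_iff[OF A N2]) blast
  finally show ?thesis .
qed

lemma tensor_exact_iso:
  assumes A: "module R A" and N1: "module R N1" and N2: "module R N2" and N3: "module R N3"
    and N1': "module R N1'" and N2': "module R N2'" and N3': "module R N3'"
    and f: "f \<in> linear_maps R N1 N2" and g: "g \<in> linear_maps R N2 N3"
    and gf: "\<forall>x\<in>carrier N1. g (f x) = \<zero>\<^bsub>N3\<^esub>"
    and f': "f' \<in> linear_maps R N1' N2'" and g': "g' \<in> linear_maps R N2' N3'"
    and gf': "\<forall>x\<in>carrier N1'. g' (f' x) = \<zero>\<^bsub>N3'\<^esub>"
    and p1: "p1 \<in> linear_maps R N1 N1'" and p2: "p2 \<in> linear_maps R N2 N2'"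
    and q2: "q2 \<in> linear_maps R N2' N2" and q3: "q3 \<in> linear_maps R N3' N3"
    and pq: "\<And>y. y \<in> carrier N2' \<Longrightarrow> p2 (q2 y) = y"
    and pf: "\<And>x. x \<in> carrier N1 \<Longrightarrow> p2 (f x) = f' (p1 x)"
    and gq: "\<And>y. y \<in> carrier N2' \<Longrightarrow> g (q2 y) = q3 (g' y)"
    and ex: "exact_at (tensor_group R A N1) (tensor_group R A N2) (tensor_group R A N3)
         (tensor_map R A N2 (\<lambda>a. a) f) (tensor_map R A N3 (\<lambda>a. a) g)"
  shows "exact_at (tensor_group R A N1') (tensor_group R A N2') (tensor_group R A N3')
         (tensor_map R A N2' (\<lambda>a. a) f') (tensor_map R A N3' (\<lambda>a. a) g')"
proof (rule tensor_exact_iff[OF A N1' N2' N3' f' g' gf', THEN iffD2], intro allI impI)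
  note E = ex[unfolded tensor_exact_iff[OF A N1 N2 N3 f g gf], rule_format]
  let ?T = "frag_tensor (\<lambda>a. a)"
  fix y' assume y': "Poly_Mapping.keys y' \<subseteq> carrier A \<times> carrier N2'" "?T g' y' \<in> tensor_null R A N3'"
  have k: "Poly_Mapping.keys (?T q2 y') \<subseteq> carrier A \<times> carrier N2"
    by (rule frag_tensor_keys[OF y'(1)]) (use linear_mapsD(1)[OF q2] in auto)
  have "?T g (?T q2 y') = ?T q3 (?T g' y')"
    unfolding frag_tensor_comp by (rule frag_tensor_cong[OF y'(1)]) (use gq in auto)
  then have "?T g (?T q2 y') \<in> tensor_null R A N3"
    using frag_tensor_null[OF A N3' A N3 linear_maps_id q3 y'(2)] by simp
  then obtain x where x: "Poly_Mapping.keys x \<subseteq> carrier A \<times> carrier N1"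
      "?T q2 y' - ?T f x \<in> tensor_null R A N2"
    using E[OF k] by blast
  have "?T p2 (?T q2 y' - ?T f x) \<in> tensor_null R A N2'"
    by (rule frag_tensor_null[OF A N2 A N2' linear_maps_id p2 x(2)])
  moreover have "?T p2 (?T q2 y') = y'"
  proof -
    have "?T p2 (?T q2 y') = ?T (\<lambda>m. m) y'"
      unfolding frag_tensor_comp by (rule frag_tensor_cong[OF y'(1)]) (use pq in auto)
    then show ?thesis by (simp add: frag_tensor_id)
  qed
  moreover have "?T p2 (?T f x) = ?T f' (?T p1 x)"
    unfolding frag_tensor_comp by (rule frag_tensor_cong[OF x(1)]) (use pf in auto)
  moreover have "Poly_Mapping.keys (?T p1 x) \<subseteq> carrier A \<times> carrier N1'"
    by (rule frag_tensor_keys[OF x(1)]) (use linear_mapsD(1)[OF p1] in auto)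
  ultimately show "\<exists>x. Poly_Mapping.keys x \<subseteq> carrier A \<times> carrier N1' \<and> y' - ?T f' x \<in> tensor_null R A N2'"
    by (intro exI[of _ "?T p1 x"]) (simp add: frag_tensor_diff)
qed

lemma faithfully_flat_embedded:
  fixes R :: "('r, 'c) ring_scheme" and \<phi>1 :: "'n1 \<Rightarrow> (nat \<Rightarrow> 'r) set"
    and \<phi>2 :: "'n2 \<Rightarrow> (nat \<Rightarrow> 'r) set" and \<phi>3 :: "'n3 \<Rightarrow> (nat \<Rightarrow> 'r) set"
  assumes ff: "faithfully_flat_module R A"
    and N1: "module R N1" and N2: "module R N2" and N3: "module R N3"
    and f: "f \<in> linear_maps R N1 N2" and g: "g \<in> linear_maps R N2 N3"
    and gf: "\<forall>x\<in>carrier N1. g (f x) = \<zero>\<^bsub>N3\<^esub>"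
    and i1: "inj_on \<phi>1 (carrier N1)" and i2: "inj_on \<phi>2 (carrier N2)" and i3: "inj_on \<phi>3 (carrier N3)"
  shows "exact_at (add_monoid N1) (add_monoid N2) (add_monoid N3) f g \<longleftrightarrow>
    exact_at (tensor_group R A N1) (tensor_group R A N2) (tensor_group R A N3)
         (tensor_map R A N2 (\<lambda>a. a) f) (tensor_map R A N3 (\<lambda>a. a) g)"
proof -
  have A: "module R A" using ff by (simp add: faithfully_flat_module_def)
  interpret N3: module R N3 by fact
  define M1 where "M1 = transport \<phi>1 N1"
  define M2 where "M2 = transport \<phi>2 N2"
  define M3 where "M3 = transport \<phi>3 N3"
  define q1 where "q1 = inv_into (carrier N1) \<phi>1"
  define q2 where "q2 = inv_into (carrier N2) \<phi>2"
  define q3 where "q3 = inv_into (carrier N3) \<phi>3"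
  define f' where "f' x = \<phi>2 (f (q1 x))" for x
  define g' where "g' x = \<phi>3 (g (q2 x))" for x
  have M: "module R M1" "module R M2" "module R M3"
    unfolding M1_def M2_def M3_def by (rule transport_module; fact)+
  have p: "\<phi>1 \<in> linear_maps R N1 M1" "\<phi>2 \<in> linear_maps R N2 M2" "\<phi>3 \<in> linear_maps R N3 M3"
    unfolding M1_def M2_def M3_def by (rule transport_linear; fact)+
  have q: "q1 \<in> linear_maps R M1 N1" "q2 \<in> linear_maps R M2 N2" "q3 \<in> linear_maps R M3 N3"
    unfolding M1_def M2_def M3_def q1_def q2_def q3_def by (rule transport_inv_linear; fact)+
  have pq: "y \<in> carrier M1 \<Longrightarrow> \<phi>1 (q1 y) = y" "y2 \<in> carrier M2 \<Longrightarrow> \<phi>2 (q2 y2) = y2"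
    "y3 \<in> carrier M3 \<Longrightarrow> \<phi>3 (q3 y3) = y3" for y y2 y3
    unfolding M1_def M2_def M3_def q1_def q2_def q3_def transport_carrier
    by (simp_all add: f_inv_into_f)
  have qp: "x \<in> carrier N1 \<Longrightarrow> q1 (\<phi>1 x) = x" "x2 \<in> carrier N2 \<Longrightarrow> q2 (\<phi>2 x2) = x2"
    "x3 \<in> carrier N3 \<Longrightarrow> q3 (\<phi>3 x3) = x3" for x x2 x3
    unfolding q1_def q2_def q3_def using i1 i2 i3 by simp_all
  note cl = linear_mapsD(1)[OF f] linear_mapsD(1)[OF g] linear_mapsD(1)[OF p(1)]
    linear_mapsD(1)[OF p(2)] linear_mapsD(1)[OF p(3)] linear_mapsD(1)[OF q(1)]
    linear_mapsD(1)[OF q(2)] linear_mapsD(1)[OF q(3)]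
  have z3: "\<zero>\<^bsub>M3\<^esub> = \<phi>3 \<zero>\<^bsub>N3\<^esub>" by (simp add: M3_def transport_zero)
  have f': "f' \<in> linear_maps R M1 M2"
    unfolding f'_def by (rule linear_maps_comp[OF linear_maps_comp[OF q(1) f] p(2)])
  have g': "g' \<in> linear_maps R M2 M3"
    unfolding g'_def by (rule linear_maps_comp[OF linear_maps_comp[OF q(2) g] p(3)])
  have gf': "\<forall>x\<in>carrier M1. g' (f' x) = \<zero>\<^bsub>M3\<^esub>"
    by (simp add: f'_def g'_def qp cl gf z3)
  have "exact_at (add_monoid N1) (add_monoid N2) (add_monoid N3) f g \<longleftrightarrow>
    exact_at (add_monoid M1) (add_monoid M2) (add_monoid M3) f' g'"
  proof -
    have "f' ` carrier M1 = \<phi>2 ` f ` carrier N1"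
      by (auto simp: f'_def M1_def transport_carrier image_image q1_def i1 intro!: image_cong)
    moreover have "{x \<in> carrier M2. g' x = \<zero>\<^bsub>M3\<^esub>} = \<phi>2 ` {x \<in> carrier N2. g x = \<zero>\<^bsub>N3\<^esub>}"
      using i3 cl(2) N3.zero_closed
      by (auto simp: M2_def transport_carrier g'_def qp z3 inj_on_eq_iff[OF i3])
    moreover have "f ` carrier N1 \<subseteq> carrier N2" using cl by auto
    ultimately show ?thesis
      unfolding exact_at_add_monoid by (simp add: inj_on_image_eq_iff[OF i2])
  qed
  also have "\<dots> \<longleftrightarrow> exact_at (tensor_group R A M1) (tensor_group R A M2) (tensor_group R A M3)
         (tensor_map R A M2 (\<lambda>a. a) f') (tensor_map R A M3 (\<lambda>a. a) g')"
    using ff[unfolded faithfully_flat_module_def, THEN conjunct2, rule_format, of M1 M2 M3 f' g']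
      M f' g' gf' by blast
  also have "\<dots> \<longleftrightarrow> exact_at (tensor_group R A N1) (tensor_group R A N2) (tensor_group R A N3)
         (tensor_map R A N2 (\<lambda>a. a) f) (tensor_map R A N3 (\<lambda>a. a) g)"
  proof
    assume *: "exact_at (tensor_group R A M1) (tensor_group R A M2) (tensor_group R A M3)
         (tensor_map R A M2 (\<lambda>a. a) f') (tensor_map R A M3 (\<lambda>a. a) g')"
    show "exact_at (tensor_group R A N1) (tensor_group R A N2) (tensor_group R A N3)
         (tensor_map R A N2 (\<lambda>a. a) f) (tensor_map R A N3 (\<lambda>a. a) g)"
      by (rule tensor_exact_iso[OF A M N1 N2 N3 f' g' gf' f g gf q(1,2) p(2,3) _ _ _ *])
        (auto simp: qp f'_def g'_def cl)
  next
    assume *: "exact_at (tensor_group R A N1) (tensor_group R A N2) (tensor_group R A N3)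
         (tensor_map R A N2 (\<lambda>a. a) f) (tensor_map R A N3 (\<lambda>a. a) g)"
    show "exact_at (tensor_group R A M1) (tensor_group R A M2) (tensor_group R A M3)
         (tensor_map R A M2 (\<lambda>a. a) f') (tensor_map R A M3 (\<lambda>a. a) g')"
      by (rule tensor_exact_iso[OF A N1 N2 N3 M f g gf f' g' gf' p(1,2) q(2,3) _ _ _ *])
        (auto simp: pq qp f'_def g'_def cl)
  qed
  finally show ?thesis .
qed

lemma finite_subset_submodule:
  fixes R :: "('r, 'c) ring_scheme" and M :: "('r, 'm, 'd) module_scheme"
  assumes "module R M" "finite Y" "Y \<subseteq> carrier M"
  shows "\<exists>H (\<phi> :: 'm \<Rightarrow> (nat \<Rightarrow> 'r) set). submodule H R M \<and> Y \<subseteq> H \<and> inj_on \<phi> H \<and>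
    (\<forall>L. submodule L R M \<longrightarrow> Y \<subseteq> L \<longrightarrow> H \<subseteq> L)"
proof -
  interpret M: module R M by fact
  obtain b :: "nat \<Rightarrow> 'm" and n where b: "Y = b ` {..<n}"
    using finite_imp_nat_seg_image_inj_on[OF assms(2)] by (auto simp: lessThan_def)
  have bM: "i < n \<Longrightarrow> b i \<in> carrier M" for i using b assms(3) by auto
  define s where "s c = (\<Oplus>\<^bsub>M\<^esub>i\<in>{..<n}. c i \<odot>\<^bsub>M\<^esub> b i)" for c
  define C where "C = {..<n} \<rightarrow> carrier R"
  define H where "H = s ` C"
  define \<phi> where "\<phi> m = {c \<in> C. s c = m}" for m
  have sM: "s c \<in> carrier M" if "c \<in> C" for c
    unfolding s_def using that bM by (intro M.finsum_closed) (auto simp: C_def Pi_iff)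
  have s_smult: "r \<odot>\<^bsub>M\<^esub> s c \<in> H" if "r \<in> carrier R" "c \<in> C" for r c
  proof -
    have "r \<odot>\<^bsub>M\<^esub> s c = (\<Oplus>\<^bsub>M\<^esub>i\<in>{..<n}. r \<odot>\<^bsub>M\<^esub> (c i \<odot>\<^bsub>M\<^esub> b i))"
      unfolding s_def
      by (rule M.finsum_smult_ldistr) (use that bM in \<open>auto simp: C_def Pi_iff\<close>)
    also have "\<dots> = s (\<lambda>i. r \<otimes>\<^bsub>R\<^esub> c i)"
      unfolding s_def
      by (rule M.finsum_cong') (use that bM in \<open>auto simp: C_def Pi_iff M.smult_assoc1\<close>)
    finally have "r \<odot>\<^bsub>M\<^esub> s c = s (\<lambda>i. r \<otimes>\<^bsub>R\<^esub> c i)" .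
    moreover have "(\<lambda>i. r \<otimes>\<^bsub>R\<^esub> c i) \<in> C" using that by (auto simp: C_def Pi_iff)
    ultimately show ?thesis unfolding H_def by simp
  qed
  have "submodule H R M"
  proof (rule M.submoduleI)
    show "H \<subseteq> carrier M" using sM by (auto simp: H_def)
    have "(\<lambda>i. \<zero>\<^bsub>R\<^esub>) \<in> C" by (simp add: C_def)
    from s_smult[OF M.R.zero_closed this] show "\<zero>\<^bsub>M\<^esub> \<in> H"
      using sM[OF \<open>(\<lambda>i. \<zero>\<^bsub>R\<^esub>) \<in> C\<close>] by simp
    fix a assume "a \<in> H"
    then obtain c where c: "a = s c" "c \<in> C" by (auto simp: H_def)
    show "\<ominus>\<^bsub>M\<^esub> a \<in> H"
      using s_smult[OF _ c(2), of "\<ominus>\<^bsub>R\<^esub> \<one>\<^bsub>R\<^esub>"] sM[OF c(2)] c(1) by (simp add: M.smult_l_minus)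
    show "r \<odot>\<^bsub>M\<^esub> a \<in> H" if "r \<in> carrier R" for r
      using s_smult[OF that c(2)] c(1) by simp
    fix a' assume "a' \<in> H"
    then obtain d where d: "a' = s d" "d \<in> C" by (auto simp: H_def)
    have "s (\<lambda>i. c i \<oplus>\<^bsub>R\<^esub> d i) = (\<Oplus>\<^bsub>M\<^esub>i\<in>{..<n}. c i \<odot>\<^bsub>M\<^esub> b i \<oplus>\<^bsub>M\<^esub> d i \<odot>\<^bsub>M\<^esub> b i)"
      unfolding s_def
      by (rule M.finsum_cong') (use c(2) d(2) bM in \<open>auto simp: C_def Pi_iff M.smult_l_distr\<close>)
    also have "\<dots> = s c \<oplus>\<^bsub>M\<^esub> s d"
      unfolding s_def
      by (rule M.finsum_addf) (use c(2) d(2) bM in \<open>auto simp: C_def Pi_iff\<close>)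
    finally have "a \<oplus>\<^bsub>M\<^esub> a' = s (\<lambda>i. c i \<oplus>\<^bsub>R\<^esub> d i)" using c d by simp
    moreover have "(\<lambda>i. c i \<oplus>\<^bsub>R\<^esub> d i) \<in> C" using c(2) d(2) by (auto simp: C_def Pi_iff)
    ultimately show "a \<oplus>\<^bsub>M\<^esub> a' \<in> H" unfolding H_def by simp
  qed
  moreover have "Y \<subseteq> H"
  proof
    fix y assume "y \<in> Y"
    then obtain j where j: "j < n" "y = b j" using b by auto
    define e where "e i = (if j = i then \<one>\<^bsub>R\<^esub> else \<zero>\<^bsub>R\<^esub>)" for i
    have "s e = (\<Oplus>\<^bsub>M\<^esub>i\<in>{..<n}. if j = i then b i else \<zero>\<^bsub>M\<^esub>)"
      unfolding s_def by (rule M.finsum_cong') (use bM in \<open>auto simp: e_def\<close>)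
    also have "\<dots> = b j"
      by (rule M.add.finprod_singleton) (use j bM in auto)
    finally have "y = s e" using j by simp
    moreover have "e \<in> C" by (auto simp: e_def C_def)
    ultimately show "y \<in> H" unfolding H_def by blast
  qed
  moreover have "inj_on \<phi> H"
  proof (rule inj_onI)
    fix x y assume "x \<in> H" "y \<in> H" "\<phi> x = \<phi> y"
    from \<open>x \<in> H\<close> obtain c where "c \<in> \<phi> x" by (auto simp: H_def \<phi>_def)
    with \<open>\<phi> x = \<phi> y\<close> show "x = y" by (auto simp: \<phi>_def)
  qed
  moreover have "H \<subseteq> L" if L: "submodule L R M" "Y \<subseteq> L" for L
  proof
    fix x assume "x \<in> H"
    then obtain c where c: "x = s c" "c \<in> C" by (auto simp: H_def)
    have "(\<Oplus>\<^bsub>M\<^esub>i\<in>B. c i \<odot>\<^bsub>M\<^esub> b i) \<in> L" if "finite B" "B \<subseteq> {..<n}" for B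
      using that
    proof (induction B rule: finite_induct)
      case empty
      then show ?case
        using subgroup.one_closed[OF submodule.axioms(1)[OF L(1)]] by simp
    next
      case (insert i B)
      have t: "c j \<odot>\<^bsub>M\<^esub> b j \<in> L" if "j < n" for j
        using M.submoduleE(4)[OF L(1), of "c j" "b j"] that c(2) L(2) b by (auto simp: C_def Pi_iff)
      have "c j \<odot>\<^bsub>M\<^esub> b j \<in> carrier M" if "j < n" for j
        using t[OF that] M.submoduleE(1)[OF L(1)] by auto
      then have "(\<Oplus>\<^bsub>M\<^esub>i\<in>insert i B. c i \<odot>\<^bsub>M\<^esub> b i) =
          c i \<odot>\<^bsub>M\<^esub> b i \<oplus>\<^bsub>M\<^esub> (\<Oplus>\<^bsub>M\<^esub>i\<in>B. c i \<odot>\<^bsub>M\<^esub> b i)"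
        using insert by (intro M.finsum_insert) auto
      then show ?case
        using insert t M.submoduleE(5)[OF L(1)] by simp
    qed
    from this[of "{..<n}"] show "x \<in> L" by (simp add: c(1) s_def)
  qed
  ultimately show ?thesis by blast
qed

lemma tensor_null_finite:
  assumes "module R A" "module R M" "x \<in> tensor_null R A M"
  shows "\<exists>Y. finite Y \<and> Y \<subseteq> carrier M \<and>
    (\<forall>H. submodule H R M \<longrightarrow> Y \<subseteq> H \<longrightarrow> x \<in> tensor_null R A (M\<lparr>carrier := H\<rparr>))"
  using assms
proof (induction rule: tensor_null_induct)
  case zero
  show ?case by (intro exI[of _ "{}"]) (simp add: tensor_null_0)
next
  case (rels x)
  then show ?case
  proof (cases rule: tensor_relsE)
    case (add_left a b m)
    then have "x \<in> tensor_null R A (M\<lparr>carrier := H\<rparr>)" if "m \<in> H" for H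
      using tensor_relsI(1)[of a A b m "M\<lparr>carrier := H\<rparr>" R] that by (simp add: tensor_null_rels)
    with add_left show ?thesis by (intro exI[of _ "{m}"]) auto
  next
    case (add_right a m n)
    then have "x \<in> tensor_null R A (M\<lparr>carrier := H\<rparr>)" if "m \<in> H" "n \<in> H" for H
      using tensor_relsI(2)[of a A m "M\<lparr>carrier := H\<rparr>" n R] that by (simp add: tensor_null_rels)
    with add_right show ?thesis by (intro exI[of _ "{m, n}"]) auto
  next
    case (smult r a m)
    then have "x \<in> tensor_null R A (M\<lparr>carrier := H\<rparr>)" if "m \<in> H" for H
      using tensor_relsI(3)[of r R a A m "M\<lparr>carrier := H\<rparr>"] that by (simp add: tensor_null_rels)
    with smult show ?thesis by (intro exI[of _ "{m}"]) auto
  qed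
next
  case (add x y)
  then obtain X Y where "finite X" "X \<subseteq> carrier M" "finite Y" "Y \<subseteq> carrier M"
    "\<And>H. submodule H R M \<Longrightarrow> X \<subseteq> H \<Longrightarrow> x \<in> tensor_null R A (M\<lparr>carrier := H\<rparr>)"
    "\<And>H. submodule H R M \<Longrightarrow> Y \<subseteq> H \<Longrightarrow> y \<in> tensor_null R A (M\<lparr>carrier := H\<rparr>)"
    by metis
  then show ?case by (intro exI[of _ "X \<union> Y"]) (simp add: tensor_null_add)
next
  case (uminus x)
  then obtain X where "finite X" "X \<subseteq> carrier M"
    "\<And>H. submodule H R M \<Longrightarrow> X \<subseteq> H \<Longrightarrow> x \<in> tensor_null R A (M\<lparr>carrier := H\<rparr>)"
    by metis
  then show ?case
    using tensor_null_uminus[OF assms(1) submodule_module[OF assms(2)]]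
    by (intro exI[of _ X]) simp
qed

lemma preimage_submodule:
  assumes "module R M" "module R N" "g \<in> linear_maps R M N" "submodule H R M" "submodule L R N"
  shows "submodule {x \<in> H. g x \<in> L} R M"
proof -
  interpret M: module R M by fact
  interpret N: module R N by fact
  note H = M.submoduleE[OF assms(4)] and L = N.submoduleE[OF assms(5)]
  note g = linear_mapsD[OF assms(3)]
  have m: "\<ominus>\<^bsub>M\<^esub> x = (\<ominus>\<^bsub>R\<^esub> \<one>\<^bsub>R\<^esub>) \<odot>\<^bsub>M\<^esub> x" if "x \<in> carrier M" for x
    using that by (simp add: M.smult_l_minus)
  show ?thesis
  proof (rule M.submoduleI)
    show "\<zero>\<^bsub>M\<^esub> \<in> {x \<in> H. g x \<in> L}"
      using linear_maps_zero[OF assms(3,1,2)]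
        subgroup.one_closed[OF submodule.axioms(1)[OF assms(4)]]
        subgroup.one_closed[OF submodule.axioms(1)[OF assms(5)]] by simp
    fix x assume x: "x \<in> {x \<in> H. g x \<in> L}"
    then have xM: "x \<in> carrier M" using H(1) by auto
    have s: "r \<odot>\<^bsub>M\<^esub> x \<in> {x \<in> H. g x \<in> L}" if "r \<in> carrier R" for r
      using x xM H(4) L(4) g(3) that by simp
    then show "r \<odot>\<^bsub>M\<^esub> x \<in> {x \<in> H. g x \<in> L}" if "r \<in> carrier R" for r
      using that .
    show "\<ominus>\<^bsub>M\<^esub> x \<in> {x \<in> H. g x \<in> L}"
      unfolding m[OF xM] by (rule s) simp
  next
    fix x y assume "x \<in> {x \<in> H. g x \<in> L}" "y \<in> {x \<in> H. g x \<in> L}"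
    moreover from this have "x \<in> carrier M" "y \<in> carrier M" using H(1) by auto
    ultimately show "x \<oplus>\<^bsub>M\<^esub> y \<in> {x \<in> H. g x \<in> L}"
      using H(5) L(5) g(2)[of x y] by simp
  qed (use H(1) in auto)
qed

lemma zero_submodule:
  assumes "module R M"
  shows "submodule {\<zero>\<^bsub>M\<^esub>} R M"
proof -
  interpret M: module R M by fact
  show ?thesis by (rule M.submoduleI) auto
qed

lemma faithfully_flat_exact:
  fixes R :: "('r, 'c) ring_scheme" and A :: "('r, 'a, 'd) module_scheme"
    and N1 :: "('r, 'n1, 'd1) module_scheme" and N2 :: "('r, 'n2, 'd2) module_scheme"
    and N3 :: "('r, 'n3, 'd3) module_scheme"
  assumes ff: "faithfully_flat_module R A"
    and N1: "module R N1" and N2: "module R N2" and N3: "module R N3"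
    and f: "f \<in> linear_maps R N1 N2" and g: "g \<in> linear_maps R N2 N3"
    and ex: "f ` carrier N1 = {x \<in> carrier N2. g x = \<zero>\<^bsub>N3\<^esub>}"
    and y: "Poly_Mapping.keys y \<subseteq> carrier A \<times> carrier N2"
      "frag_tensor (\<lambda>a. a) g y \<in> tensor_null R A N3"
  shows "\<exists>x. Poly_Mapping.keys x \<subseteq> carrier A \<times> carrier N1 \<and> y - frag_tensor (\<lambda>a. a) f x \<in> tensor_null R A N2"
proof -
  let ?T = "frag_tensor (\<lambda>a. a)"
  have A: "module R A" using ff by (simp add: faithfully_flat_module_def)
  interpret N2: module R N2 by fact
  interpret N3: module R N3 by fact
  obtain X3 where X3: "finite X3" "X3 \<subseteq> carrier N3"
    "\<And>H. submodule H R N3 \<Longrightarrow> X3 \<subseteq> H \<Longrightarrow> ?T g y \<in> tensor_null R A (N3\<lparr>carrier := H\<rparr>)"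
    using tensor_null_finite[OF A N3 y(2)] by blast
  define Y where "Y = snd ` Poly_Mapping.keys y"
  have "finite Y" "Y \<subseteq> carrier N2" using y(1) by (auto simp: Y_def)
  then obtain H2 and \<phi>2 :: "'n2 \<Rightarrow> (nat \<Rightarrow> 'r) set" where
    H2: "submodule H2 R N2" "Y \<subseteq> H2" "inj_on \<phi>2 H2"
      "\<forall>L. submodule L R N2 \<longrightarrow> Y \<subseteq> L \<longrightarrow> H2 \<subseteq> L"
    using finite_subset_submodule[OF N2] by metis
  have "finite (X3 \<union> g ` Y)" "X3 \<union> g ` Y \<subseteq> carrier N3"
    using X3(1,2) \<open>finite Y\<close> \<open>Y \<subseteq> carrier N2\<close> linear_mapsD(1)[OF g] by auto
  then obtain H3 and \<phi>3 :: "'n3 \<Rightarrow> (nat \<Rightarrow> 'r) set" where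
    H3': "submodule H3 R N3" "X3 \<union> g ` Y \<subseteq> H3" "inj_on \<phi>3 H3"
    using finite_subset_submodule[OF N3] by metis
  have "submodule {x \<in> carrier N2. g x \<in> H3} R N2"
    by (rule preimage_submodule[OF N2 N3 g N2.carrier_is_submodule H3'(1)])
  moreover have "Y \<subseteq> {x \<in> carrier N2. g x \<in> H3}" using H3'(2) \<open>Y \<subseteq> carrier N2\<close> by auto
  ultimately have "H2 \<subseteq> {x \<in> carrier N2. g x \<in> H3}" using H2(4) by blast
  then have H3: "submodule H3 R N3" "X3 \<subseteq> H3" "g ` H2 \<subseteq> H3" "inj_on \<phi>3 H3"
    using H3' by auto
  define K where "K = {x \<in> H2. g x = \<zero>\<^bsub>N3\<^esub>}"
  have K: "submodule K R N2" 
    using preimage_submodule[OF N2 N3 g H2(1) zero_submodule[OF N3]] by (simp add: K_def)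
  note KM = submodule_module[OF N2 K] and H2M = submodule_module[OF N2 H2(1)]
    and H3M = submodule_module[OF N3 H3(1)]
  have H2s: "H2 \<subseteq> carrier N2" by (rule N2.submoduleE(1)[OF H2(1)])
  have inc: "(\<lambda>x. x) \<in> linear_maps R (N2\<lparr>carrier := K\<rparr>) (N2\<lparr>carrier := H2\<rparr>)"
    by (auto simp: linear_maps_def K_def)
  have g2: "g \<in> linear_maps R (N2\<lparr>carrier := H2\<rparr>) (N3\<lparr>carrier := H3\<rparr>)"
    using H3(3) linear_mapsD[OF g] subsetD[OF H2s] by (intro linear_mapsI) auto
  have gK: "\<forall>x\<in>carrier (N2\<lparr>carrier := K\<rparr>). g x = \<zero>\<^bsub>N3\<lparr>carrier := H3\<rparr>\<^esub>"
    by (simp add: K_def)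
  have i: "inj_on \<phi>2 (carrier (N2\<lparr>carrier := K\<rparr>))" "inj_on \<phi>2 (carrier (N2\<lparr>carrier := H2\<rparr>))"
    "inj_on \<phi>3 (carrier (N3\<lparr>carrier := H3\<rparr>))"
    using H2(3) H3(4) by (auto simp: K_def inj_on_def)
  have "exact_at (add_monoid (N2\<lparr>carrier := K\<rparr>)) (add_monoid (N2\<lparr>carrier := H2\<rparr>)) (add_monoid (N3\<lparr>carrier := H3\<rparr>)) (\<lambda>x. x) g"
    unfolding exact_at_add_monoid by (auto simp: K_def)
  then have E: "\<exists>x. Poly_Mapping.keys x \<subseteq> carrier A \<times> carrier (N2\<lparr>carrier := K\<rparr>) \<and>
      y - ?T (\<lambda>x. x) x \<in> tensor_null R A (N2\<lparr>carrier := H2\<rparr>)"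
    if "Poly_Mapping.keys y \<subseteq> carrier A \<times> carrier (N2\<lparr>carrier := H2\<rparr>)"
      "?T g y \<in> tensor_null R A (N3\<lparr>carrier := H3\<rparr>)" for y
    using that unfolding faithfully_flat_embedded[OF ff KM H2M H3M inc g2 gK i]
      tensor_exact_iff[OF A KM H2M H3M inc g2 gK] by blast
  have "Poly_Mapping.keys y \<subseteq> carrier A \<times> H2"
    using y(1) H2(2) by (force simp: Y_def)
  then obtain z where z: "Poly_Mapping.keys z \<subseteq> carrier A \<times> K"
    "y - z \<in> tensor_null R A (N2\<lparr>carrier := H2\<rparr>)"
    using E[of y] X3(3)[OF H3(1,2)] by (auto simp: frag_tensor_id)
  have "(\<lambda>x. x) \<in> linear_maps R (N2\<lparr>carrier := H2\<rparr>) N2"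
    using H2s by (auto simp: linear_maps_def)
  from frag_tensor_null[OF A H2M A N2 linear_maps_id this z(2)]
  have yz: "y - z \<in> tensor_null R A N2" by (simp add: frag_tensor_id)
  define k where "k = inv_into (carrier N1) f"
  have k: "k m \<in> carrier N1" "f (k m) = m" if "m \<in> K" for m
  proof -
    have "m \<in> f ` carrier N1" using that H2s by (auto simp: ex K_def)
    then show "k m \<in> carrier N1" "f (k m) = m"
      unfolding k_def by (rule inv_into_into, rule f_inv_into_f)
  qed
  have "?T f (?T k z) = ?T (\<lambda>m. m) z"
    unfolding frag_tensor_comp by (rule frag_tensor_cong[OF z(1)]) (use k in auto)
  moreover have "Poly_Mapping.keys (?T k z) \<subseteq> carrier A \<times> carrier N1"
    by (rule frag_tensor_keys[OF z(1)]) (use k in auto)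
  ultimately show ?thesis
    using yz by (intro exI[of _ "?T k z"]) (simp add: frag_tensor_id)
qed

definition prod_module :: "('r, 'm, 'd) module_scheme \<Rightarrow> ('r, 'n, 'e) module_scheme \<Rightarrow> ('r, 'm \<times> 'n) module"
  where "prod_module M N = module_of_group (add_monoid M \<times>\<times> add_monoid N)
    (\<lambda>r (x, y). (r \<odot>\<^bsub>M\<^esub> x, r \<odot>\<^bsub>N\<^esub> y))"

lemma prod_module_simps [simp]:
  "carrier (prod_module M N) = carrier M \<times> carrier N"
  "\<zero>\<^bsub>prod_module M N\<^esub> = (\<zero>\<^bsub>M\<^esub>, \<zero>\<^bsub>N\<^esub>)"
  "(x, y) \<oplus>\<^bsub>prod_module M N\<^esub> (x', y') = (x \<oplus>\<^bsub>M\<^esub> x', y \<oplus>\<^bsub>N\<^esub> y')"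
  "r \<odot>\<^bsub>prod_module M N\<^esub> (x, y) = (r \<odot>\<^bsub>M\<^esub> x, r \<odot>\<^bsub>N\<^esub> y)"
  by (simp_all add: prod_module_def)

lemma prod_module_module:
  assumes "module R M" "module R N"
  shows "module R (prod_module M N)"
proof -
  interpret M: module R M by fact
  interpret N: module R N by fact
  have "comm_group (add_monoid M \<times>\<times> add_monoid N)"
    by (rule group.group_comm_groupI[OF DirProd_group[OF M.a_group N.a_group]])
      (auto simp: M.a_comm N.a_comm)
  then have "abelian_group (prod_module M N)"
    unfolding prod_module_def by (rule module_of_group_abelian_group)
  then show ?thesis
    by (intro moduleI)
      (auto simp: M.smult_l_distr M.smult_r_distr M.smult_assoc1
        N.smult_l_distr N.smult_r_distr N.smult_assoc1 M.R.is_cring)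
qed

theorem faithfully_flat_exact_iff:
  fixes R :: "('r, 'c) ring_scheme" and A :: "('r, 'a, 'd) module_scheme"
    and N1 :: "('r, 'n1, 'd1) module_scheme" and N2 :: "('r, 'n2, 'd2) module_scheme"
    and N3 :: "('r, 'n3, 'd3) module_scheme"
  assumes ff: "faithfully_flat_module R A"
    and N1: "module R N1" and N2: "module R N2" and N3: "module R N3"
    and f: "f \<in> linear_maps R N1 N2" and g: "g \<in> linear_maps R N2 N3"
    and gf: "\<forall>x\<in>carrier N1. g (f x) = \<zero>\<^bsub>N3\<^esub>"
  shows "exact_at (add_monoid N1) (add_monoid N2) (add_monoid N3) f g \<longleftrightarrow>
    exact_at (tensor_group R A N1) (tensor_group R A N2) (tensor_group R A N3)
         (tensor_map R A N2 (\<lambda>a. a) f) (tensor_map R A N3 (\<lambda>a. a) g)"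
proof
  have A: "module R A" using ff by (simp add: faithfully_flat_module_def)
  let ?T = "frag_tensor (\<lambda>a. a)"
  {
    assume "exact_at (add_monoid N1) (add_monoid N2) (add_monoid N3) f g"
    then show "exact_at (tensor_group R A N1) (tensor_group R A N2) (tensor_group R A N3)
         (tensor_map R A N2 (\<lambda>a. a) f) (tensor_map R A N3 (\<lambda>a. a) g)"
      using faithfully_flat_exact[OF ff N1 N2 N3 f g]
      unfolding exact_at_add_monoid tensor_exact_iff[OF A N1 N2 N3 f g gf] by blast
  }
  assume T: "exact_at (tensor_group R A N1) (tensor_group R A N2) (tensor_group R A N3)
         (tensor_map R A N2 (\<lambda>a. a) f) (tensor_map R A N3 (\<lambda>a. a) g)"
  note E = tensor_exact_iff[OF A N1 N2 N3 f g gf, THEN iffD1, OF T, rule_format]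
  interpret A: module R A by fact
  interpret N1: module R N1 by fact
  interpret N2: module R N2 by fact
  interpret N3: module R N3 by fact
  note fD = linear_mapsD[OF f] and gD = linear_mapsD[OF g]
  have f0: "f \<zero>\<^bsub>N1\<^esub> = \<zero>\<^bsub>N2\<^esub>" by (rule linear_maps_zero[OF f N1 N2])
  define U :: "('r, 'r) module" where "U = module_of_group (add_monoid R) (\<lambda>r s. r \<otimes>\<^bsub>R\<^esub> s)"
  have U_simps: "carrier U = carrier R" "\<zero>\<^bsub>U\<^esub> = \<zero>\<^bsub>R\<^esub>" "ring.add U = ring.add R" "smult U = (\<lambda>r s. r \<otimes>\<^bsub>R\<^esub> s)"
    by (simp_all add: U_def)
  have U: "module R U"
  proof (rule moduleI)
    show "abelian_group U"
      unfolding U_def by (rule module_of_group_abelian_group[OF A.R.a_comm_group])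
  qed (auto simp: U_simps A.R.is_cring A.R.l_distr A.R.r_distr A.R.m_assoc)
  define Z where "Z = U\<lparr>carrier := {\<zero>\<^bsub>U\<^esub>}\<rparr>"
  have Z: "module R Z"
    unfolding Z_def by (rule submodule_module[OF U zero_submodule[OF U]])
  have Z_simps: "carrier Z = {\<zero>\<^bsub>R\<^esub>}" "\<zero>\<^bsub>Z\<^esub> = \<zero>\<^bsub>R\<^esub>" "ring.add Z = ring.add R" "smult Z = (\<lambda>r s. r \<otimes>\<^bsub>R\<^esub> s)"
    by (simp_all add: Z_def U_simps)
  have "y \<in> f ` carrier N1" if y: "y \<in> carrier N2" "g y = \<zero>\<^bsub>N3\<^esub>" for y
  proof -
    define D where "D = prod_module N1 U"
    have D: "module R D" unfolding D_def by (rule prod_module_module[OF N1 U])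
    have D_simps: "carrier D = carrier N1 \<times> carrier R" by (simp add: D_def U_simps)
    define k where "k = (\<lambda>(n, r). f n \<oplus>\<^bsub>N2\<^esub> r \<odot>\<^bsub>N2\<^esub> y)"
    have k: "k \<in> linear_maps R D N2"
      by (rule linear_mapsI)
        (use y fD in \<open>auto simp: k_def D_def U_simps N2.smult_l_distr N2.smult_r_distr
          N2.smult_assoc1 N2.M.a_ac\<close>)
    define L where "L = {d \<in> carrier D. k d = \<zero>\<^bsub>N2\<^esub>}"
    have L: "submodule L R D"
      using preimage_submodule[OF D N2 k module.carrier_is_submodule[OF D] zero_submodule[OF N2]]
      by (simp add: L_def)
    note LM = submodule_module[OF D L]
    have incL: "(\<lambda>x. x) \<in> linear_maps R (D\<lparr>carrier := L\<rparr>) D"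
      by (auto simp: linear_maps_def L_def)
    define I where "I = {r \<in> carrier R. \<exists>n\<in>carrier N1. f n = r \<odot>\<^bsub>N2\<^esub> y}"
    have LI: "snd d \<in> I" if "d \<in> L" for d
    proof -
      obtain n r where d: "d = (n, r)" by (cases d)
      with that have n: "n \<in> carrier N1" "r \<in> carrier R" "f n \<oplus>\<^bsub>N2\<^esub> r \<odot>\<^bsub>N2\<^esub> y = \<zero>\<^bsub>N2\<^esub>"
        by (auto simp: L_def D_simps k_def)
      have "f ((\<ominus>\<^bsub>R\<^esub> \<one>\<^bsub>R\<^esub>) \<odot>\<^bsub>N1\<^esub> n) = \<ominus>\<^bsub>N2\<^esub> (f n)"
        using n fD by (simp add: N2.smult_l_minus)
      also have "\<dots> = r \<odot>\<^bsub>N2\<^esub> y"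
        using n fD y by (metis N2.M.minus_equality N2.M.a_comm N2.smult_closed)
      finally show ?thesis
        using n d by (auto simp: I_def intro!: bexI[of _ "(\<ominus>\<^bsub>R\<^esub> \<one>\<^bsub>R\<^esub>) \<odot>\<^bsub>N1\<^esub> n"])
    qed
    have I: "submodule I R U"
    proof (rule module.submoduleI[OF U])
      show "\<zero>\<^bsub>U\<^esub> \<in> I" using y by (auto simp: I_def U_simps f0 intro!: bexI[of _ "\<zero>\<^bsub>N1\<^esub>"])
      fix r assume r: "r \<in> I"
      then obtain n where n: "n \<in> carrier N1" "f n = r \<odot>\<^bsub>N2\<^esub> y" "r \<in> carrier R" by (auto simp: I_def)
      have s: "t \<odot>\<^bsub>U\<^esub> r \<in> I" if "t \<in> carrier R" for t
        using n y fD that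
        by (auto simp: I_def U_simps N2.smult_assoc1 intro!: bexI[of _ "t \<odot>\<^bsub>N1\<^esub> n"])
      then show "t \<odot>\<^bsub>U\<^esub> r \<in> I" if "t \<in> carrier R" for t using that .
      have "(\<ominus>\<^bsub>R\<^esub> \<one>\<^bsub>R\<^esub>) \<odot>\<^bsub>U\<^esub> r = \<ominus>\<^bsub>U\<^esub> r"
        using module.smult_l_minus[OF U, of "\<one>\<^bsub>R\<^esub>" r] n module.smult_one[OF U, of r]
        by (simp add: U_simps)
      then show "\<ominus>\<^bsub>U\<^esub> r \<in> I" using s[of "\<ominus>\<^bsub>R\<^esub> \<one>\<^bsub>R\<^esub>"] by simp
      fix r' assume "r' \<in> I"
      then obtain n' where n': "n' \<in> carrier N1" "f n' = r' \<odot>\<^bsub>N2\<^esub> y" "r' \<in> carrier R" by (auto simp: I_def)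
      show "r \<oplus>\<^bsub>U\<^esub> r' \<in> I"
        using n n' y fD
        by (auto simp: I_def U_simps N2.smult_l_distr intro!: bexI[of _ "n \<oplus>\<^bsub>N1\<^esub> n'"])
    qed (auto simp: I_def U_simps)
    note IM = submodule_module[OF U I]
    have incI: "(\<lambda>x. x) \<in> linear_maps R (U\<lparr>carrier := I\<rparr>) U"
      by (auto simp: linear_maps_def I_def U_simps)
    have zU: "(\<lambda>_. \<zero>\<^bsub>R\<^esub>) \<in> linear_maps R U Z"
      by (rule linear_mapsI) (auto simp: U_simps Z_simps)
    have sndD: "snd \<in> linear_maps R D U"
      by (rule linear_mapsI) (auto simp: D_def)
    have gen1: "\<exists>z. Poly_Mapping.keys z \<subseteq> carrier A \<times> I \<and> frag_of (a, \<one>\<^bsub>R\<^esub>) - z \<in> tensor_null R A U"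
      if a: "a \<in> carrier A" for a
    proof -
      have "frag_of (a, \<zero>\<^bsub>N3\<^esub>) \<in> tensor_null R A N3"
        using frag_tensor_zero_map[OF A N3, of "frag_of (a, y)" "{y}"] a by simp
      then obtain x where x: "Poly_Mapping.keys x \<subseteq> carrier A \<times> carrier N1"
        "frag_of (a, y) - ?T f x \<in> tensor_null R A N2"
        using E[of "frag_of (a, y)"] a y by auto
      define w where "w = frag_of (a, (\<zero>\<^bsub>N1\<^esub>, \<one>\<^bsub>R\<^esub>)) - ?T (\<lambda>n. (n, \<zero>\<^bsub>R\<^esub>)) x"
      have kx: "Poly_Mapping.keys (?T (\<lambda>n. (n, \<zero>\<^bsub>R\<^esub>)) x) \<subseteq> carrier A \<times> carrier D"
        by (rule frag_tensor_keys[OF x(1)]) (auto simp: D_simps)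
      have w: "Poly_Mapping.keys w \<subseteq> carrier A \<times> carrier D"
        using keys_diff[of "frag_of (a, (\<zero>\<^bsub>N1\<^esub>, \<one>\<^bsub>R\<^esub>))" "?T (\<lambda>n. (n, \<zero>\<^bsub>R\<^esub>)) x"] kx a
        unfolding w_def by (auto simp: D_simps keys_frag_of)
      have "?T k (?T (\<lambda>n. (n, \<zero>\<^bsub>R\<^esub>)) x) = ?T f x"
        unfolding frag_tensor_comp
        by (rule frag_tensor_cong[OF x(1)]) (use fD y in \<open>auto simp: k_def\<close>)
      then have "?T k w \<in> tensor_null R A N2"
        using x(2) y by (simp add: w_def frag_tensor_diff k_def f0)
      moreover have "(\<lambda>x. x) ` carrier (D\<lparr>carrier := L\<rparr>) = {d \<in> carrier D. k d = \<zero>\<^bsub>N2\<^esub>}"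
        by (auto simp: L_def)
      ultimately obtain z where z: "Poly_Mapping.keys z \<subseteq> carrier A \<times> L" "w - z \<in> tensor_null R A D"
        using faithfully_flat_exact[OF ff LM D N2 incL k _ w] by (auto simp: frag_tensor_id)
      have "?T snd (?T (\<lambda>n. (n, \<zero>\<^bsub>R\<^esub>)) x) \<in> tensor_null R A U"
        using frag_tensor_zero_map[OF A U x(1)] by (simp add: frag_tensor_comp U_simps)
      from tensor_null_add[OF frag_tensor_null[OF A D A U linear_maps_id sndD z(2)] this]
      have "frag_of (a, \<one>\<^bsub>R\<^esub>) - ?T snd z \<in> tensor_null R A U"
        by (simp add: w_def frag_tensor_diff)
      moreover have "Poly_Mapping.keys (?T snd z) \<subseteq> carrier A \<times> I"
        by (rule frag_tensor_keys[OF z(1)]) (use LI in auto)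
      ultimately show ?thesis by blast
    qed
    have all: "\<exists>z. Poly_Mapping.keys z \<subseteq> carrier A \<times> I \<and> v - z \<in> tensor_null R A U"
      if "Poly_Mapping.keys v \<subseteq> carrier A \<times> carrier U" for v
      using that
    proof (induction v rule: frag_induction)
      case zero
      show ?case by (rule exI[of _ 0]) (simp add: tensor_null_0)
    next
      case (one p)
      then obtain a r where p: "p = (a, r)" "a \<in> carrier A" "r \<in> carrier R" by (auto simp: U_simps)
      obtain z where z: "Poly_Mapping.keys z \<subseteq> carrier A \<times> I"
        "frag_of (r \<odot>\<^bsub>A\<^esub> a, \<one>\<^bsub>R\<^esub>) - z \<in> tensor_null R A U"
        using gen1[of "r \<odot>\<^bsub>A\<^esub> a"] p by auto
      have "frag_of (r \<odot>\<^bsub>A\<^esub> a, \<one>\<^bsub>R\<^esub>) - frag_of (a, r \<odot>\<^bsub>U\<^esub> \<one>\<^bsub>R\<^esub>) \<in> tensor_null R A U"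
        by (intro tensor_null_rels tensor_relsI(3)) (use p in \<open>auto simp: U_simps\<close>)
      from tensor_null_diff[OF A U z(2) this] have "frag_of p - z \<in> tensor_null R A U"
        using p by (simp add: U_simps)
      with z(1) show ?case by blast
    next
      case (diff v v')
      then obtain z z' where z: "Poly_Mapping.keys z \<subseteq> carrier A \<times> I" "v - z \<in> tensor_null R A U"
        "Poly_Mapping.keys z' \<subseteq> carrier A \<times> I" "v' - z' \<in> tensor_null R A U" by blast
      have "(v - v') - (z - z') \<in> tensor_null R A U"
        using tensor_null_diff[OF A U z(2,4)] by (simp add: algebra_simps)
      moreover have "Poly_Mapping.keys (z - z') \<subseteq> carrier A \<times> I"
        using keys_diff[of z z'] z by blast
      ultimately show ?case by blast
    qed
    have zc: "\<forall>x\<in>carrier (U\<lparr>carrier := I\<rparr>). \<zero>\<^bsub>R\<^esub> = \<zero>\<^bsub>Z\<^esub>" by (simp add: Z_simps)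
    have T': "exact_at (tensor_group R A (U\<lparr>carrier := I\<rparr>)) (tensor_group R A U) (tensor_group R A Z)
         (tensor_map R A U (\<lambda>a. a) (\<lambda>x. x)) (tensor_map R A Z (\<lambda>a. a) (\<lambda>_. \<zero>\<^bsub>R\<^esub>))"
      unfolding tensor_exact_iff[OF A IM U Z incI zU zc]
      using all by (auto simp: frag_tensor_id)
    define \<phi> :: "'r \<Rightarrow> (nat \<Rightarrow> 'r) set" where "\<phi> r = {\<lambda>_. r}" for r
    have \<phi>: "inj_on \<phi> B" for B by (auto simp: inj_on_def \<phi>_def fun_eq_iff)
    have "exact_at (add_monoid (U\<lparr>carrier := I\<rparr>)) (add_monoid U) (add_monoid Z) (\<lambda>x. x) (\<lambda>_. \<zero>\<^bsub>R\<^esub>)"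
      by (rule faithfully_flat_embedded[OF ff IM U Z incI zU zc \<phi> \<phi> \<phi>, THEN iffD2, OF T'])
    then have "I = carrier R"
      unfolding exact_at_add_monoid by (simp add: U_simps Z_simps)
    then have "\<one>\<^bsub>R\<^esub> \<in> I" by simp
    then show ?thesis using y by (auto simp: I_def)
  qed
  then show "exact_at (add_monoid N1) (add_monoid N2) (add_monoid N3) f g"
    unfolding exact_at_add_monoid using gf fD(1) by blast
qed

end

theory Submission
  imports Defs
begin
text \<open>Projectivity ascends along any ring homomorphism by adjunction (\<open>base_change_projective\<close>). Descent
  along a faithfully flat \<open>h : R \<rightarrow> S\<close> is the theorem of Raynaud and Gruson. The classical argument
  passes through the Mittag-Leffler condition; the one below extracts from it the few
  statements about linear equations that are used. Write \<open>\<iota> : P \<rightarrow> S \<otimes> P\<close> for \<open>m \<mapsto> 1 \<otimes> m\<close>.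

  Two features of faithful flatness enter. The solutions over \<open>S\<close> of a finite system of linear
  equations over \<open>R\<close> are spanned by the solutions over \<open>R\<close> (\<open>flat_solutions\<close>), and an element of a
  module that lies in the \<open>S\<close>-span of a submodule lies in the submodule (\<open>descend_membership\<close>).

  A countably generated module \<open>P\<close> is projective as soon as every \<open>p \<in> P\<close> is fixed by some
  endomorphism of the form \<open>\<Sum> \<theta>\<^sub>i(\<sqdot>) y\<^sub>i\<close> (the trace property): subtracting such endomorphisms from the identity kills
  the generators one at a time, which writes the identity as a locally finite sum of maps of finite
  rank (\<open>lift_extends\<close>). A projective \<open>S \<otimes> P\<close> has this property over \<open>S\<close>, so linear functionals on \<open>P\<close> have to be
  produced from functionals on \<open>S \<otimes> P\<close>. Call a function with values in \<open>R\<close> on a finite set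
  \<open>X \<subseteq> P\<close> admissible if some functional on \<open>S \<otimes> P\<close> induces it on \<open>X\<close>. The crucial point is that every
  functional on \<open>S \<otimes> P\<close> is on \<open>X\<close> an \<open>S\<close>-combination of admissible functions
  (\<open>functional_descends\<close>): for \<open>u \<in> X\<close> the expansion of \<open>\<iota> u\<close> in a dual basis is a relation in
  \<open>S \<otimes> P\<close>, it follows from finitely many instances of linearity, every function satisfying these
  instances is admissible on \<open>X\<close>, and the instances form a linear system over \<open>R\<close> which is solved by
  the functional. Consequently admissible functions extend to larger finite sets
  (\<open>admissible_extend\<close>), hence along a countable generating set to \<open>R\<close>-linear functionals, and the
  property of \<open>S \<otimes> P\<close> descends to \<open>P\<close> (\<open>finite_rank_fixing\<close>).

  For arbitrary \<open>P\<close> this is combined with a devissage in the manner of Kaplansky. With respect to a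
  dual basis of \<open>S \<otimes> P\<close>, there are many submodules \<open>M'\<close> of \<open>P\<close> whose base change is the summand cut
  out by a set of coordinates, and each of them is contained in a larger one \<open>M''\<close> containing a
  prescribed element such that \<open>M'' / M'\<close> is countably generated (\<open>splits_extend\<close>). All of the above is done relative
  to \<open>M'\<close>; thus lifts of a map on \<open>P\<close> extend from \<open>M'\<close> to \<open>M''\<close>, and Zorn's lemma gives a lift on
  all of \<open>P\<close> (\<open>lift_exists\<close>).\<close>

section \<open>Modules and linear maps\<close>

abbreviation regular_module :: "('r, 'c) ring_scheme \<Rightarrow> ('r, 'r) module"
  where "regular_module R \<equiv> restrict_scalars (\<lambda>r. r) R"

lemma restrict_scalars_simps [simp]:
  "carrier (restrict_scalars h S) = carrier S"
  "ring.add (restrict_scalars h S) = ring.add S"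
  "\<zero>\<^bsub>restrict_scalars h S\<^esub> = \<zero>\<^bsub>S\<^esub>"
  "r \<odot>\<^bsub>restrict_scalars h S\<^esub> s = h r \<otimes>\<^bsub>S\<^esub> s"
  by (simp_all add: restrict_scalars_def)

lemma restrict_scalars_minus [simp]:
  "a_inv (restrict_scalars h S) = a_inv S"
  "a \<ominus>\<^bsub>restrict_scalars h S\<^esub> b = a \<ominus>\<^bsub>S\<^esub> b"
  by (simp_all add: a_minus_def a_inv_def m_inv_def fun_eq_iff)

lemma regular_module_module: "cring R \<Longrightarrow> module R (regular_module R)"
  by (rule restrict_scalars_module) (auto simp: ring_hom_def)

lemma free_module_mono: "A \<subseteq> B \<Longrightarrow> carrier (free_module R A) \<subseteq> carrier (free_module R B)"
  by (auto simp: free_module_simps)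

lemma (in abelian_group) minus_zero_imp_eq:
  assumes "a \<in> carrier G" "b \<in> carrier G" "a \<ominus> b = \<zero>"
  shows "a = b"
proof -
  have "a = (a \<ominus> b) \<oplus> b" using assms(1,2) by (simp add: a_minus_def a_assoc l_neg)
  then show ?thesis using assms by simp
qed

lemma lincomb_zero: "module R M \<Longrightarrow> lincomb R M m (\<lambda>p. \<zero>\<^bsub>R\<^esub>) = \<zero>\<^bsub>M\<^esub>"
proof -
  assume "module R M"
  then interpret M: module R M .
  show ?thesis by (simp add: lincomb_def)
qed

lemma submodule_minus_closed:
  assumes "module R M" "submodule H R M" "a \<in> H" "b \<in> H"
  shows "a \<ominus>\<^bsub>M\<^esub> b \<in> H"
proof -
  interpret M: module R M by fact
  show ?thesis
    using M.submoduleE(3,5)[OF assms(2)] assms(3,4) by (simp add: a_minus_def)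
qed

lemma submodule_zero_closed: "submodule H R M \<Longrightarrow> \<zero>\<^bsub>M\<^esub> \<in> H"
  using subgroup.one_closed[OF submodule.axioms(1)] by fastforce

lemma submodule_finsum_closed:
  assumes "module R M" "submodule H R M" "\<And>i. i \<in> I \<Longrightarrow> a i \<in> H"
  shows "finsum M a I \<in> H"
proof -
  interpret M: module R M by fact
  have H: "H \<subseteq> carrier M" by (rule M.submoduleE(1)[OF assms(2)])
  show ?thesis
    using assms(3)
  proof (induction I rule: infinite_finite_induct)
    case (insert i I)
    then have "finsum M a (insert i I) = a i \<oplus>\<^bsub>M\<^esub> finsum M a I"
      using H by (intro M.finsum_insert) auto
    then show ?case
      using insert M.submoduleE(5)[OF assms(2)] by simp
  qed (use submodule_zero_closed[OF assms(2)] in auto)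
qed

lemma submoduleI_smult:
  assumes "module R M" "H \<subseteq> carrier M" "\<zero>\<^bsub>M\<^esub> \<in> H"
    and "\<And>a b. a \<in> H \<Longrightarrow> b \<in> H \<Longrightarrow> a \<oplus>\<^bsub>M\<^esub> b \<in> H"
    and s: "\<And>r a. r \<in> carrier R \<Longrightarrow> a \<in> H \<Longrightarrow> r \<odot>\<^bsub>M\<^esub> a \<in> H"
  shows "submodule H R M"
proof -
  interpret M: module R M by fact
  have "\<ominus>\<^bsub>M\<^esub> a \<in> H" if "a \<in> H" for a
    using s[of "\<ominus>\<^bsub>R\<^esub> \<one>\<^bsub>R\<^esub>" a] that assms(2) by (auto simp: M.smult_l_minus)
  then show ?thesis using assms by (intro M.submoduleI) auto
qed

lemma linear_maps_minus:
  assumes "module R M" "module R N" "f \<in> linear_maps R M N" "x \<in> carrier M" "y \<in> carrier M"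
  shows "f (x \<ominus>\<^bsub>M\<^esub> y) = f x \<ominus>\<^bsub>N\<^esub> f y"
proof -
  interpret M: module R M by fact
  interpret N: module R N by fact
  have m: "\<ominus>\<^bsub>M\<^esub> y = (\<ominus>\<^bsub>R\<^esub> \<one>\<^bsub>R\<^esub>) \<odot>\<^bsub>M\<^esub> y" using assms by (simp add: M.smult_l_minus)
  have "f (\<ominus>\<^bsub>M\<^esub> y) = \<ominus>\<^bsub>N\<^esub> f y"
    unfolding m using assms linear_mapsD[OF assms(3)] by (simp add: N.smult_l_minus)
  then show ?thesis
    using assms linear_mapsD[OF assms(3)] by (simp add: a_minus_def)
qed

text \<open>A projective module has a dual basis that is indexed by its own elements: the free module on all
  elements surjects onto it.\<close>

lemma projective_module_section:
  fixes P :: "('r, 'p, 'd) module_scheme"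
  assumes "projective_module R P"
  shows "\<exists>s\<in>linear_maps R P (free_module R (carrier P)). \<forall>x\<in>carrier P. lincomb R P (\<lambda>p. p) (s x) = x"
proof -
  have P: "module R P" using assms by (simp add: projective_module_def)
  interpret P: module R P by fact
  let ?F = "free_module R (carrier P)"
  note lin = lincomb_linear[OF P, of "carrier P" "\<lambda>p. p"]
  have "p \<in> lincomb R P (\<lambda>p. p) ` carrier ?F" if p: "p \<in> carrier P" for p
  proof (rule image_eqI)
    define c where "c = (\<lambda>q. if q = p then \<one>\<^bsub>R\<^esub> else \<zero>\<^bsub>R\<^esub>)"
    have s: "{q. c q \<noteq> \<zero>\<^bsub>R\<^esub>} \<subseteq> {p}" and r: "range c \<subseteq> carrier R" by (auto simp: c_def)
    with p show "c \<in> carrier ?F"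
      using finite_subset[OF s] by (auto simp: free_module_simps)
    have "lincomb R P (\<lambda>p. p) c = (\<Oplus>\<^bsub>P\<^esub>q\<in>{p}. c q \<odot>\<^bsub>P\<^esub> q)"
      by (rule lincomb_superset[OF P _ r _ s]) (use p in auto)
    then show "p = lincomb R P (\<lambda>p. p) c"
      using p by (simp add: c_def)
  qed
  then have "lincomb R P (\<lambda>p. p) ` carrier ?F = carrier P"
    using linear_mapsD(1)[OF lin] by blast
  from projective_module_lift[OF assms free_module_module[OF P.R.is_cring] P lin this linear_maps_id]
  show ?thesis by simp
qed

section \<open>Evaluation of formal tensors\<close>

locale ring_change = R: cring R + S: cring S
  for R :: "('r, 'c) ring_scheme" and S :: "('s, 'd) ring_scheme" +
  fixes h :: "'r \<Rightarrow> 's"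
  assumes h_hom: "h \<in> ring_hom R S"
begin

sublocale h: ring_hom_cring R S h
  by unfold_locales (rule h_hom)

abbreviation A where "A \<equiv> restrict_scalars h S"

lemma A_module: "module R A"
  by (rule restrict_scalars_module) (fact R.is_cring S.is_cring h_hom)+

definition restrict_module :: "('s, 'n, 'x) module_scheme \<Rightarrow> ('r, 'n) module"
  where "restrict_module N = module_of_group (add_monoid N) (\<lambda>r n. h r \<odot>\<^bsub>N\<^esub> n)"

lemma restrict_module_simps [simp]:
  "carrier (restrict_module N) = carrier N"
  "ring.add (restrict_module N) = ring.add N"
  "\<zero>\<^bsub>restrict_module N\<^esub> = \<zero>\<^bsub>N\<^esub>"
  "r \<odot>\<^bsub>restrict_module N\<^esub> n = h r \<odot>\<^bsub>N\<^esub> n"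
  by (simp_all add: restrict_module_def)

lemma restrict_module_minus [simp]:
  "a_inv (restrict_module N) = a_inv N"
  "a \<ominus>\<^bsub>restrict_module N\<^esub> b = a \<ominus>\<^bsub>N\<^esub> b"
  by (simp_all add: a_minus_def a_inv_def m_inv_def fun_eq_iff)

lemma restrict_module_module:
  assumes "module S N"
  shows "module R (restrict_module N)"
proof -
  interpret N: module S N by fact
  have "abelian_group (restrict_module N)"
    unfolding restrict_module_def by (rule module_of_group_abelian_group[OF N.a_comm_group])
  then show ?thesis
    by (intro moduleI) (auto simp: N.smult_l_distr N.smult_r_distr N.smult_assoc1 R.is_cring)
qed

text \<open>Linear maps into a module with restricted scalars are the semilinear maps.\<close>

abbreviation semilinear where "semilinear M N \<equiv> linear_maps R M (restrict_module N)"

lemma h_semilinear: "h \<in> semilinear (regular_module R) (regular_module S)"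
  by (rule linear_mapsI) simp_all

abbreviation frags :: "'m set \<Rightarrow> ('s \<times> 'm \<Rightarrow>\<^sub>0 int) set"
  where "frags X \<equiv> {z. Poly_Mapping.keys z \<subseteq> carrier S \<times> X}"

abbreviation scale_frag :: "'s \<Rightarrow> ('s \<times> 'm \<Rightarrow>\<^sub>0 int) \<Rightarrow> ('s \<times> 'm \<Rightarrow>\<^sub>0 int)"
  where "scale_frag s \<equiv> frag_tensor (\<lambda>t. s \<otimes>\<^bsub>S\<^esub> t) (\<lambda>m. m)"

lemma frags_add: "x \<in> frags X \<Longrightarrow> y \<in> frags X \<Longrightarrow> x + y \<in> frags X"
  using keys_add[of x y] by auto

lemma frags_diff: "x \<in> frags X \<Longrightarrow> y \<in> frags X \<Longrightarrow> x - y \<in> frags X"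
  using keys_diff[of x y] by auto

lemma frags_of: "s \<in> carrier S \<Longrightarrow> m \<in> X \<Longrightarrow> frag_of (s, m) \<in> frags X"
  by (simp add: keys_frag_of)

lemma frags_scale: "s \<in> carrier S \<Longrightarrow> x \<in> frags X \<Longrightarrow> scale_frag s x \<in> frags X"
  using frag_tensor_keys[of x "carrier S" X "\<lambda>t. s \<otimes>\<^bsub>S\<^esub> t" "carrier S" "\<lambda>m. m" X] by auto

lemma frags_map: "x \<in> frags X \<Longrightarrow> f \<in> X \<rightarrow> Y \<Longrightarrow> frag_tensor (\<lambda>a. a) f x \<in> frags Y"
  using frag_tensor_keys[of x "carrier S" X "\<lambda>t. t" "carrier S" f Y] by (auto simp: Pi_iff)

lemma frags_mono: "x \<in> frags X \<Longrightarrow> X \<subseteq> Y \<Longrightarrow> x \<in> frags Y"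
  by auto

lemma frags_sum: "(\<And>i. i \<in> I \<Longrightarrow> x i \<in> frags X) \<Longrightarrow> sum x I \<in> frags X"
proof (induction I rule: infinite_finite_induct)
  case (insert i I)
  have "sum x I \<in> frags X" by (rule insert.IH) (use insert.prems in blast)
  moreover have "x i \<in> frags X" using insert.prems by blast
  ultimately show ?case
    unfolding sum.insert[OF insert.hyps] by (intro frags_add)
qed auto

lemma frags_induct [consumes 1, case_names zero one diff]:
  assumes "z \<in> frags X" "Q 0"
    and "\<And>s m. s \<in> carrier S \<Longrightarrow> m \<in> X \<Longrightarrow> Q (frag_of (s, m))"
    and "\<And>x y. x \<in> frags X \<Longrightarrow> y \<in> frags X \<Longrightarrow> Q x \<Longrightarrow> Q y \<Longrightarrow> Q (x - y)"
  shows "Q z"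
proof -
  have "Poly_Mapping.keys z \<subseteq> carrier S \<times> X" using assms(1) by simp
  then show ?thesis
    by (induction z rule: free_Abelian_group_induct) (use assms in auto)
qed

text \<open>The function \<open>t\<close> need not be linear, so the value depends on the formal sum and not only on the
  tensor that it represents. This generality is essential for the linearity tests below, where \<open>t\<close> is
  linear only as far as a given relation requires.\<close>

definition tensor_eval ::
    "('r, 'm, 'x) module_scheme \<Rightarrow> ('s, 'n, 'y) module_scheme \<Rightarrow> ('m \<Rightarrow> 'n) \<Rightarrow> ('s \<times> 'm \<Rightarrow>\<^sub>0 int) \<Rightarrow> 'n"
  where "tensor_eval M N t = (SOME e. e \<in> hom (free_Abelian_group (carrier S \<times> carrier M)) (add_monoid N) \<and>
    (\<forall>s\<in>carrier S. \<forall>m\<in>carrier M. e (frag_of (s, m)) = s \<odot>\<^bsub>N\<^esub> t m))"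

lemma tensor_eval:
  assumes N: "module S N" and t: "t \<in> carrier M \<rightarrow> carrier N"
  shows tensor_eval_closed: "x \<in> frags (carrier M) \<Longrightarrow> tensor_eval M N t x \<in> carrier N"
    and tensor_eval_add: "x \<in> frags (carrier M) \<Longrightarrow> y \<in> frags (carrier M) \<Longrightarrow>
      tensor_eval M N t (x + y) = tensor_eval M N t x \<oplus>\<^bsub>N\<^esub> tensor_eval M N t y"
    and tensor_eval_of: "s \<in> carrier S \<Longrightarrow> m \<in> carrier M \<Longrightarrow> tensor_eval M N t (frag_of (s, m)) = s \<odot>\<^bsub>N\<^esub> t m"
    and tensor_eval_0: "tensor_eval M N t 0 = \<zero>\<^bsub>N\<^esub>"
    and tensor_eval_diff: "x \<in> frags (carrier M) \<Longrightarrow> y \<in> frags (carrier M) \<Longrightarrow>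
      tensor_eval M N t (x - y) = tensor_eval M N t x \<ominus>\<^bsub>N\<^esub> tensor_eval M N t y"
proof -
  interpret N: module S N by fact
  have sub: "(\<lambda>(s, m). s \<odot>\<^bsub>N\<^esub> t m) ` (carrier S \<times> carrier M) \<subseteq> carrier (add_monoid N)"
    using t by auto
  obtain e where e: "e \<in> hom (free_Abelian_group (carrier S \<times> carrier M)) (add_monoid N)"
    "\<And>x. x \<in> carrier S \<times> carrier M \<Longrightarrow> e (frag_of x) = (\<lambda>(s, m). s \<odot>\<^bsub>N\<^esub> t m) x"
    using comm_group.free_Abelian_group_universal[OF N.a_comm_group sub] by blast
  have "tensor_eval M N t \<in> hom (free_Abelian_group (carrier S \<times> carrier M)) (add_monoid N) \<and>
    (\<forall>s\<in>carrier S. \<forall>m\<in>carrier M. tensor_eval M N t (frag_of (s, m)) = s \<odot>\<^bsub>N\<^esub> t m)"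
    unfolding tensor_eval_def by (rule someI[of _ e]) (use e in auto)
  then have hom: "tensor_eval M N t \<in> hom (free_Abelian_group (carrier S \<times> carrier M)) (add_monoid N)"
    and of: "\<And>s m. s \<in> carrier S \<Longrightarrow> m \<in> carrier M \<Longrightarrow> tensor_eval M N t (frag_of (s, m)) = s \<odot>\<^bsub>N\<^esub> t m"
    by auto
  show "s \<in> carrier S \<Longrightarrow> m \<in> carrier M \<Longrightarrow> tensor_eval M N t (frag_of (s, m)) = s \<odot>\<^bsub>N\<^esub> t m"
    by (rule of)
  show c: "tensor_eval M N t x \<in> carrier N" if "x \<in> frags (carrier M)" for x
    using hom that by (auto simp: hom_def Pi_iff)
  show a: "tensor_eval M N t (x + y) = tensor_eval M N t x \<oplus>\<^bsub>N\<^esub> tensor_eval M N t y"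
    if "x \<in> frags (carrier M)" "y \<in> frags (carrier M)" for x y
    using hom that by (auto simp: hom_def)
  have 0: "(0 :: ('s \<times> 'e) \<Rightarrow>\<^sub>0 int) \<in> frags (carrier M)" by simp
  show "tensor_eval M N t 0 = \<zero>\<^bsub>N\<^esub>"
    using a[OF 0 0] c[OF 0] by simp
  show "tensor_eval M N t (x - y) = tensor_eval M N t x \<ominus>\<^bsub>N\<^esub> tensor_eval M N t y"
    if x: "x \<in> frags (carrier M)" and y: "y \<in> frags (carrier M)"
  proof -
    have "tensor_eval M N t x = tensor_eval M N t (x - y) \<oplus>\<^bsub>N\<^esub> tensor_eval M N t y"
      using a[OF frags_diff[OF x y] y] by simp
    then show ?thesis
      using c[OF x] c[OF y] c[OF frags_diff[OF x y]]
      by (simp add: a_minus_def N.a_assoc N.r_neg)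
  qed
qed

lemma tensor_eval_scale:
  assumes N: "module S N" and t: "t \<in> carrier M \<rightarrow> carrier N"
    and x: "x \<in> frags (carrier M)" and s: "s \<in> carrier S"
  shows "tensor_eval M N t (scale_frag s x) = s \<odot>\<^bsub>N\<^esub> tensor_eval M N t x"
proof -
  interpret N: module S N by fact
  show ?thesis
    using x
  proof (induction rule: frags_induct)
    case zero
    then show ?case using s by (simp add: tensor_eval_0[OF N t])
  next
    case (one a m)
    then show ?case using s t by (simp add: tensor_eval_of[OF N t] N.smult_assoc1 Pi_iff)
  next
    case (diff x y)
    show ?case
      using diff s frags_scale[OF s diff(1)] frags_scale[OF s diff(2)]
      by (simp add: frag_tensor_diff tensor_eval_diff[OF N t] tensor_eval_closed[OF N t]
          N.smult_r_distr N.smult_r_minus a_minus_def)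
  qed
qed

lemma tensor_eval_map:
  assumes N: "module S N" and t: "t \<in> carrier M' \<rightarrow> carrier N"
    and f: "f \<in> carrier M \<rightarrow> carrier M'" and x: "x \<in> frags (carrier M)"
  shows "tensor_eval M' N t (frag_tensor (\<lambda>a. a) f x) = tensor_eval M N (\<lambda>m. t (f m)) x"
proof -
  have tf: "(\<lambda>m. t (f m)) \<in> carrier M \<rightarrow> carrier N" using t f by auto
  show ?thesis
    using x
  proof (induction rule: frags_induct)
    case zero
    show ?case by (simp add: tensor_eval_0[OF N t] tensor_eval_0[OF N tf])
  next
    case (one a m)
    then show ?case using f by (simp add: tensor_eval_of[OF N t] tensor_eval_of[OF N tf] Pi_iff)
  next
    case (diff x y)
    show ?case
      using diff frags_map[OF diff(1) f] frags_map[OF diff(2) f]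
      by (simp add: frag_tensor_diff tensor_eval_diff[OF N t] tensor_eval_diff[OF N tf])
  qed
qed

lemma tensor_eval_null:
  assumes N: "module S N" and M: "module R M" and t: "t \<in> semilinear M N"
    and x: "x \<in> tensor_null R A M"
  shows "tensor_eval M N t x = \<zero>\<^bsub>N\<^esub>"
proof -
  interpret N: module S N by fact
  interpret M: module R M by fact
  note tD = linear_mapsD[OF t, simplified]
  have tc: "t \<in> carrier M \<rightarrow> carrier N" using tD(1) by auto
  note e = tensor_eval_closed[OF N tc] tensor_eval_diff[OF N tc] tensor_eval_of[OF N tc]
    tensor_eval_add[OF N tc] tensor_eval_0[OF N tc]
  have fr: "z \<in> frags (carrier M)" if "z \<in> tensor_null R A M" for z
    using tensor_null_keys[OF A_module M that] by simp
  note d = frags_diff[of _ "carrier M"] frags_of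
  have cancel: "p \<oplus>\<^bsub>N\<^esub> q \<ominus>\<^bsub>N\<^esub> p \<ominus>\<^bsub>N\<^esub> q = \<zero>\<^bsub>N\<^esub>" if "p \<in> carrier N" "q \<in> carrier N" for p q
  proof -
    have "p \<oplus>\<^bsub>N\<^esub> q \<ominus>\<^bsub>N\<^esub> p = q"
      using that by (simp add: a_minus_def N.M.add.m_comm[of p q] N.M.add.m_assoc N.M.r_neg)
    then show ?thesis using that by (simp add: a_minus_def N.M.r_neg)
  qed
  show ?thesis
    using A_module M x
  proof (induction rule: tensor_null_induct)
    case zero
    show ?case by (rule e)
  next
    case (rels x)
    then show ?case
    proof (cases rule: tensor_relsE)
      case (add_left a b m)
      then have ab: "a \<in> carrier S" "b \<in> carrier S" by simp_all
      have "tensor_eval M N t x = (a \<oplus>\<^bsub>S\<^esub> b) \<odot>\<^bsub>N\<^esub> t m \<ominus>\<^bsub>N\<^esub> a \<odot>\<^bsub>N\<^esub> t m \<ominus>\<^bsub>N\<^esub> b \<odot>\<^bsub>N\<^esub> t m"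
        unfolding add_left(1) using ab add_left(4)
        by (subst e(2), simp_all add: e d del: mem_Collect_eq)
      also have "\<dots> = \<zero>\<^bsub>N\<^esub>"
        using ab add_left(4) tD(1)
        by (simp add: N.smult_l_distr cancel)
      finally show ?thesis .
    next
      case (add_right a m n)
      then have a: "a \<in> carrier S" by simp
      have "tensor_eval M N t x = a \<odot>\<^bsub>N\<^esub> t (m \<oplus>\<^bsub>M\<^esub> n) \<ominus>\<^bsub>N\<^esub> a \<odot>\<^bsub>N\<^esub> t m \<ominus>\<^bsub>N\<^esub> a \<odot>\<^bsub>N\<^esub> t n"
        unfolding add_right(1) using a add_right(3,4)
        by (subst e(2), simp_all add: e d del: mem_Collect_eq)
      also have "\<dots> = \<zero>\<^bsub>N\<^esub>"
        using a add_right(3,4) tD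
        by (simp add: N.smult_r_distr cancel)
      finally show ?thesis .
    next
      case (smult r a m)
      then have a: "a \<in> carrier S" by simp
      have "tensor_eval M N t x = (h r \<otimes>\<^bsub>S\<^esub> a) \<odot>\<^bsub>N\<^esub> t m \<ominus>\<^bsub>N\<^esub> a \<odot>\<^bsub>N\<^esub> t (r \<odot>\<^bsub>M\<^esub> m)"
        unfolding smult(1) using a smult(2,4)
        by (subst e(2), simp_all add: e d del: mem_Collect_eq)
      also have "(h r \<otimes>\<^bsub>S\<^esub> a) \<odot>\<^bsub>N\<^esub> t m = a \<odot>\<^bsub>N\<^esub> t (r \<odot>\<^bsub>M\<^esub> m)"
        using a smult(2,4) tD(1) by (simp add: tD(3) N.smult_assoc1[symmetric] S.m_comm)
      finally show ?thesis
        using a smult(2,4) tD(1) by (simp add: tD(3) a_minus_def N.r_neg)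
    qed
  next
    case (add x y)
    then show ?case by (simp add: e fr del: mem_Collect_eq)
  next
    case (uminus x)
    have 0: "(0 :: ('s \<times> 'e) \<Rightarrow>\<^sub>0 int) \<in> frags (carrier M)" by simp
    have "tensor_eval M N t (0 - x) = \<zero>\<^bsub>N\<^esub> \<ominus>\<^bsub>N\<^esub> tensor_eval M N t x"
      unfolding e(2)[OF 0 fr[OF uminus(1)]] e(5) ..
    then show ?case using uminus by (simp add: a_minus_def)
  qed
qed


section \<open>Base change and its universal property\<close>

abbreviation bc :: "('r, 'm, 'e) module_scheme \<Rightarrow> ('s, ('s \<times> 'm \<Rightarrow>\<^sub>0 int) set) module"
  where "bc \<equiv> base_change R S h"

abbreviation cls :: "('r, 'm, 'e) module_scheme \<Rightarrow> ('s \<times> 'm \<Rightarrow>\<^sub>0 int) \<Rightarrow> ('s \<times> 'm \<Rightarrow>\<^sub>0 int) set"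
  where "cls \<equiv> tensor_class R A"

definition iota :: "('r, 'm, 'e) module_scheme \<Rightarrow> 'm \<Rightarrow> ('s \<times> 'm \<Rightarrow>\<^sub>0 int) set"
  where "iota M m = cls M (frag_of (\<one>\<^bsub>S\<^esub>, m))"

definition bc_span :: "('r, 'm, 'e) module_scheme \<Rightarrow> 'm set \<Rightarrow> ('s \<times> 'm \<Rightarrow>\<^sub>0 int) set set"
  where "bc_span M X = cls M ` frags X"

lemma bc_module: "module R M \<Longrightarrow> module S (bc M)"
  by (rule base_change_module[OF R.is_cring S.is_cring h_hom])

lemma carrier_bc: "carrier (bc M) = bc_span M (carrier M)"
  by (simp add: base_change_def carrier_tensor_group bc_span_def)

lemma cls_in_span: "z \<in> frags X \<Longrightarrow> cls M z \<in> bc_span M X"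
  by (auto simp: bc_span_def)

lemma bc_spanE:
  assumes "n \<in> bc_span M X"
  obtains z where "z \<in> frags X" "n = cls M z"
  using assms by (auto simp: bc_span_def)

lemma cls_closed: "z \<in> frags (carrier M) \<Longrightarrow> cls M z \<in> carrier (bc M)"
  unfolding carrier_bc by (rule cls_in_span)

lemma bc_span_mono: "X \<subseteq> Y \<Longrightarrow> bc_span M X \<subseteq> bc_span M Y"
  unfolding bc_span_def by (intro image_mono) auto

lemma bc_span_closed: "X \<subseteq> carrier M \<Longrightarrow> bc_span M X \<subseteq> carrier (bc M)"
  unfolding carrier_bc by (rule bc_span_mono)

lemma cls_zero: "\<zero>\<^bsub>bc M\<^esub> = cls M 0"
  by (simp add: base_change_def one_tensor_group tensor_class_0)

lemma cls_add: "module R M \<Longrightarrow> cls M x \<oplus>\<^bsub>bc M\<^esub> cls M y = cls M (x + y)"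
  by (simp add: base_change_def mult_tensor_group[OF A_module])

lemma cls_diff:
  assumes "module R M" "x \<in> frags (carrier M)" "y \<in> frags (carrier M)"
  shows "cls M (x - y) = cls M x \<ominus>\<^bsub>bc M\<^esub> cls M y"
proof -
  interpret N: module S "bc M" by (rule bc_module[OF assms(1)])
  have "cls M x = cls M (x - y) \<oplus>\<^bsub>bc M\<^esub> cls M y"
    by (simp add: cls_add[OF assms(1)])
  then show ?thesis
    using cls_closed[OF assms(3)] cls_closed[OF frags_diff[OF assms(2,3)]]
    by (simp add: a_minus_def N.a_assoc N.r_neg)
qed

lemma mult_linear: "s \<in> carrier S \<Longrightarrow> (\<lambda>t. s \<otimes>\<^bsub>S\<^esub> t) \<in> linear_maps R A A"
  by (rule linear_mapsI) (auto simp: S.r_distr S.m_lcomm)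

lemma cls_scale:
  assumes "module R M" "s \<in> carrier S"
  shows "s \<odot>\<^bsub>bc M\<^esub> cls M x = cls M (scale_frag s x)"
  using tensor_map_class[OF A_module assms(1) A_module assms(1) mult_linear[OF assms(2)] linear_maps_id, of x]
  by (simp add: base_change_def)

lemma cls_eq_iff: "module R M \<Longrightarrow> cls M x = cls M y \<longleftrightarrow> x - y \<in> tensor_null R A M"
  by (rule tensor_class_eq_iff[OF A_module])

lemma cls_of:
  assumes "module R M" "s \<in> carrier S"
  shows "cls M (frag_of (s, m)) = s \<odot>\<^bsub>bc M\<^esub> iota M m"
  using assms by (simp add: iota_def cls_scale)

lemma iota_in_span: "m \<in> X \<Longrightarrow> iota M m \<in> bc_span M X"
  unfolding iota_def by (intro cls_in_span frags_of) auto

lemma iota_closed: "m \<in> carrier M \<Longrightarrow> iota M m \<in> carrier (bc M)"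
  unfolding carrier_bc by (rule iota_in_span)

lemma iota_semilinear:
  assumes M: "module R M"
  shows "iota M \<in> semilinear M (bc M)"
proof (rule linear_mapsI)
  interpret M: module R M by fact
  fix x y assume xy: "x \<in> carrier M" "y \<in> carrier M"
  have "frag_of (\<one>\<^bsub>S\<^esub>, x \<oplus>\<^bsub>M\<^esub> y) - frag_of (\<one>\<^bsub>S\<^esub>, x) - frag_of (\<one>\<^bsub>S\<^esub>, y) \<in> tensor_null R A M"
    by (intro tensor_null_rels tensor_relsI(2)) (use xy in auto)
  then show "iota M (x \<oplus>\<^bsub>M\<^esub> y) = iota M x \<oplus>\<^bsub>restrict_module (bc M)\<^esub> iota M y"
    by (simp add: iota_def cls_add[OF M] cls_eq_iff[OF M] diff_diff_eq)
next
  interpret M: module R M by fact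
  fix r x assume rx: "r \<in> carrier R" "x \<in> carrier M"
  have "frag_of (r \<odot>\<^bsub>A\<^esub> \<one>\<^bsub>S\<^esub>, x) - frag_of (\<one>\<^bsub>S\<^esub>, r \<odot>\<^bsub>M\<^esub> x) \<in> tensor_null R A M"
    by (intro tensor_null_rels tensor_relsI(3)) (use rx in auto)
  then have "cls M (frag_of (h r, x)) = iota M (r \<odot>\<^bsub>M\<^esub> x)"
    using rx by (simp add: iota_def cls_eq_iff[OF M])
  then show "iota M (r \<odot>\<^bsub>M\<^esub> x) = r \<odot>\<^bsub>restrict_module (bc M)\<^esub> iota M x"
    using rx by (simp add: cls_of[OF M])
qed (simp add: iota_closed)

lemmas iotaD = linear_mapsD[OF iota_semilinear, simplified]

lemma iota_zero: "module R M \<Longrightarrow> iota M \<zero>\<^bsub>M\<^esub> = \<zero>\<^bsub>bc M\<^esub>"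
  using linear_maps_zero[OF iota_semilinear _ restrict_module_module[OF bc_module]] by fastforce

lemma bc_span_submodule:
  assumes M: "module R M" and X: "X \<subseteq> carrier M"
  shows "submodule (bc_span M X) S (bc M)"
proof (rule submoduleI_smult[OF bc_module[OF M] bc_span_closed[OF X]])
  show "\<zero>\<^bsub>bc M\<^esub> \<in> bc_span M X"
    unfolding cls_zero by (rule cls_in_span) simp
  fix a assume "a \<in> bc_span M X"
  then obtain x where x: "x \<in> frags X" "a = cls M x" by (rule bc_spanE)
  show "r \<odot>\<^bsub>bc M\<^esub> a \<in> bc_span M X" if "r \<in> carrier S" for r
    unfolding x(2) cls_scale[OF M that] by (intro cls_in_span frags_scale that x)
  fix b assume "b \<in> bc_span M X"
  then obtain y where y: "y \<in> frags X" "b = cls M y" by (rule bc_spanE)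
  show "a \<oplus>\<^bsub>bc M\<^esub> b \<in> bc_span M X"
    unfolding x(2) y(2) cls_add[OF M] by (intro cls_in_span frags_add x y)
qed

lemma bc_span_least:
  assumes M: "module R M" and W: "submodule W S (bc M)" and X: "X \<subseteq> carrier M"
    and sub: "\<And>m. m \<in> X \<Longrightarrow> iota M m \<in> W"
  shows "bc_span M X \<subseteq> W"
proof
  interpret N: module S "bc M" by (rule bc_module[OF M])
  note WE = N.submoduleE[OF W]
  fix n assume "n \<in> bc_span M X"
  then obtain z where z: "z \<in> frags X" and n: "n = cls M z" by (rule bc_spanE)
  show "n \<in> W"
    unfolding n using z
  proof (induction rule: frags_induct)
    case zero
    show ?case using submodule_zero_closed[OF W] by (simp add: cls_zero)
  next
    case (one s m)
    then show ?case using sub WE(4) by (simp add: cls_of[OF M])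
  next
    case (diff x y)
    have "x \<in> frags (carrier M)" "y \<in> frags (carrier M)"
      using diff(1,2) frags_mono[OF _ X] by blast+
    from cls_diff[OF M this] show ?case
      using submodule_minus_closed[OF bc_module[OF M] W diff(3,4)] by simp
  qed
qed

text \<open>The \<open>S\<close>-linear map on \<open>S \<otimes> M\<close> induced by a semilinear map on \<open>M\<close>. The choice of the representing
  formal sum is immaterial by \<open>bc_lift_cls\<close>.\<close>

definition bc_lift :: "('r, 'm, 'x) module_scheme \<Rightarrow> ('s, 'n, 'y) module_scheme \<Rightarrow> ('m \<Rightarrow> 'n) \<Rightarrow> ('s \<times> 'm \<Rightarrow>\<^sub>0 int) set \<Rightarrow> 'n"
  where "bc_lift M N t c = tensor_eval M N t (SOME z. z \<in> frags (carrier M) \<and> c = cls M z)"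

lemma semilinear_funcset: "t \<in> semilinear M N \<Longrightarrow> t \<in> carrier M \<rightarrow> carrier N"
  by (auto simp: linear_maps_def)

lemma bc_lift_cls:
  assumes M: "module R M" and N: "module S N" and t: "t \<in> semilinear M N"
    and z: "z \<in> frags (carrier M)"
  shows "bc_lift M N t (cls M z) = tensor_eval M N t z"
proof -
  interpret N: module S N by fact
  note tc = semilinear_funcset[OF t]
  define w where "w = (SOME w. w \<in> frags (carrier M) \<and> cls M z = cls M w)"
  have w: "w \<in> frags (carrier M) \<and> cls M z = cls M w"
    unfolding w_def by (rule someI[of _ z]) (use z in simp)
  then have "z - w \<in> tensor_null R A M" by (simp add: cls_eq_iff[OF M])
  from tensor_eval_null[OF N M t this]
  have "tensor_eval M N t z \<ominus>\<^bsub>N\<^esub> tensor_eval M N t w = \<zero>\<^bsub>N\<^esub>"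
    using w z by (simp add: tensor_eval_diff[OF N tc])
  then have "tensor_eval M N t z = tensor_eval M N t w"
    using tensor_eval_closed[OF N tc z] tensor_eval_closed[OF N tc conjunct1[OF w]]
    by (rule N.minus_zero_imp_eq[rotated 2])
  then show ?thesis by (simp add: bc_lift_def w_def)
qed

lemma bc_lift_linear:
  assumes M: "module R M" and N: "module S N" and t: "t \<in> semilinear M N"
  shows "bc_lift M N t \<in> linear_maps S (bc M) N"
proof (rule linear_mapsI)
  note tc = semilinear_funcset[OF t] and l = bc_lift_cls[OF M N t]
  fix x assume "x \<in> carrier (bc M)"
  then obtain x' where x: "x' \<in> frags (carrier M)" "x = cls M x'"
    unfolding carrier_bc by (rule bc_spanE)
  show "bc_lift M N t x \<in> carrier N"
    unfolding x(2) l[OF x(1)] by (rule tensor_eval_closed[OF N tc x(1)])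
  show "bc_lift M N t (r \<odot>\<^bsub>bc M\<^esub> x) = r \<odot>\<^bsub>N\<^esub> bc_lift M N t x" if "r \<in> carrier S" for r
    unfolding x(2) cls_scale[OF M that] l[OF x(1)] l[OF frags_scale[OF that x(1)]]
    by (rule tensor_eval_scale[OF N tc x(1) that])
  fix y assume "y \<in> carrier (bc M)"
  then obtain y' where y: "y' \<in> frags (carrier M)" "y = cls M y'"
    unfolding carrier_bc by (rule bc_spanE)
  show "bc_lift M N t (x \<oplus>\<^bsub>bc M\<^esub> y) = bc_lift M N t x \<oplus>\<^bsub>N\<^esub> bc_lift M N t y"
    unfolding x(2) y(2) cls_add[OF M] l[OF x(1)] l[OF y(1)] l[OF frags_add[OF x(1) y(1)]]
    by (rule tensor_eval_add[OF N tc x(1) y(1)])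
qed

lemma bc_lift_iota:
  assumes M: "module R M" and N: "module S N" and t: "t \<in> semilinear M N" and m: "m \<in> carrier M"
  shows "bc_lift M N t (iota M m) = t m"
proof -
  interpret N: module S N by fact
  show ?thesis
    using m semilinear_funcset[OF t]
    unfolding iota_def by (simp add: bc_lift_cls[OF M N t] frags_of tensor_eval_of[OF N semilinear_funcset[OF t]] Pi_iff
        del: mem_Collect_eq)
qed

lemma bc_maps_eqI:
  assumes M: "module R M" and N: "module S N"
    and f: "f \<in> linear_maps S (bc M) N" and g: "g \<in> linear_maps S (bc M) N"
    and X: "X \<subseteq> carrier M" and eq: "\<And>m. m \<in> X \<Longrightarrow> f (iota M m) = g (iota M m)"
    and n: "n \<in> bc_span M X"
  shows "f n = g n"
proof -
  interpret N: module S N by fact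
  interpret B: module S "bc M" by (rule bc_module[OF M])
  have "submodule {n \<in> carrier (bc M). f n = g n} S (bc M)"
    by (rule submoduleI_smult[OF bc_module[OF M]])
      (use linear_mapsD[OF f] linear_mapsD[OF g] linear_maps_zero[OF f bc_module[OF M] N]
        linear_maps_zero[OF g bc_module[OF M] N] in auto)
  from bc_span_least[OF M this X] show ?thesis
    using eq n iota_closed[of _ M] X by auto
qed

lemma semilinear_comp_iota:
  assumes "module R M" "f \<in> linear_maps S (bc M) N"
  shows "(\<lambda>m. f (iota M m)) \<in> semilinear M N"
  by (rule linear_mapsI) (use iotaD[OF assms(1)] linear_mapsD[OF assms(2)] iota_closed[of _ M] in auto)

text \<open>By adjunction, lifting an \<open>S\<close>-linear map out of \<open>S \<otimes> P\<close> amounts to lifting the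
  \<open>R\<close>-linear map out of \<open>P\<close> which it induces.\<close>

theorem base_change_projective:
  fixes P :: "('r, 'p, 'x) module_scheme"
  assumes "projective_module R P"
  shows "projective_module S (bc P)"
proof -
  have P: "module R P" using assms by (simp add: projective_module_def)
  show ?thesis
    unfolding projective_module_def
  proof (intro conjI allI impI bc_module[OF P])
    fix M :: "('s, ('s \<times> 'p \<Rightarrow>\<^sub>0 int) set \<Rightarrow> 's) module" and N :: "('s, ('s \<times> 'p \<Rightarrow>\<^sub>0 int) set) module"
      and g f
    assume a: "module S M \<and> module S N \<and> g \<in> linear_maps S M N \<and> g ` carrier M = carrier N \<and>
      f \<in> linear_maps S (bc P) N"
    then have M: "module S M" and N: "module S N" and g: "g \<in> linear_maps S M N"
      and im: "g ` carrier M = carrier N" and f: "f \<in> linear_maps S (bc P) N" by auto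
    have g': "g \<in> linear_maps R (restrict_module M) (restrict_module N)"
      by (rule linear_mapsI) (use linear_mapsD[OF g] in auto)
    have im': "g ` carrier (restrict_module M) = carrier (restrict_module N)"
      using im by simp
    obtain t where t: "t \<in> semilinear P M" "\<And>x. x \<in> carrier P \<Longrightarrow> g (t x) = f (iota P x)"
      using projective_module_lift[OF assms restrict_module_module[OF M] restrict_module_module[OF N]
          g' im' semilinear_comp_iota[OF P f]] by blast
    note l = bc_lift_linear[OF P M t(1)]
    have "g (bc_lift P M t (iota P m)) = f (iota P m)" if "m \<in> carrier P" for m
      using that by (simp add: bc_lift_iota[OF P M t(1)] t(2))
    then have "g (bc_lift P M t n) = f n" if "n \<in> carrier (bc P)" for n
      using bc_maps_eqI[OF P N linear_maps_comp[OF l g] f order_refl] that unfolding carrier_bc by blast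
    with l show "\<exists>t\<in>linear_maps S (bc P) M. \<forall>x\<in>carrier (bc P). g (t x) = f x" by blast
  qed
qed


section \<open>Relations in a tensor product\<close>

text \<open>A tensor vanishes for a finite reason, so a function \<open>l\<close> on \<open>M\<close> needs to be linear at finitely
  many places only in order to respect a given relation. Such a place is a quadruple \<open>(m, r, n, k)\<close>
  with \<open>m = r n + k\<close>; this single form covers additivity (\<open>r = 1\<close>) and homogeneity (\<open>k = 0\<close>).\<close>

definition passes :: "('m \<Rightarrow> 'r) \<Rightarrow> ('m \<times> 'r \<times> 'm \<times> 'm) set \<Rightarrow> bool"
  where "passes l T \<longleftrightarrow> (\<forall>(m, r, n, k)\<in>T. l m = r \<otimes>\<^bsub>R\<^esub> l n \<oplus>\<^bsub>R\<^esub> l k)"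

text \<open>The equation \<open>m = r n + k\<close> is required modulo \<open>M'\<close> only: functions passing all tests are the linear
  functions that vanish on \<open>M'\<close>.\<close>

definition linearity_tests :: "('r, 'm, 'e) module_scheme \<Rightarrow> 'm set \<Rightarrow> ('m \<times> 'r \<times> 'm \<times> 'm) set"
  where "linearity_tests M M' = {(m, r, n, k). m \<in> carrier M \<and> r \<in> carrier R \<and> n \<in> carrier M \<and> k \<in> carrier M \<and>
    m \<ominus>\<^bsub>M\<^esub> (r \<odot>\<^bsub>M\<^esub> n \<oplus>\<^bsub>M\<^esub> k) \<in> M'}"

lemma passes_Un [simp]: "passes l (T \<union> T') \<longleftrightarrow> passes l T \<and> passes l T'"
  by (simp add: passes_def ball_Un)

text \<open>The quadruple \<open>(z, 1, z, z)\<close> is a test if \<open>z = 0\<close>.\<close>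

lemma passes_zero:
  assumes "passes l {(z, \<one>\<^bsub>R\<^esub>, z, z)}" "l z \<in> carrier R"
  shows "l z = \<zero>\<^bsub>R\<^esub>"
proof -
  have "l z = l z \<oplus>\<^bsub>R\<^esub> l z" using assms by (simp add: passes_def)
  then show ?thesis using assms(2) by (metis R.add.r_cancel_one')
qed

abbreviation eval_fun :: "('r, 'm, 'e) module_scheme \<Rightarrow> ('m \<Rightarrow> 'r) \<Rightarrow> ('s \<times> 'm \<Rightarrow>\<^sub>0 int) \<Rightarrow> 's"
  where "eval_fun M l \<equiv> tensor_eval M (regular_module S) (\<lambda>m. h (l m))"

text \<open>Each defining relation of the tensor product uses at most one instance of linearity in the second
  variable; additivity in the first variable holds for every function.\<close>

lemma tensor_null_tests:
  assumes M: "module R M" and z: "z \<in> tensor_null R A M" and zero: "\<zero>\<^bsub>M\<^esub> \<in> M'"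
  shows "\<exists>T. finite T \<and> T \<subseteq> linearity_tests M M' \<and>
    (\<forall>l\<in>carrier M \<rightarrow> carrier R. passes l T \<longrightarrow> eval_fun M l z = \<zero>\<^bsub>S\<^esub>)"
proof -
  interpret M: module R M by fact
  note V = regular_module_module[OF S.is_cring]
  have hl: "(\<lambda>m. h (l m)) \<in> carrier M \<rightarrow> carrier (regular_module S)" if "l \<in> carrier M \<rightarrow> carrier R" for l
    using that by auto
  note e = tensor_eval_closed[OF V hl] tensor_eval_diff[OF V hl] tensor_eval_of[OF V hl]
    tensor_eval_add[OF V hl] tensor_eval_0[OF V hl]
  note [simp del] = mem_Collect_eq
  have fr: "z \<in> frags (carrier M)" if "z \<in> tensor_null R A M" for z
    using tensor_null_keys[OF A_module M that] by (simp add: mem_Collect_eq)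
  have canc: "p \<ominus>\<^bsub>S\<^esub> p = \<zero>\<^bsub>S\<^esub>" if "p \<in> carrier S" for p
    using that by (simp add: a_minus_def S.r_neg)
  show ?thesis
    using A_module M z
  proof (induction rule: tensor_null_induct)
    case zero
    show ?case by (rule exI[of _ "{}"]) (simp add: e)
  next
    case (rels z)
    then show ?case
    proof (cases rule: tensor_relsE)
      case (add_left a b m)
      then have ab: "a \<in> carrier S" "b \<in> carrier S" by simp_all
      have "eval_fun M l z = \<zero>\<^bsub>S\<^esub>" if l: "l \<in> carrier M \<rightarrow> carrier R" for l
      proof -
        have "h (l m) \<in> carrier S" using l add_left(4) by auto
        then show ?thesis
          unfolding add_left(1) diff_diff_eq using ab add_left(4)
          by (simp add: e[OF l] frags_of frags_add S.l_distr canc)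
      qed
      then show ?thesis by (intro exI[of _ "{}"]) simp
    next
      case (add_right a m n)
      then have a: "a \<in> carrier S" by simp
      let ?T = "{(m \<oplus>\<^bsub>M\<^esub> n, \<one>\<^bsub>R\<^esub>, m, n)}"
      have "eval_fun M l z = \<zero>\<^bsub>S\<^esub>" if l: "l \<in> carrier M \<rightarrow> carrier R" and p: "passes l ?T" for l
      proof -
        have lm: "l m \<in> carrier R" "l n \<in> carrier R" using l add_right(3,4) by auto
        moreover have "l (m \<oplus>\<^bsub>M\<^esub> n) = l m \<oplus>\<^bsub>R\<^esub> l n" using p lm by (simp add: passes_def)
        ultimately show ?thesis
          unfolding add_right(1) diff_diff_eq using a add_right(3,4)
          by (simp add: e[OF l] frags_of frags_add S.r_distr canc)
      qed
      moreover have "?T \<subseteq> linearity_tests M M'"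
        using add_right(3,4) zero by (simp add: linearity_tests_def a_minus_def M.M.r_neg mem_Collect_eq)
      ultimately show ?thesis by (intro exI[of _ ?T]) simp
    next
      case (smult r a m)
      then have a: "a \<in> carrier S" by simp
      let ?T = "{(r \<odot>\<^bsub>M\<^esub> m, r, m, \<zero>\<^bsub>M\<^esub>), (\<zero>\<^bsub>M\<^esub>, \<one>\<^bsub>R\<^esub>, \<zero>\<^bsub>M\<^esub>, \<zero>\<^bsub>M\<^esub>)}"
      have "eval_fun M l z = \<zero>\<^bsub>S\<^esub>" if l: "l \<in> carrier M \<rightarrow> carrier R" and p: "passes l ?T" for l
      proof -
        have lm: "l m \<in> carrier R" "l \<zero>\<^bsub>M\<^esub> \<in> carrier R" using l smult(4) by auto
        moreover have "l \<zero>\<^bsub>M\<^esub> = \<zero>\<^bsub>R\<^esub>" by (rule passes_zero) (use p lm in \<open>auto simp: passes_def\<close>)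
        then have "l (r \<odot>\<^bsub>M\<^esub> m) = r \<otimes>\<^bsub>R\<^esub> l m" using p lm smult(2) by (simp add: passes_def)
        ultimately show ?thesis
          unfolding smult(1) using a smult(2,4)
          by (simp add: e[OF l] frags_of S.m_lcomm[of a "h r"] S.m_assoc canc)
      qed
      moreover have "?T \<subseteq> linearity_tests M M'"
        using smult(2,4) zero by (simp add: linearity_tests_def a_minus_def M.M.r_neg mem_Collect_eq)
      ultimately show ?thesis by (intro exI[of _ ?T]) simp
    qed
  next
    case (add x y)
    then obtain T T' where T: "finite T" "T \<subseteq> linearity_tests M M'"
        "\<forall>l\<in>carrier M \<rightarrow> carrier R. passes l T \<longrightarrow> eval_fun M l x = \<zero>\<^bsub>S\<^esub>"
      and T': "finite T'" "T' \<subseteq> linearity_tests M M'"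
        "\<forall>l\<in>carrier M \<rightarrow> carrier R. passes l T' \<longrightarrow> eval_fun M l y = \<zero>\<^bsub>S\<^esub>" by blast
    show ?case
      using T T' by (intro exI[of _ "T \<union> T'"]) (simp add: e fr add(1,2))
  next
    case (uminus x)
    then obtain T where T: "finite T" "T \<subseteq> linearity_tests M M'"
        "\<forall>l\<in>carrier M \<rightarrow> carrier R. passes l T \<longrightarrow> eval_fun M l x = \<zero>\<^bsub>S\<^esub>" by blast
    have 0: "0 \<in> frags (carrier M)" by (simp add: mem_Collect_eq)
    have "eval_fun M l (0 - x) = \<zero>\<^bsub>S\<^esub> \<ominus>\<^bsub>S\<^esub> eval_fun M l x" if l: "l \<in> carrier M \<rightarrow> carrier R" for l
      unfolding e(2)[OF l 0 fr[OF uminus(1)]] e(5)[OF l]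
      using e(1)[OF l fr[OF uminus(1)]] by (simp add:)
    with T show ?case
      by (intro exI[of _ T]) (simp add: a_minus_def)
  qed
qed

text \<open>A tensor in the span of \<open>M'\<close> differs by a relation from a formal sum with entries in \<open>M'\<close>, at each
  of which \<open>l\<close> has to vanish.\<close>

lemma span_null_tests:
  assumes M: "module R M" and M': "submodule M' R M"
    and z: "z \<in> frags (carrier M)" "cls M z \<in> bc_span M M'"
  shows "\<exists>T. finite T \<and> T \<subseteq> linearity_tests M M' \<and>
    (\<forall>l\<in>carrier M \<rightarrow> carrier R. passes l T \<longrightarrow> eval_fun M l z = \<zero>\<^bsub>S\<^esub>)"
proof -
  interpret M: module R M by fact
  note V = regular_module_module[OF S.is_cring]
  have M'M: "M' \<subseteq> carrier M" by (rule M.submoduleE(1)[OF M'])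
  note 0 = submodule_zero_closed[OF M']
  have hl: "(\<lambda>m. h (l m)) \<in> carrier M \<rightarrow> carrier (regular_module S)" if "l \<in> carrier M \<rightarrow> carrier R" for l
    using that by auto
  note e = tensor_eval_closed[OF V hl] tensor_eval_diff[OF V hl] tensor_eval_of[OF V hl]
    tensor_eval_add[OF V hl] tensor_eval_0[OF V hl]
  note [simp del] = mem_Collect_eq
  have tests: "\<exists>T. finite T \<and> T \<subseteq> linearity_tests M M' \<and>
    (\<forall>l\<in>carrier M \<rightarrow> carrier R. passes l T \<longrightarrow> eval_fun M l x = \<zero>\<^bsub>S\<^esub>)" if "x \<in> frags M'" for x
    using that
  proof (induction rule: frags_induct)
    case zero
    show ?case by (rule exI[of _ "{}"]) (simp add: e)
  next
    case (one s m)
    (* The tests say l m = l 0 and l 0 = 0; the first is admitted because m is 0 modulo M'. *)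
    let ?T = "{(m, \<zero>\<^bsub>R\<^esub>, \<zero>\<^bsub>M\<^esub>, \<zero>\<^bsub>M\<^esub>), (\<zero>\<^bsub>M\<^esub>, \<one>\<^bsub>R\<^esub>, \<zero>\<^bsub>M\<^esub>, \<zero>\<^bsub>M\<^esub>)}"
    have m: "m \<in> carrier M" using one M'M by auto
    have "eval_fun M l (frag_of (s, m)) = \<zero>\<^bsub>S\<^esub>"
      if l: "l \<in> carrier M \<rightarrow> carrier R" and p: "passes l ?T" for l
    proof -
      have lm: "l \<zero>\<^bsub>M\<^esub> \<in> carrier R" using l by auto
      have "l \<zero>\<^bsub>M\<^esub> = \<zero>\<^bsub>R\<^esub>" by (rule passes_zero) (use p lm in \<open>auto simp: passes_def\<close>)
      then have "l m = \<zero>\<^bsub>R\<^esub>" using p by (simp add: passes_def)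
      then show ?thesis using one m by (simp add: e[OF l])
    qed
    moreover have "?T \<subseteq> linearity_tests M M'"
      using m one submodule_minus_closed[OF M M' _ 0] 0 by (simp add: linearity_tests_def mem_Collect_eq)
    ultimately show ?case by (intro exI[of _ ?T]) simp
  next
    case (diff x y)
    then obtain T T' where T: "finite T" "T \<subseteq> linearity_tests M M'"
        "\<forall>l\<in>carrier M \<rightarrow> carrier R. passes l T \<longrightarrow> eval_fun M l x = \<zero>\<^bsub>S\<^esub>"
      and T': "finite T'" "T' \<subseteq> linearity_tests M M'"
        "\<forall>l\<in>carrier M \<rightarrow> carrier R. passes l T' \<longrightarrow> eval_fun M l y = \<zero>\<^bsub>S\<^esub>" by blast
    have "x \<in> frags (carrier M)" "y \<in> frags (carrier M)"
      using diff(1,2) frags_mono[OF _ M'M] by blast+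
    with T T' show ?case by (intro exI[of _ "T \<union> T'"]) (simp add: e a_minus_def)
  qed
  obtain x where x: "x \<in> frags M'" "cls M z = cls M x" using z(2) by (rule bc_spanE)
  have xM: "x \<in> frags (carrier M)" using frags_mono[OF x(1) M'M] .
  have "z - x \<in> tensor_null R A M" using x(2) by (simp add: cls_eq_iff[OF M])
  from tensor_null_tests[OF M this 0] obtain T where T: "finite T" "T \<subseteq> linearity_tests M M'"
      "\<forall>l\<in>carrier M \<rightarrow> carrier R. passes l T \<longrightarrow> eval_fun M l (z - x) = \<zero>\<^bsub>S\<^esub>" by blast
  from tests[OF x(1)] obtain T' where T': "finite T'" "T' \<subseteq> linearity_tests M M'"
        "\<forall>l\<in>carrier M \<rightarrow> carrier R. passes l T' \<longrightarrow> eval_fun M l x = \<zero>\<^bsub>S\<^esub>" by blast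
  have "eval_fun M l z = eval_fun M l (z - x) \<oplus>\<^bsub>S\<^esub> eval_fun M l x" if "l \<in> carrier M \<rightarrow> carrier R" for l
    using e(4)[OF that frags_diff[OF z(1) xM] xM] by simp
  with T T' show ?thesis by (intro exI[of _ "T \<union> T'"]) simp
qed


text \<open>Used both for the class of a formal sum and for its evaluation at a nonlinear function: a linear
  combination can be lifted to a formal sum on which both are computed.\<close>

lemma additive_combination:
  assumes N: "module S N" and c: "c \<in> carrier (free_module S K)"
    and z: "\<And>k. k \<in> K \<Longrightarrow> z k \<in> frags X"
    and q: "q \<in> frags X \<rightarrow> carrier N" and q0: "q 0 = \<zero>\<^bsub>N\<^esub>"
    and qa: "\<And>x y. x \<in> frags X \<Longrightarrow> y \<in> frags X \<Longrightarrow> q (x + y) = q x \<oplus>\<^bsub>N\<^esub> q y"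
    and qs: "\<And>s x. s \<in> carrier S \<Longrightarrow> x \<in> frags X \<Longrightarrow> q (scale_frag s x) = s \<odot>\<^bsub>N\<^esub> q x"
  shows "q (\<Sum>k\<in>{k. c k \<noteq> \<zero>\<^bsub>S\<^esub>}. scale_frag (c k) (z k)) = lincomb S N (\<lambda>k. q (z k)) c"
proof -
  interpret N: module S N by fact
  have "q (\<Sum>k\<in>B. scale_frag (c k) (z k)) = (\<Oplus>\<^bsub>N\<^esub>k\<in>B. c k \<odot>\<^bsub>N\<^esub> q (z k))"
    if "finite B" "B \<subseteq> {k. c k \<noteq> \<zero>\<^bsub>S\<^esub>}" for B
    using that
  proof (induction B rule: finite_induct)
    case empty
    show ?case by (simp add: q0)
  next
    case (insert k B)
    have fr: "scale_frag (c j) (z j) \<in> frags X" "z j \<in> frags X" "c j \<in> carrier S" if "j \<in> insert k B" for j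
    proof -
      show j: "z j \<in> frags X" "c j \<in> carrier S"
        using z[of j] c insert(4) that by (auto simp: free_module_simps subset_iff)
      show "scale_frag (c j) (z j) \<in> frags X" by (rule frags_scale[OF j(2,1)])
    qed
    have qc: "q (z j) \<in> carrier N" if "j \<in> insert k B" for j
      using q fr(2)[OF that] by blast
    have "q (\<Sum>j\<in>insert k B. scale_frag (c j) (z j)) =
        q (scale_frag (c k) (z k)) \<oplus>\<^bsub>N\<^esub> q (\<Sum>j\<in>B. scale_frag (c j) (z j))"
      unfolding sum.insert[OF insert(1,2)]
      by (rule qa[OF fr(1)]) (use fr(1) in \<open>auto intro!: frags_sum simp del: mem_Collect_eq\<close>)
    also have "\<dots> = c k \<odot>\<^bsub>N\<^esub> q (z k) \<oplus>\<^bsub>N\<^esub> (\<Oplus>\<^bsub>N\<^esub>j\<in>B. c j \<odot>\<^bsub>N\<^esub> q (z j))"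
      using insert qs[OF fr(3,2)[of k]] by simp
    also have "\<dots> = (\<Oplus>\<^bsub>N\<^esub>j\<in>insert k B. c j \<odot>\<^bsub>N\<^esub> q (z j))"
      by (rule N.finsum_insert[symmetric]) (use insert qc fr(3) in auto)
    finally show ?case .
  qed
  moreover have "finite {k. c k \<noteq> \<zero>\<^bsub>S\<^esub>}" using c by (simp add: free_module_simps)
  ultimately show ?thesis by (simp add: lincomb_def)
qed

section \<open>Faithful flatness\<close>

text \<open>The base change of \<open>R\<close> is generated by \<open>1 \<otimes> 1\<close>: every element \<open>n\<close> is its image in \<open>S\<close> times this
  generator.\<close>

lemma regular_bc_lift_inj:
  assumes n: "n \<in> carrier (bc (regular_module R))"
    and z: "bc_lift (regular_module R) (regular_module S) h n = \<zero>\<^bsub>S\<^esub>"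
  shows "n = \<zero>\<^bsub>bc (regular_module R)\<^esub>"
proof -
  let ?U = "regular_module R" and ?l = "bc_lift (regular_module R) (regular_module S) h"
  note U = regular_module_module[OF R.is_cring] and V = regular_module_module[OF S.is_cring]
  interpret B: module S "bc ?U" by (rule bc_module[OF U])
  note l = bc_lift_linear[OF U V h_semilinear] and io = iotaD[OF U]
  have one: "iota ?U \<one>\<^bsub>R\<^esub> \<in> carrier (bc ?U)" by (rule iota_closed) simp
  have g: "(\<lambda>n. ?l n \<odot>\<^bsub>bc ?U\<^esub> iota ?U \<one>\<^bsub>R\<^esub>) \<in> linear_maps S (bc ?U) (bc ?U)"
    by (rule linear_mapsI)
      (use linear_mapsD[OF l] one in \<open>simp_all add: B.smult_l_distr B.smult_assoc1\<close>)
  have "iota ?U r = ?l (iota ?U r) \<odot>\<^bsub>bc ?U\<^esub> iota ?U \<one>\<^bsub>R\<^esub>" if "r \<in> carrier ?U" for r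
  proof -
    have "?l (iota ?U r) = h r" using that by (intro bc_lift_iota[OF U V h_semilinear])
    then show ?thesis using io(3)[of r "\<one>\<^bsub>R\<^esub>"] that by simp
  qed
  from bc_maps_eqI[OF U bc_module[OF U] linear_maps_id g order_refl this] n
  have "n = ?l n \<odot>\<^bsub>bc ?U\<^esub> iota ?U \<one>\<^bsub>R\<^esub>" unfolding carrier_bc by blast
  then show ?thesis using z one by simp
qed

end

locale faithfully_flat_ring_change = ring_change R S h
  for R :: "('r, 'c) ring_scheme" and S :: "('s, 'd) ring_scheme" and h :: "'r \<Rightarrow> 's" +
  assumes ff: "faithfully_flat_module R A"
begin

text \<open>Exactness of \<open>ker \<epsilon> \<rightarrow> M \<rightarrow> T\<close> is preserved by \<open>S \<otimes> -\<close>, and the image of \<open>S \<otimes> ker \<epsilon>\<close> is the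
  span of the kernel.\<close>

lemma flat_kernel:
  assumes M: "module R M" and T: "module R T" and \<epsilon>: "\<epsilon> \<in> linear_maps R M T"
    and n: "n \<in> carrier (bc M)" and z: "bc_lift M (bc T) (\<lambda>m. iota T (\<epsilon> m)) n = \<zero>\<^bsub>bc T\<^esub>"
  shows "n \<in> bc_span M {m \<in> carrier M. \<epsilon> m = \<zero>\<^bsub>T\<^esub>}"
proof -
  note \<epsilon>c = linear_mapsD(1)[OF \<epsilon>]
  define K where "K = {m \<in> carrier M. \<epsilon> m = \<zero>\<^bsub>T\<^esub>}"
  have K: "submodule K R M"
    using preimage_submodule[OF M T \<epsilon> module.carrier_is_submodule[OF M] zero_submodule[OF T]]
    by (simp add: K_def)
  have inc: "(\<lambda>x. x) \<in> linear_maps R (M\<lparr>carrier := K\<rparr>) M"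
    by (rule linear_mapsI) (auto simp: K_def)
  have im: "(\<lambda>x. x) ` carrier (M\<lparr>carrier := K\<rparr>) = {x \<in> carrier M. \<epsilon> x = \<zero>\<^bsub>T\<^esub>}"
    by (auto simp: K_def)
  obtain y where y: "y \<in> frags (carrier M)" "n = cls M y"
    using n unfolding carrier_bc by (rule bc_spanE)
  have \<iota>\<epsilon>: "(\<lambda>m. iota T (\<epsilon> m)) \<in> semilinear M (bc T)"
    by (rule linear_maps_comp[OF \<epsilon> iota_semilinear[OF T]])
  have \<epsilon>f: "\<epsilon> \<in> carrier M \<rightarrow> carrier T" and \<iota>f: "iota T \<in> carrier T \<rightarrow> carrier (bc T)"
    using \<epsilon>c by (auto intro: iota_closed)
  have ev: "tensor_eval T (bc T) (iota T) w = cls T w" if "w \<in> frags (carrier T)" for w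
    using that
  proof (induction rule: frags_induct)
    case zero
    show ?case by (simp add: tensor_eval_0[OF bc_module[OF T] \<iota>f] cls_zero)
  next
    case (one s m)
    then show ?case by (simp add: tensor_eval_of[OF bc_module[OF T] \<iota>f] cls_of[OF T])
  next
    case (diff x y)
    then show ?case by (simp add: tensor_eval_diff[OF bc_module[OF T] \<iota>f] cls_diff[OF T])
  qed
  have "cls T (frag_tensor (\<lambda>a. a) \<epsilon> y) = cls T 0"
    using z frags_map[OF y(1) \<epsilon>f] unfolding y(2) bc_lift_cls[OF M bc_module[OF T] \<iota>\<epsilon> y(1)]
      tensor_eval_map[OF bc_module[OF T] \<iota>f \<epsilon>f y(1), symmetric] cls_zero by (simp add: ev)
  then have "frag_tensor (\<lambda>a. a) \<epsilon> y \<in> tensor_null R A T"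
    by (simp add: cls_eq_iff[OF T])
  with y(1) obtain x where x: "Poly_Mapping.keys x \<subseteq> carrier S \<times> K" "y - frag_tensor (\<lambda>a. a) (\<lambda>x. x) x \<in> tensor_null R A M"
    using faithfully_flat_exact[OF ff submodule_module[OF M K] M T inc \<epsilon> im, of y] by auto
  then have "n = cls M x" by (simp add: y(2) cls_eq_iff[OF M] frag_tensor_id)
  then show ?thesis
    using x(1) unfolding K_def by (auto intro: cls_in_span)
qed

text \<open>For a functional, vanishing in \<open>S \<otimes> R\<close> may be tested in \<open>S\<close>.\<close>

lemma flat_functional_kernel:
  assumes M: "module R M" and \<epsilon>: "\<epsilon> \<in> linear_maps R M (regular_module R)"
    and n: "n \<in> carrier (bc M)" and z: "bc_lift M (regular_module S) (\<lambda>m. h (\<epsilon> m)) n = \<zero>\<^bsub>S\<^esub>"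
  shows "n \<in> bc_span M {m \<in> carrier M. \<epsilon> m = \<zero>\<^bsub>R\<^esub>}"
proof -
  let ?U = "regular_module R" and ?V = "regular_module S"
  note U = regular_module_module[OF R.is_cring] and V = regular_module_module[OF S.is_cring]
  note \<iota>\<epsilon> = linear_maps_comp[OF \<epsilon> iota_semilinear[OF U]]
  note h\<epsilon> = linear_maps_comp[OF \<epsilon> h_semilinear]
  note l1 = bc_lift_linear[OF M bc_module[OF U] \<iota>\<epsilon>]
    and l2 = bc_lift_linear[OF U V h_semilinear] and l3 = bc_lift_linear[OF M V h\<epsilon>]
  have "bc_lift ?U ?V h (bc_lift M (bc ?U) (\<lambda>m. iota ?U (\<epsilon> m)) (iota M m)) =
      bc_lift M ?V (\<lambda>m. h (\<epsilon> m)) (iota M m)" if "m \<in> carrier M" for m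
    using that linear_mapsD(1)[OF \<epsilon> that]
    by (simp add: bc_lift_iota[OF M V h\<epsilon>] bc_lift_iota[OF U V h_semilinear] bc_lift_iota[OF M bc_module[OF U] \<iota>\<epsilon>])
  from bc_maps_eqI[OF M V linear_maps_comp[OF l1 l2] l3 order_refl this] n
  have "bc_lift ?U ?V h (bc_lift M (bc ?U) (\<lambda>m. iota ?U (\<epsilon> m)) n) = \<zero>\<^bsub>S\<^esub>"
    unfolding carrier_bc z[symmetric] by blast
  then have "bc_lift M (bc ?U) (\<lambda>m. iota ?U (\<epsilon> m)) n = \<zero>\<^bsub>bc ?U\<^esub>"
    by (rule regular_bc_lift_inj[OF linear_mapsD(1)[OF l1 n]])
  from flat_kernel[OF M U \<epsilon> n this] show ?thesis by simp
qed

text \<open>Imposing the equations one at a time, each step is \<open>flat_functional_kernel\<close> on the solution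
  module of the previous equations. Finiteness matters: in general \<open>S \<otimes> -\<close> does not commute with
  infinite intersections of submodules.\<close>

lemma flat_solutions:
  assumes M: "module R M" and E: "finite E" "E \<subseteq> linear_maps R M (regular_module R)"
    and n: "n \<in> carrier (bc M)"
    and z: "\<And>\<epsilon>. \<epsilon> \<in> E \<Longrightarrow> bc_lift M (regular_module S) (\<lambda>m. h (\<epsilon> m)) n = \<zero>\<^bsub>S\<^esub>"
  shows "n \<in> bc_span M {m \<in> carrier M. \<forall>\<epsilon>\<in>E. \<epsilon> m = \<zero>\<^bsub>R\<^esub>}"
    and "submodule {m \<in> carrier M. \<forall>\<epsilon>\<in>E. \<epsilon> m = \<zero>\<^bsub>R\<^esub>} R M"
proof -
  let ?V = "regular_module S"
  note U = regular_module_module[OF R.is_cring] and V = regular_module_module[OF S.is_cring]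
  have "n \<in> bc_span M {m \<in> carrier M. \<forall>\<epsilon>\<in>E. \<epsilon> m = \<zero>\<^bsub>R\<^esub>} \<and>
    submodule {m \<in> carrier M. \<forall>\<epsilon>\<in>E. \<epsilon> m = \<zero>\<^bsub>R\<^esub>} R M"
    using E z
  proof (induction E rule: finite_induct)
    case empty
    then show ?case
      using n module.carrier_is_submodule[OF M] by (simp add: carrier_bc)
  next
    case (insert \<epsilon> E)
    define W where "W = {m \<in> carrier M. \<forall>\<epsilon>\<in>E. \<epsilon> m = \<zero>\<^bsub>R\<^esub>}"
    have nW: "n \<in> bc_span M W" and W: "submodule W R M"
      using insert unfolding W_def by auto
    have WM: "W \<subseteq> carrier M" by (auto simp: W_def)
    have \<epsilon>: "\<epsilon> \<in> linear_maps R M (regular_module R)" using insert by simp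
    define M' where "M' = M\<lparr>carrier := W\<rparr>"
    have M': "module R M'" unfolding M'_def by (rule submodule_module[OF M W])
    have \<epsilon>': "\<epsilon> \<in> linear_maps R M' (regular_module R)"
      by (rule linear_mapsI) (use linear_mapsD[OF \<epsilon>] subsetD[OF WM] in \<open>auto simp: M'_def\<close>)
    have inc: "(\<lambda>x. x) \<in> linear_maps R M' M"
      by (rule linear_mapsI) (use WM in \<open>auto simp: M'_def\<close>)
    note h\<epsilon> = linear_maps_comp[OF \<epsilon> h_semilinear] and h\<epsilon>' = linear_maps_comp[OF \<epsilon>' h_semilinear]
    obtain y where y: "y \<in> frags W" "n = cls M y" using nW by (rule bc_spanE)
    have yM: "y \<in> frags (carrier M)" using frags_mono[OF y(1) WM] .
    have yM': "y \<in> frags (carrier M')" using y(1) by (simp add: M'_def)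
    have i: "(\<lambda>m. m) \<in> carrier M' \<rightarrow> carrier M" using WM by (auto simp: M'_def)
    have "bc_lift M' ?V (\<lambda>m. h (\<epsilon> m)) (cls M' y) = bc_lift M ?V (\<lambda>m. h (\<epsilon> m)) n"
      unfolding y(2) bc_lift_cls[OF M' V h\<epsilon>' yM'] bc_lift_cls[OF M V h\<epsilon> yM]
      using tensor_eval_map[OF V semilinear_funcset[OF h\<epsilon>] i yM'] by (simp add: frag_tensor_id)
    also have "\<dots> = \<zero>\<^bsub>S\<^esub>" using insert by simp
    finally have "cls M' y \<in> bc_span M' {m \<in> carrier M'. \<epsilon> m = \<zero>\<^bsub>R\<^esub>}"
      by (rule flat_functional_kernel[OF M' \<epsilon>' cls_closed[OF yM']])
    then obtain x where x: "x \<in> frags {m \<in> W. \<epsilon> m = \<zero>\<^bsub>R\<^esub>}" "cls M' y = cls M' x"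
      by (auto simp: M'_def elim: bc_spanE)
    then have "y - x \<in> tensor_null R A M'" by (simp add: cls_eq_iff[OF M'])
    from frag_tensor_null[OF A_module M' A_module M linear_maps_id inc this]
    have "n = cls M x" by (simp add: frag_tensor_id y(2) cls_eq_iff[OF M])
    moreover have e: "{m \<in> carrier M. \<forall>\<epsilon>\<in>insert \<epsilon> E. \<epsilon> m = \<zero>\<^bsub>R\<^esub>} = {m \<in> W. \<epsilon> m = \<zero>\<^bsub>R\<^esub>}"
      by (auto simp: W_def)
    moreover have "submodule {m \<in> W. \<epsilon> m \<in> {\<zero>\<^bsub>R\<^esub>}} R M"
      using preimage_submodule[OF M U \<epsilon> W zero_submodule[OF U]] by simp
    ultimately show ?case
      using cls_in_span[OF x(1), of M] by simp
  qed
  then show "n \<in> bc_span M {m \<in> carrier M. \<forall>\<epsilon>\<in>E. \<epsilon> m = \<zero>\<^bsub>R\<^esub>}"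
    "submodule {m \<in> carrier M. \<forall>\<epsilon>\<in>E. \<epsilon> m = \<zero>\<^bsub>R\<^esub>} R M" by simp_all
qed

lemma iota_preimage_submodule:
  assumes M: "module R M" and W: "submodule W S (bc M)"
  shows "submodule {m \<in> carrier M. iota M m \<in> W} R M"
proof -
  note B = bc_module[OF M]
  have "submodule W R (restrict_module (bc M))"
    by (rule submoduleI_smult[OF restrict_module_module[OF B]])
      (use module.submoduleE[OF B W] submodule_zero_closed[OF W] in auto)
  from preimage_submodule[OF M restrict_module_module[OF B] iota_semilinear[OF M]
      module.carrier_is_submodule[OF M] this]
  show ?thesis .
qed

text \<open>The elements whose images lie in the span of \<open>L\<close> form a submodule \<open>H\<close> with the same span. By
  flatness this holds in the base change of \<open>H\<close> as well, so \<open>L \<rightarrow> H \<rightarrow> 0\<close> becomes exact after base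
  change; by faithfulness it is exact, that is, \<open>L = H\<close>.\<close>

lemma descend_membership:
  assumes M: "module R M" and L: "submodule L R M" and v: "v \<in> carrier M"
    and iv: "iota M v \<in> bc_span M L"
  shows "v \<in> L"
proof -
  interpret M: module R M by fact
  have LM: "L \<subseteq> carrier M" by (rule M.submoduleE(1)[OF L])
  define H where "H = {m \<in> carrier M. iota M m \<in> bc_span M L}"
  have H: "submodule H R M"
    unfolding H_def by (rule iota_preimage_submodule[OF M bc_span_submodule[OF M LM]])
  have HM: "H \<subseteq> carrier M" by (auto simp: H_def)
  have LH: "L \<subseteq> H" using LM iota_in_span by (auto simp: H_def)
  have span: "bc_span M H \<subseteq> bc_span M L"
    by (rule bc_span_least[OF M bc_span_submodule[OF M LM] HM]) (simp add: H_def)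
  define NL where "NL = M\<lparr>carrier := L\<rparr>"
  define NH where "NH = M\<lparr>carrier := H\<rparr>"
  define NZ where "NZ = M\<lparr>carrier := {\<zero>\<^bsub>M\<^esub>}\<rparr>"
  have NL: "module R NL" and NH: "module R NH" and NZ: "module R NZ"
    unfolding NL_def NH_def NZ_def by (intro submodule_module[OF M] L H zero_submodule[OF M])+
  have incL: "(\<lambda>x. x) \<in> linear_maps R NL NH" and incH: "(\<lambda>x. x) \<in> linear_maps R NH M"
    and incZ: "(\<lambda>x. x) \<in> linear_maps R NZ NH" and zero: "(\<lambda>_. \<zero>\<^bsub>M\<^esub>) \<in> linear_maps R NH NZ"
    using LH HM submodule_zero_closed[OF H]
    by (auto intro!: linear_mapsI simp: NL_def NH_def NZ_def)
  have imZ: "(\<lambda>x. x) ` carrier NZ = {x \<in> carrier NH. x = \<zero>\<^bsub>M\<^esub>}"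
    using submodule_zero_closed[OF H] by (auto simp: NZ_def NH_def)
  have "exact_at (tensor_group R A NL) (tensor_group R A NH) (tensor_group R A NZ)
     (tensor_map R A NH (\<lambda>a. a) (\<lambda>x. x)) (tensor_map R A NZ (\<lambda>a. a) (\<lambda>_. \<zero>\<^bsub>M\<^esub>))"
  proof (rule tensor_exact_iff[THEN iffD2, OF A_module NL NH NZ incL zero], goal_cases)
    case 1
    show ?case by (simp add: NZ_def)
  next
    case 2
    show ?case
    proof (intro allI impI)
    fix y :: "_ \<Rightarrow>\<^sub>0 int" assume y: "Poly_Mapping.keys y \<subseteq> carrier A \<times> carrier NH"
    then have yH: "y \<in> frags H" by (simp add: NH_def)
    then have "cls M y \<in> bc_span M L" using span cls_in_span by blast
    then obtain x where x: "x \<in> frags L" "cls M y = cls M x" by (rule bc_spanE)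
    then have "y - x \<in> tensor_null R A M" by (simp add: cls_eq_iff[OF M])
    (* The relation holds in the base change of M; injectivity of the inclusion of H moves it there. *)
    moreover have "y - x \<in> frags H" by (rule frags_diff[OF yH frags_mono[OF x(1) LH]])
    ultimately obtain z where z: "Poly_Mapping.keys z \<subseteq> carrier S \<times> {\<zero>\<^bsub>M\<^esub>}" "y - x - z \<in> tensor_null R A NH"
      using faithfully_flat_exact[OF ff NZ NH M incZ incH imZ, of "y - x"]
      by (auto simp: frag_tensor_id NH_def NZ_def)
    have "frag_tensor (\<lambda>a. a) (\<lambda>_. \<zero>\<^bsub>NH\<^esub>) z \<in> tensor_null R A NH"
      by (rule frag_tensor_zero_map[OF A_module NH]) (use z(1) in simp)
    moreover have "frag_tensor (\<lambda>a. a) (\<lambda>_. \<zero>\<^bsub>NH\<^esub>) z = frag_tensor (\<lambda>a. a) (\<lambda>x. x) z"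
      by (rule frag_tensor_cong[OF z(1)]) (auto simp: NH_def)
    ultimately have "z \<in> tensor_null R A NH" by (simp add: frag_tensor_id)
    from tensor_null_add[OF z(2) this] have "y - x \<in> tensor_null R A NH" by simp
    with x(1) show "\<exists>x. Poly_Mapping.keys x \<subseteq> carrier A \<times> carrier NL \<and>
        y - frag_tensor (\<lambda>a. a) (\<lambda>x. x) x \<in> tensor_null R A NH"
      by (intro exI[of _ x]) (simp add: frag_tensor_id NL_def)
    qed
  qed
  then have "exact_at (add_monoid NL) (add_monoid NH) (add_monoid NZ) (\<lambda>x. x) (\<lambda>_. \<zero>\<^bsub>M\<^esub>)"
    by (subst faithfully_flat_exact_iff[OF ff NL NH NZ incL zero]) (simp_all add: NZ_def)
  then have "L = H" unfolding exact_at_add_monoid by (simp add: NL_def NH_def NZ_def)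
  moreover have "v \<in> H" using v iv by (simp add: H_def)
  ultimately show ?thesis by simp
qed

lemma h_injective:
  assumes "r \<in> carrier R" "r' \<in> carrier R" "h r = h r'"
  shows "r = r'"
proof -
  note U = regular_module_module[OF R.is_cring]
  have "bc_lift (regular_module R) (regular_module S) h (iota (regular_module R) (r \<ominus>\<^bsub>R\<^esub> r')) = \<zero>\<^bsub>S\<^esub>"
    using assms bc_lift_iota[OF U regular_module_module[OF S.is_cring] h_semilinear, of "r \<ominus>\<^bsub>R\<^esub> r'"]
    by (simp add: a_minus_def S.r_neg)
  then have "iota (regular_module R) (r \<ominus>\<^bsub>R\<^esub> r') = \<zero>\<^bsub>bc (regular_module R)\<^esub>"
    using assms by (intro regular_bc_lift_inj iota_closed) simp_all
  then have "iota (regular_module R) (r \<ominus>\<^bsub>R\<^esub> r') \<in> bc_span (regular_module R) {\<zero>\<^bsub>R\<^esub>}"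
    using iota_in_span[of "\<zero>\<^bsub>R\<^esub>" "{\<zero>\<^bsub>R\<^esub>}" "regular_module R"] iota_zero[OF U] by simp
  then have "r \<ominus>\<^bsub>R\<^esub> r' \<in> {\<zero>\<^bsub>R\<^esub>}"
    using descend_membership[OF U zero_submodule[OF U], of "r \<ominus>\<^bsub>R\<^esub> r'"] assms by simp
  then show ?thesis using assms by (simp add: R.minus_zero_imp_eq)
qed

end

section \<open>Admissible functions\<close>

text \<open>The data express that \<open>(S \<otimes> M) / N'\<close> is projective: it has the generators \<open>K\<close> and the coordinates
  \<open>\<sigma>\<close>. Moreover \<open>N'\<close> is the span of the submodule \<open>M'\<close> of \<open>M\<close> defined below, so that \<open>(S \<otimes> M) / N'\<close> is
  the base change of \<open>M / M'\<close>. Statements about this quotient are formulated modulo \<open>M'\<close> and \<open>N'\<close>.\<close>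

locale relative_dual_basis = faithfully_flat_ring_change R S h
  for R :: "('r, 'c) ring_scheme" and S :: "('s, 'd) ring_scheme" and h :: "'r \<Rightarrow> 's" +
  fixes M :: "('r, 'm, 'e) module_scheme" and N' :: "('s \<times> 'm \<Rightarrow>\<^sub>0 int) set set"
    and K :: "('s \<times> 'm \<Rightarrow>\<^sub>0 int) set set"
    and \<sigma> :: "('s \<times> 'm \<Rightarrow>\<^sub>0 int) set \<Rightarrow> (('s \<times> 'm \<Rightarrow>\<^sub>0 int) set \<Rightarrow> 's)"
  assumes M: "module R M"
    and N': "submodule N' S (bc M)" and N'_span: "N' \<subseteq> bc_span M {m \<in> carrier M. iota M m \<in> N'}"
    and K: "K \<subseteq> carrier (bc M)"
    and \<sigma>: "\<sigma> \<in> linear_maps S (bc M) (free_module S K)"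
    and \<sigma>_zero: "n \<in> N' \<Longrightarrow> \<sigma> n = \<zero>\<^bsub>free_module S K\<^esub>"
    and \<sigma>_dual: "n \<in> carrier (bc M) \<Longrightarrow> n \<ominus>\<^bsub>bc M\<^esub> lincomb S (bc M) (\<lambda>k. k) (\<sigma> n) \<in> N'"
begin

sublocale M: module R M by (rule M)

lemmas U = regular_module_module[OF R.is_cring] and V = regular_module_module[OF S.is_cring]

abbreviation R\<^sub>1 where "R\<^sub>1 \<equiv> regular_module R"
abbreviation S\<^sub>1 where "S\<^sub>1 \<equiv> regular_module S"
abbreviation F where "F \<equiv> free_module R (carrier M)"

lemmas F = free_module_module[OF R.is_cring, of "carrier M"]

definition M' where "M' = {m \<in> carrier M. iota M m \<in> N'}"

lemma M'_submodule: "submodule M' R M"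
  unfolding M'_def by (rule iota_preimage_submodule[OF M N'])

text \<open>The dual of \<open>(S \<otimes> M) / N'\<close>.\<close>

definition functionals where
  "functionals = {\<phi> \<in> linear_maps S (bc M) S\<^sub>1. \<forall>n\<in>N'. \<phi> n = \<zero>\<^bsub>S\<^esub>}"

text \<open>An element of this set stands for its restriction to \<open>X\<close>. Functions of finite support on all of \<open>M\<close> form
  one free module, which serves for all \<open>X\<close> at once.\<close>

definition admissible :: "'m set \<Rightarrow> ('m \<Rightarrow> 'r) set" where
  "admissible X = {l \<in> carrier F. \<exists>\<phi>\<in>functionals. \<forall>u\<in>X. h (l u) = \<phi> (iota M u)}"

abbreviation eval_at :: "'m \<Rightarrow> ('s \<times> ('m \<Rightarrow> 'r) \<Rightarrow>\<^sub>0 int) set \<Rightarrow> 's" where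
  "eval_at u \<equiv> bc_lift F S\<^sub>1 (\<lambda>l. h (l u))"

lemma eval_linear: "(\<lambda>l. l u) \<in> linear_maps R F R\<^sub>1"
  by (rule linear_mapsI) (auto simp: free_module_simps)

lemmas eval_at_semilinear = linear_maps_comp[OF eval_linear h_semilinear]
lemmas eval_at_linear = bc_lift_linear[OF F V eval_at_semilinear]

lemma F_closed: "l \<in> carrier F \<Longrightarrow> l u \<in> carrier R"
  by (auto simp: free_module_simps)

lemma functionals_combine:
  assumes "\<phi> \<in> functionals" "\<phi>' \<in> functionals" "s \<in> carrier S"
  shows "(\<lambda>n. \<phi> n \<oplus>\<^bsub>S\<^esub> \<phi>' n) \<in> functionals" "(\<lambda>n. s \<otimes>\<^bsub>S\<^esub> \<phi> n) \<in> functionals"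
    "(\<lambda>n. \<zero>\<^bsub>S\<^esub>) \<in> functionals"
proof -
  note l = linear_mapsD[of \<phi> S "bc M" S\<^sub>1, simplified] linear_mapsD[of \<phi>' S "bc M" S\<^sub>1, simplified]
  show "(\<lambda>n. \<phi> n \<oplus>\<^bsub>S\<^esub> \<phi>' n) \<in> functionals" "(\<lambda>n. s \<otimes>\<^bsub>S\<^esub> \<phi> n) \<in> functionals" "(\<lambda>n. \<zero>\<^bsub>S\<^esub>) \<in> functionals"
    using assms unfolding functionals_def
    by (auto intro!: linear_mapsI simp: l S.a_ac S.r_distr S.m_lcomm)
qed

lemma admissible_submodule: "submodule (admissible X) R F"
proof (rule submoduleI_smult[OF F])
  interpret F: module R F by (rule F)
  show "admissible X \<subseteq> carrier F" by (auto simp: admissible_def)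
  show "\<zero>\<^bsub>F\<^esub> \<in> admissible X"
    using functionals_combine(3) F.zero_closed
    by (auto simp: admissible_def free_module_simps(3) intro!: bexI[of _ "\<lambda>n. \<zero>\<^bsub>S\<^esub>"])
      (simp add: functionals_def linear_maps_def)
  fix l assume l: "l \<in> admissible X"
  then obtain \<phi> where \<phi>: "\<phi> \<in> functionals" "\<forall>u\<in>X. h (l u) = \<phi> (iota M u)" "l \<in> carrier F"
    by (auto simp: admissible_def)
  show "r \<odot>\<^bsub>F\<^esub> l \<in> admissible X" if r: "r \<in> carrier R" for r
    using functionals_combine(2)[OF \<phi>(1,1), of "h r"] F.smult_closed[OF r \<phi>(3)] \<phi> r F_closed[OF \<phi>(3)]
    by (auto simp: admissible_def free_module_simps(4) intro!: bexI[of _ "\<lambda>n. h r \<otimes>\<^bsub>S\<^esub> \<phi> n"])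
  fix l' assume l: "l' \<in> admissible X"
  then obtain \<phi>' where \<phi>': "\<phi>' \<in> functionals" "\<forall>u\<in>X. h (l' u) = \<phi>' (iota M u)" "l' \<in> carrier F"
    by (auto simp: admissible_def)
  show "l \<oplus>\<^bsub>F\<^esub> l' \<in> admissible X"
    using functionals_combine(1)[OF \<phi>(1) \<phi>'(1)] F.a_closed[OF \<phi>(3) \<phi>'(3)] \<phi> \<phi>' F_closed[OF \<phi>(3)] F_closed[OF \<phi>'(3)]
    by (auto simp: admissible_def free_module_simps(2) intro!: bexI[of _ "\<lambda>n. \<phi> n \<oplus>\<^bsub>S\<^esub> \<phi>' n"])
qed

text \<open>Modulo \<open>N'\<close>, the image of \<open>u \<in> X\<close> is the combination of the generators in \<open>K\<close> with coefficients
  \<open>\<sigma>\<close>, and this relation is a consequence of finitely many instances of linearity. If \<open>l\<close> satisfies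
  them, \<open>h (l u)\<close> is computed from \<open>\<sigma> (\<iota> u)\<close> by fixed coefficients in \<open>S\<close>, hence by a functional.\<close>

lemma admissible_tests:
  assumes X: "finite X" "X \<subseteq> carrier M"
  shows "\<exists>T. finite T \<and> T \<subseteq> linearity_tests M M' \<and> (\<forall>l\<in>carrier F. passes l T \<longrightarrow> l \<in> admissible X)"
proof -
  interpret B: module S "bc M" by (rule bc_module[OF M])
  have "\<exists>z. \<forall>k\<in>K. z k \<in> frags (carrier M) \<and> cls M (z k) = k"
  proof (intro bchoice ballI)
    fix k assume "k \<in> K"
    then have "k \<in> bc_span M (carrier M)" using K unfolding carrier_bc by blast
    then show "\<exists>x. x \<in> frags (carrier M) \<and> cls M x = k" by (elim bc_spanE) blast
  qed
  then obtain z where z: "\<And>k. k \<in> K \<Longrightarrow> z k \<in> frags (carrier M)" "\<And>k. k \<in> K \<Longrightarrow> cls M (z k) = k" by blast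
  (* A formal sum that represents the expansion of the image of u in the generators. *)
  define comb where "comb u = (\<Sum>k\<in>{k. \<sigma> (iota M u) k \<noteq> \<zero>\<^bsub>S\<^esub>}. scale_frag (\<sigma> (iota M u) k) (z k))" for u
  have \<sigma>F: "\<sigma> (iota M u) \<in> carrier (free_module S K)" if "u \<in> carrier M" for u
    by (rule linear_mapsD(1)[OF \<sigma> iota_closed[OF that]])
  have comb_fr: "comb u \<in> frags (carrier M)" if "u \<in> carrier M" for u
    unfolding comb_def
  proof (rule frags_sum)
    fix k assume "k \<in> {k. \<sigma> (iota M u) k \<noteq> \<zero>\<^bsub>S\<^esub>}"
    then have "k \<in> K" "\<sigma> (iota M u) k \<in> carrier S"
      using \<sigma>F[OF that] by (auto simp: free_module_simps)
    then show "scale_frag (\<sigma> (iota M u) k) (z k) \<in> frags (carrier M)"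
      using z(1) by (intro frags_scale) auto
  qed
  have comb_cls: "cls M (comb u) = lincomb S (bc M) (\<lambda>k. k) (\<sigma> (iota M u))" if u: "u \<in> carrier M" for u
  proof -
    have "cls M (comb u) = lincomb S (bc M) (\<lambda>k. cls M (z k)) (\<sigma> (iota M u))"
      unfolding comb_def
      by (rule additive_combination[OF bc_module[OF M] \<sigma>F[OF u] z(1)])
        (auto simp: cls_zero cls_add[OF M] cls_scale[OF M] cls_closed simp del: mem_Collect_eq)
    also have "\<dots> = lincomb S (bc M) (\<lambda>k. k) (\<sigma> (iota M u))"
      unfolding lincomb_def
      by (rule B.finsum_cong') (use \<sigma>F[OF u] z(2) K in \<open>auto simp: free_module_simps subset_iff\<close>)
    finally show ?thesis .
  qed
  have "\<exists>T. finite T \<and> T \<subseteq> linearity_tests M M' \<and>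
      (\<forall>l\<in>carrier M \<rightarrow> carrier R. passes l T \<longrightarrow> eval_fun M l (frag_of (\<one>\<^bsub>S\<^esub>, u) - comb u) = \<zero>\<^bsub>S\<^esub>)"
    if u: "u \<in> X" for u
  proof (rule span_null_tests[OF M M'_submodule])
    have uM: "u \<in> carrier M" using u X by auto
    have 1: "frag_of (\<one>\<^bsub>S\<^esub>, u) \<in> frags (carrier M)" using uM by (intro frags_of) auto
    show "frag_of (\<one>\<^bsub>S\<^esub>, u) - comb u \<in> frags (carrier M)"
      by (rule frags_diff[OF 1 comb_fr[OF uM]])
    have "cls M (frag_of (\<one>\<^bsub>S\<^esub>, u) - comb u) \<in> N'"
      unfolding cls_diff[OF M 1 comb_fr[OF uM]] comb_cls[OF uM] iota_def[symmetric]
      by (rule \<sigma>_dual[OF iota_closed[OF uM]])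
    then show "cls M (frag_of (\<one>\<^bsub>S\<^esub>, u) - comb u) \<in> bc_span M M'"
      using N'_span by (auto simp: M'_def)
  qed
  then have "\<exists>T. \<forall>u\<in>X. finite (T u) \<and> T u \<subseteq> linearity_tests M M' \<and>
      (\<forall>l\<in>carrier M \<rightarrow> carrier R. passes l (T u) \<longrightarrow> eval_fun M l (frag_of (\<one>\<^bsub>S\<^esub>, u) - comb u) = \<zero>\<^bsub>S\<^esub>)"
    by (intro bchoice ballI)
  then obtain T where T: "\<And>u. u \<in> X \<Longrightarrow> finite (T u)" "\<And>u. u \<in> X \<Longrightarrow> T u \<subseteq> linearity_tests M M'"
    "\<And>u l. u \<in> X \<Longrightarrow> l \<in> carrier M \<rightarrow> carrier R \<Longrightarrow> passes l (T u) \<Longrightarrow>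
      eval_fun M l (frag_of (\<one>\<^bsub>S\<^esub>, u) - comb u) = \<zero>\<^bsub>S\<^esub>" by metis
  show ?thesis
  proof (intro exI[of _ "\<Union>(T ` X)"] conjI ballI impI)
    show "finite (\<Union>(T ` X))" using X(1) T(1) by blast
    show "\<Union>(T ` X) \<subseteq> linearity_tests M M'" using T(2) by blast
    fix l assume l: "l \<in> carrier F" and p: "passes l (\<Union>(T ` X))"
    have lc: "l \<in> carrier M \<rightarrow> carrier R" using F_closed[OF l] by auto
    have hl: "(\<lambda>m. h (l m)) \<in> carrier M \<rightarrow> carrier S\<^sub>1" using F_closed[OF l] by auto
    (* The functional sending each generator to the value of l at the formal sum representing it. *)
    define b where "b k = eval_fun M l (z k)" for k
    have bS: "k \<in> K \<Longrightarrow> b k \<in> carrier S\<^sub>1" for k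
      unfolding b_def by (rule tensor_eval_closed[OF V hl z(1)])
    define \<phi> where "\<phi> n = lincomb S S\<^sub>1 b (\<sigma> n)" for n
    have "\<phi> \<in> linear_maps S (bc M) S\<^sub>1"
      unfolding \<phi>_def by (rule linear_maps_comp[OF \<sigma> lincomb_linear[OF V bS]])
    moreover have "\<phi> n = \<zero>\<^bsub>S\<^esub>" if "n \<in> N'" for n
      using that lincomb_zero[OF V, of b] by (simp add: \<phi>_def \<sigma>_zero free_module_simps(3))
    ultimately have \<phi>f: "\<phi> \<in> functionals" by (simp add: functionals_def)
    have "h (l u) = \<phi> (iota M u)" if u: "u \<in> X" for u
    proof -
      have uM: "u \<in> carrier M" using u X by auto
      have 1: "frag_of (\<one>\<^bsub>S\<^esub>, u) \<in> frags (carrier M)" using uM by (intro frags_of) auto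
      have "passes l (T u)" using p u by (auto simp: passes_def)
      from T(3)[OF u lc this]
      have "eval_fun M l (frag_of (\<one>\<^bsub>S\<^esub>, u)) \<ominus>\<^bsub>S\<^esub> eval_fun M l (comb u) = \<zero>\<^bsub>S\<^esub>"
        using tensor_eval_diff[OF V hl 1 comb_fr[OF uM]] by simp
      moreover have "eval_fun M l (frag_of (\<one>\<^bsub>S\<^esub>, u)) = h (l u)"
        using tensor_eval_of[OF V hl S.one_closed uM] F_closed[OF l] by simp
      moreover have "eval_fun M l (comb u) = \<phi> (iota M u)"
        unfolding comb_def \<phi>_def b_def
      proof (rule additive_combination[OF V \<sigma>F[OF uM] z(1)])
        show "eval_fun M l \<in> frags (carrier M) \<rightarrow> carrier S\<^sub>1"
          by (intro funcsetI tensor_eval_closed[OF V hl])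
        show "eval_fun M l 0 = \<zero>\<^bsub>S\<^sub>1\<^esub>" by (rule tensor_eval_0[OF V hl])
      qed (simp_all only: tensor_eval_add[OF V hl] tensor_eval_scale[OF V hl])
      ultimately show ?thesis
        using F_closed[OF l, of u] tensor_eval_closed[OF V hl comb_fr[OF uM]]
        by (simp add: S.minus_zero_imp_eq)
    qed
    with \<phi>f l show "l \<in> admissible X" by (auto simp: admissible_def)
  qed
qed


text \<open>The functional passes all linearity tests. The finitely many tests that ensure admissibility on \<open>X\<close>
  are linear equations with coefficients in \<open>R\<close>, so the values of the functional at the points that
  occur in them are a solution over \<open>S\<close>, and this is an \<open>S\<close>-combination of solutions over \<open>R\<close>.\<close>

lemma functional_descends:
  assumes \<phi>: "\<phi> \<in> functionals" and X: "finite X" "X \<subseteq> carrier M"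
  shows "\<exists>n\<in>bc_span F (admissible X). \<forall>u\<in>X. eval_at u n = \<phi> (iota M u)"
proof -
  interpret F: module R F by (rule F)
  interpret BF: module S "bc F" by (rule bc_module[OF F])
  interpret V: module S S\<^sub>1 by (rule V)
  obtain T where T: "finite T" "T \<subseteq> linearity_tests M M'"
    and adm: "\<And>l. l \<in> carrier F \<Longrightarrow> passes l T \<Longrightarrow> l \<in> admissible X"
    using admissible_tests[OF X] by blast
  have \<phi>l: "\<phi> \<in> linear_maps S (bc M) S\<^sub>1" and \<phi>0: "\<And>n. n \<in> N' \<Longrightarrow> \<phi> n = \<zero>\<^bsub>S\<^esub>"
    using \<phi> by (auto simp: functionals_def)
  have \<phi>c: "\<phi> (iota M u) \<in> carrier S" if "u \<in> carrier M" for u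
    using linear_mapsD(1)[OF \<phi>l iota_closed[OF that]] by simp
  define Y where "Y = X \<union> (\<Union>(m, r, n, k)\<in>T. {m, n, k})"
  have Y: "finite Y" "Y \<subseteq> carrier M"
    using X T by (auto simp: Y_def linearity_tests_def)
  (* Point masses; n0 is their combination whose value at every point of Y is that of the functional. *)
  define \<delta> where "\<delta> x = (\<lambda>p. if p = x then \<one>\<^bsub>R\<^esub> else \<zero>\<^bsub>R\<^esub>)" for x :: 'm
  have \<delta>: "\<delta> x \<in> carrier F" if "x \<in> carrier M" for x
  proof -
    have "{p. \<delta> x p \<noteq> \<zero>\<^bsub>R\<^esub>} \<subseteq> {x}" by (auto simp: \<delta>_def)
    then show ?thesis
      using finite_subset[of _ "{x}"] that by (auto simp: free_module_simps \<delta>_def)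
  qed
  define n0 where "n0 = (\<Oplus>\<^bsub>bc F\<^esub>x\<in>Y. \<phi> (iota M x) \<odot>\<^bsub>bc F\<^esub> iota F (\<delta> x))"
  have cl: "\<phi> (iota M x) \<odot>\<^bsub>bc F\<^esub> iota F (\<delta> x) \<in> carrier (bc F)" if "x \<in> Y" for x
    using that Y \<phi>c iota_closed[OF \<delta>] by (intro BF.smult_closed) auto
  have n0: "n0 \<in> carrier (bc F)"
    unfolding n0_def by (rule BF.finsum_closed) (use cl in auto)
  have ev: "eval_at u n0 = \<phi> (iota M u)" if u: "u \<in> Y" for u
  proof -
    have "eval_at u n0 = (\<Oplus>\<^bsub>S\<^sub>1\<^esub>x\<in>Y. eval_at u (\<phi> (iota M x) \<odot>\<^bsub>bc F\<^esub> iota F (\<delta> x)))"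
      unfolding n0_def by (rule linear_maps_finsum[OF bc_module[OF F] V eval_at_linear Y(1) cl])
    also have "\<dots> = (\<Oplus>\<^bsub>S\<^sub>1\<^esub>x\<in>Y. if u = x then \<phi> (iota M x) else \<zero>\<^bsub>S\<^sub>1\<^esub>)"
    proof (rule V.finsum_cong')
      fix x assume x: "x \<in> Y"
      then have xM: "x \<in> carrier M" using Y by auto
      have "eval_at u (\<phi> (iota M x) \<odot>\<^bsub>bc F\<^esub> iota F (\<delta> x)) = \<phi> (iota M x) \<otimes>\<^bsub>S\<^esub> h (\<delta> x u)"
        using linear_mapsD(3)[OF eval_at_linear \<phi>c[OF xM] iota_closed[OF \<delta>[OF xM]]]
          bc_lift_iota[OF F V eval_at_semilinear \<delta>[OF xM]] by simp
      then show "eval_at u (\<phi> (iota M x) \<odot>\<^bsub>bc F\<^esub> iota F (\<delta> x)) = (if u = x then \<phi> (iota M x) else \<zero>\<^bsub>S\<^sub>1\<^esub>)"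
        using \<phi>c[OF xM] by (simp add: \<delta>_def)
    qed (use \<phi>c Y in auto)
    also have "\<dots> = \<phi> (iota M u)"
      by (rule V.add.finprod_singleton) (use u Y \<phi>c in auto)
    finally show ?thesis .
  qed
  define \<epsilon> where "\<epsilon> = (\<lambda>(m, r, n, k) (l :: 'm \<Rightarrow> 'r). l m \<ominus>\<^bsub>R\<^esub> (r \<otimes>\<^bsub>R\<^esub> l n \<oplus>\<^bsub>R\<^esub> l k))"
  have \<epsilon>: "\<epsilon> \<tau> \<in> linear_maps R F R\<^sub>1 \<and> bc_lift F S\<^sub>1 (\<lambda>l. h (\<epsilon> \<tau> l)) n0 = \<zero>\<^bsub>S\<^esub>" if "\<tau> \<in> T" for \<tau>
  proof -
    obtain m r n k where \<tau>: "\<tau> = (m, r, n, k)" by (cases \<tau>)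
    have Ym: "m \<in> Y" "n \<in> Y" "k \<in> Y" using that by (auto simp: \<tau> Y_def)
    have mM: "m \<in> carrier M" "n \<in> carrier M" "k \<in> carrier M" "r \<in> carrier R" "m \<ominus>\<^bsub>M\<^esub> (r \<odot>\<^bsub>M\<^esub> n \<oplus>\<^bsub>M\<^esub> k) \<in> M'"
      using that T(2) by (auto simp: \<tau> linearity_tests_def)
    have lin: "\<epsilon> \<tau> \<in> linear_maps R F R\<^sub>1"
      by (rule linear_mapsI)
        (use mM in \<open>auto simp: \<tau> \<epsilon>_def F_closed free_module_simps(2,4) a_minus_def R.r_distr R.minus_add
          R.a_ac R.m_lcomm R.r_minus\<close>)
    let ?e = "\<lambda>c. eval_at m c \<ominus>\<^bsub>S\<^esub> (h r \<otimes>\<^bsub>S\<^esub> eval_at n c \<oplus>\<^bsub>S\<^esub> eval_at k c)"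
    note ec = linear_mapsD[OF eval_at_linear, simplified]
    have lin2: "?e \<in> linear_maps S (bc F) S\<^sub>1"
      by (rule linear_mapsI)
        (use mM in \<open>simp_all add: ec a_minus_def S.r_distr S.minus_add S.a_ac S.m_lcomm S.r_minus\<close>)
    note h\<epsilon> = linear_maps_comp[OF lin h_semilinear]
    have "bc_lift F S\<^sub>1 (\<lambda>l. h (\<epsilon> \<tau> l)) n0 = ?e n0"
    proof (rule bc_maps_eqI[OF F V bc_lift_linear[OF F V h\<epsilon>] lin2 order_refl _ n0[unfolded carrier_bc]])
      fix l assume l: "l \<in> carrier F"
      show "bc_lift F S\<^sub>1 (\<lambda>l. h (\<epsilon> \<tau> l)) (iota F l) = ?e (iota F l)"
        unfolding bc_lift_iota[OF F V h\<epsilon> l] bc_lift_iota[OF F V eval_at_semilinear l]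
        using mM F_closed[OF l] by (simp add: \<tau> \<epsilon>_def a_minus_def)
    qed
    also have "\<dots> = \<phi> (iota M m) \<ominus>\<^bsub>S\<^esub> (h r \<otimes>\<^bsub>S\<^esub> \<phi> (iota M n) \<oplus>\<^bsub>S\<^esub> \<phi> (iota M k))"
      by (simp add: ev Ym)
    also have "\<dots> = \<phi> (iota M (m \<ominus>\<^bsub>M\<^esub> (r \<odot>\<^bsub>M\<^esub> n \<oplus>\<^bsub>M\<^esub> k)))"
    proof -
      note \<psi> = semilinear_comp_iota[OF M \<phi>l]
      note \<psi>D = linear_mapsD[OF \<psi>, simplified]
      have "\<phi> (iota M (m \<ominus>\<^bsub>M\<^esub> (r \<odot>\<^bsub>M\<^esub> n \<oplus>\<^bsub>M\<^esub> k))) =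
          \<phi> (iota M m) \<ominus>\<^bsub>restrict_module S\<^sub>1\<^esub> \<phi> (iota M (r \<odot>\<^bsub>M\<^esub> n \<oplus>\<^bsub>M\<^esub> k))"
        by (rule linear_maps_minus[OF M restrict_module_module[OF V] \<psi>]) (use mM in auto)
      then show ?thesis using mM by (simp add: \<psi>D)
    qed
    also have "\<dots> = \<zero>\<^bsub>S\<^esub>" using mM(5) by (intro \<phi>0) (simp add: M'_def)
    finally show ?thesis using lin by simp
  qed
  have "n0 \<in> bc_span F {l \<in> carrier F. \<forall>e\<in>\<epsilon> ` T. e l = \<zero>\<^bsub>R\<^esub>}"
    by (rule flat_solutions(1)[OF F _ _ n0]) (use T(1) \<epsilon> in auto)
  moreover have "{l \<in> carrier F. \<forall>e\<in>\<epsilon> ` T. e l = \<zero>\<^bsub>R\<^esub>} \<subseteq> admissible X"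
  proof
    fix l assume l: "l \<in> {l \<in> carrier F. \<forall>e\<in>\<epsilon> ` T. e l = \<zero>\<^bsub>R\<^esub>}"
    show "l \<in> admissible X"
    proof (rule adm)
      show "passes l T"
        unfolding passes_def
      proof (intro ballI, clarify)
        fix m r n k assume t: "(m, r, n, k) \<in> T"
        then have "r \<in> carrier R" using T(2) by (auto simp: linearity_tests_def)
        moreover have "l m \<ominus>\<^bsub>R\<^esub> (r \<otimes>\<^bsub>R\<^esub> l n \<oplus>\<^bsub>R\<^esub> l k) = \<zero>\<^bsub>R\<^esub>" using l t by (auto simp: \<epsilon>_def)
        moreover have "l m \<in> carrier R" "l n \<in> carrier R" "l k \<in> carrier R"
          using l F_closed[of l] by auto
        ultimately show "l m = r \<otimes>\<^bsub>R\<^esub> l n \<oplus>\<^bsub>R\<^esub> l k"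
          by (simp add: R.minus_zero_imp_eq)
      qed
    qed (use l in simp)
  qed
  ultimately have "n0 \<in> bc_span F (admissible X)" using bc_span_mono by blast
  moreover have "\<forall>u\<in>X. eval_at u n0 = \<phi> (iota M u)" using ev by (simp add: Y_def)
  ultimately show ?thesis by blast
qed

text \<open>Let \<open>L\<close> consist of the functions that agree on \<open>X\<close> with an admissible function on \<open>Y\<close>. The
  functional that witnesses the admissibility of \<open>l\<close> is on \<open>Y\<close> a combination of admissible functions on
  \<open>Y\<close>, so the image of \<open>l\<close> is in the span of \<open>L\<close>, and hence \<open>l \<in> L\<close>.\<close>

lemma admissible_extend:
  assumes l: "l \<in> admissible X" and X: "X \<subseteq> Y" "finite Y" "Y \<subseteq> carrier M"
  shows "\<exists>l'\<in>admissible Y. \<forall>u\<in>X. l' u = l u"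
proof -
  interpret F: module R F by (rule F)
  interpret BF: module S "bc F" by (rule bc_module[OF F])
  have X': "finite X" using X finite_subset by auto
  have lF: "l \<in> carrier F" using l by (simp add: admissible_def)
  obtain \<phi> where \<phi>: "\<phi> \<in> functionals" "\<And>u. u \<in> X \<Longrightarrow> h (l u) = \<phi> (iota M u)"
    using l by (auto simp: admissible_def)
  obtain n where n: "n \<in> bc_span F (admissible Y)" "\<And>u. u \<in> Y \<Longrightarrow> eval_at u n = \<phi> (iota M u)"
    using functional_descends[OF \<phi>(1) X(2,3)] by blast
  define L where "L = {v \<in> carrier F. \<exists>l'\<in>admissible Y. \<forall>u\<in>X. l' u = v u}"
  note AE = F.submoduleE[OF admissible_submodule[of Y]]
  have L: "submodule L R F"
  proof (rule submoduleI_smult[OF F])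
    show "\<zero>\<^bsub>F\<^esub> \<in> L"
      using submodule_zero_closed[OF admissible_submodule[of Y]] by (auto simp: L_def)
    fix a assume "a \<in> L"
    then obtain a' where a: "a \<in> carrier F" "a' \<in> admissible Y" "\<And>u. u \<in> X \<Longrightarrow> a' u = a u"
      by (auto simp: L_def)
    show "r \<odot>\<^bsub>F\<^esub> a \<in> L" if "r \<in> carrier R" for r
      using a F.smult_closed[OF that a(1)] AE(4)[OF that a(2)]
      by (auto simp: L_def free_module_simps(4) intro!: bexI[of _ "r \<odot>\<^bsub>F\<^esub> a'"])
    fix b assume "b \<in> L"
    then obtain b' where b: "b \<in> carrier F" "b' \<in> admissible Y" "\<And>u. u \<in> X \<Longrightarrow> b' u = b u"
      by (auto simp: L_def)
    show "a \<oplus>\<^bsub>F\<^esub> b \<in> L"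
      using a b F.a_closed[OF a(1) b(1)] AE(5)[OF a(2) b(2)]
      by (auto simp: L_def free_module_simps(2) intro!: bexI[of _ "a' \<oplus>\<^bsub>F\<^esub> b'"])
  qed (auto simp: L_def)
  have LF: "L \<subseteq> carrier F" by (auto simp: L_def)
  have AF: "admissible Y \<subseteq> carrier F" by (auto simp: admissible_def)
  have AL: "admissible Y \<subseteq> L" using AF by (auto simp: L_def)
  have nF: "n \<in> carrier (bc F)" using n(1) bc_span_closed[OF AF] by auto
  (* The difference vanishes on X, hence is spanned by functions vanishing on X, and these are in L. *)
  define n1 where "n1 = iota F l \<ominus>\<^bsub>bc F\<^esub> n"
  have n1F: "n1 \<in> carrier (bc F)" unfolding n1_def using nF iota_closed[OF lF] by simp
  have "eval_at u n1 = \<zero>\<^bsub>S\<^esub>" if u: "u \<in> X" for u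
  proof -
    have "eval_at u n1 = eval_at u (iota F l) \<ominus>\<^bsub>S\<^sub>1\<^esub> eval_at u n"
      unfolding n1_def by (rule linear_maps_minus[OF bc_module[OF F] V eval_at_linear iota_closed[OF lF] nF])
    also have "\<dots> = h (l u) \<ominus>\<^bsub>S\<^esub> h (l u)"
      using u X n(2) \<phi>(2) by (simp add: bc_lift_iota[OF F V eval_at_semilinear lF] subset_iff)
    finally show ?thesis using F_closed[OF lF, of u] by (simp add: a_minus_def S.r_neg)
  qed
  then have "n1 \<in> bc_span F {v \<in> carrier F. \<forall>e\<in>(\<lambda>u l. l u) ` X. e v = \<zero>\<^bsub>R\<^esub>}"
    by (intro flat_solutions(1)[OF F _ _ n1F]) (use X' eval_linear in auto)
  moreover have "{v \<in> carrier F. \<forall>e\<in>(\<lambda>u l. l u) ` X. e v = \<zero>\<^bsub>R\<^esub>} \<subseteq> L"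
    using submodule_zero_closed[OF admissible_submodule[of Y]]
    by (auto simp: L_def free_module_simps(3))
  ultimately have 1: "n1 \<in> bc_span F L" using bc_span_mono by blast
  have "n \<in> bc_span F L" using n(1) bc_span_mono[OF AL] by blast
  with 1 have "n1 \<oplus>\<^bsub>bc F\<^esub> n \<in> bc_span F L"
    by (rule BF.submoduleE(5)[OF bc_span_submodule[OF F LF]])
  also have "n1 \<oplus>\<^bsub>bc F\<^esub> n = iota F l"
    unfolding n1_def using nF iota_closed[OF lF] by (simp add: a_minus_def BF.M.a_assoc BF.M.l_neg)
  finally have "l \<in> L" by (rule descend_membership[OF F L lF])
  then show ?thesis by (auto simp: L_def)
qed

end

section \<open>Functionals on countably generated extensions\<close>

text \<open>Here \<open>M'' / M'\<close> is generated by the sequence \<open>x\<close>, and expanding the image of an element of \<open>M''\<close> in the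
  generators \<open>K\<close> involves only those in the span of \<open>M''\<close>. The latter makes the trace property of the
  base change hold within \<open>M''\<close>.\<close>

locale countably_generated_extension = relative_dual_basis R S h M N' K \<sigma>
  for R :: "('r, 'c) ring_scheme" and S :: "('s, 'd) ring_scheme" and h :: "'r \<Rightarrow> 's"
    and M :: "('r, 'm, 'e) module_scheme" and N' K \<sigma> +
  fixes M'' :: "'m set" and x :: "nat \<Rightarrow> 'm"
  assumes M'': "submodule M'' R M" and M'M'': "M' \<subseteq> M''" and x: "\<And>i. x i \<in> M''"
    and generated: "\<And>L. submodule L R M \<Longrightarrow> M' \<subseteq> L \<Longrightarrow> range x \<subseteq> L \<Longrightarrow> M'' \<subseteq> L"
    and support: "\<And>p k. p \<in> M'' \<Longrightarrow> \<sigma> (iota M p) k \<noteq> \<zero>\<^bsub>S\<^esub> \<Longrightarrow> k \<in> bc_span M M''"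
begin

abbreviation M\<^sub>2 where "M\<^sub>2 \<equiv> M\<lparr>carrier := M''\<rparr>"

lemmas M2 = submodule_module[OF M M'']

sublocale M2: module R M\<^sub>2 by (rule M2)

lemma M''M: "M'' \<subseteq> carrier M" by (rule M.submoduleE(1)[OF M''])

text \<open>An admissible function on \<open>{p}\<close> extends successively to the generators; the functionals
  witnessing admissibility determine the values on all of \<open>M''\<close>.\<close>

lemma extend_to_functional:
  assumes p: "p \<in> M''" and l: "l \<in> admissible {p}"
  shows "\<exists>\<theta>\<in>linear_maps R M\<^sub>2 R\<^sub>1. \<theta> p = l p \<and> (\<forall>m\<in>M'. \<theta> m = \<zero>\<^bsub>R\<^esub>)"
proof -
  define X where "X n = insert p (x ` {..<n})" for n
  have X: "finite (X n)" "X n \<subseteq> carrier M" for n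
    using p x M''M by (auto simp: X_def)
  have Xmono: "X n \<subseteq> X n'" if "n \<le> n'" for n n' using that by (auto simp: X_def)
  have "\<exists>ls. (ls 0 = l \<and> (\<forall>n. ls n \<in> admissible (X n))) \<and> (\<forall>n. \<forall>u\<in>X n. ls (Suc n) u = ls n u)"
  proof -
    have "\<exists>ls. \<forall>n. (ls n \<in> admissible (X n) \<and> (n = 0 \<longrightarrow> ls n = l)) \<and> (\<forall>u\<in>X n. ls (Suc n) u = ls n u)"
    proof (rule dependent_nat_choice)
      show "\<exists>a. a \<in> admissible (X 0) \<and> (0 = (0::nat) \<longrightarrow> a = l)" using l by (simp add: X_def)
      fix a n assume "a \<in> admissible (X n) \<and> (n = 0 \<longrightarrow> a = l)"
      then show "\<exists>b. (b \<in> admissible (X (Suc n)) \<and> (Suc n = 0 \<longrightarrow> b = l)) \<and> (\<forall>u\<in>X n. b u = a u)"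
        using admissible_extend[of a "X n" "X (Suc n)"] X Xmono[of n "Suc n"] by auto
    qed
    then show ?thesis by metis
  qed
  then obtain ls where ls0: "ls 0 = l" and lsA: "\<And>n. ls n \<in> admissible (X n)"
    and lsS: "\<And>n u. u \<in> X n \<Longrightarrow> ls (Suc n) u = ls n u" by blast
  have lsF: "ls n u \<in> carrier R" for n u using lsA[of n] F_closed by (auto simp: admissible_def)
  have ls: "ls n' u = ls n u" if "n \<le> n'" "u \<in> X n" for n n' u
    using that
  proof (induction n' rule: dec_induct)
    case (step n')
    then show ?case using lsS[of u n'] Xmono[of n n'] by auto
  qed simp
  have "\<exists>\<phi>. \<forall>n. \<phi> n \<in> functionals \<and> (\<forall>u\<in>X n. h (ls n u) = \<phi> n (iota M u))"
    using lsA by (intro choice) (auto simp: admissible_def)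
  then obtain \<phi> where \<phi>: "\<And>n. \<phi> n \<in> functionals" "\<And>n u. u \<in> X n \<Longrightarrow> h (ls n u) = \<phi> n (iota M u)"
    by blast
  have \<psi>: "(\<lambda>m. \<phi> n (iota M m)) \<in> semilinear M S\<^sub>1" for n
    by (rule semilinear_comp_iota[OF M]) (use \<phi>(1)[of n] in \<open>simp add: functionals_def\<close>)
  note \<psi>D = linear_mapsD[OF \<psi>, simplified]
  (* The set of m at which the functionals eventually agree with an element of R is a submodule. *)
  define val where "val m r \<longleftrightarrow> r \<in> carrier R \<and> (\<exists>N. \<forall>n\<ge>N. \<phi> n (iota M m) = h r)" for m r
  have val_unique: "r = r'" if "val m r" "val m r'" for m r r'
  proof -
    obtain N N' where "\<And>n. n \<ge> N \<Longrightarrow> \<phi> n (iota M m) = h r" "\<And>n. n \<ge> N' \<Longrightarrow> \<phi> n (iota M m) = h r'"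
      using \<open>val m r\<close> \<open>val m r'\<close> unfolding val_def by blast
    from this(1)[of "max N N'"] this(2)[of "max N N'"] have "h r = h r'" by simp
    then show ?thesis using that h_injective by (auto simp: val_def)
  qed
  have val_add: "val (m \<oplus>\<^bsub>M\<^esub> m') (r \<oplus>\<^bsub>R\<^esub> r')" if "val m r" "val m' r'" "m \<in> carrier M" "m' \<in> carrier M" for m m' r r'
  proof -
    obtain N N' where "\<And>n. n \<ge> N \<Longrightarrow> \<phi> n (iota M m) = h r" "\<And>n. n \<ge> N' \<Longrightarrow> \<phi> n (iota M m') = h r'"
      using \<open>val m r\<close> \<open>val m' r'\<close> unfolding val_def by blast
    then have "\<forall>n\<ge>max N N'. \<phi> n (iota M (m \<oplus>\<^bsub>M\<^esub> m')) = h (r \<oplus>\<^bsub>R\<^esub> r')"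
      using that by (simp add: \<psi>D val_def)
    then show ?thesis using that unfolding val_def by blast
  qed
  have val_smult: "val (a \<odot>\<^bsub>M\<^esub> m) (a \<otimes>\<^bsub>R\<^esub> r)" if "val m r" "m \<in> carrier M" "a \<in> carrier R" for a m r
  proof -
    obtain N where "\<And>n. n \<ge> N \<Longrightarrow> \<phi> n (iota M m) = h r"
      using \<open>val m r\<close> unfolding val_def by blast
    then have "\<forall>n\<ge>N. \<phi> n (iota M (a \<odot>\<^bsub>M\<^esub> m)) = h (a \<otimes>\<^bsub>R\<^esub> r)"
      using that by (simp add: \<psi>D val_def)
    then show ?thesis using that unfolding val_def by blast
  qed
  have val_X: "val u (ls n u)" if "u \<in> X n" for n u
    unfolding val_def
  proof (intro conjI exI[of _ n] allI impI lsF)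
    fix n' assume "n' \<ge> n"
    then show "\<phi> n' (iota M u) = h (ls n u)"
      using \<phi>(2)[of u n'] ls[of n n' u] Xmono[of n n'] that by auto
  qed
  have val_M': "val m \<zero>\<^bsub>R\<^esub>" if "m \<in> M'" for m
    using that \<phi>(1) by (auto simp: val_def M'_def functionals_def)
  have "submodule {m \<in> carrier M. \<exists>r. val m r} R M"
    by (rule submoduleI_smult[OF M])
      (use val_M'[OF submodule_zero_closed[OF M'_submodule]] val_add val_smult in blast)+
  then have "M'' \<subseteq> {m \<in> carrier M. \<exists>r. val m r}"
  proof (rule generated)
    show "M' \<subseteq> {m \<in> carrier M. \<exists>r. val m r}" using val_M' M'M'' M''M by blast
    have "val (x i) (ls (Suc i) (x i))" for i by (rule val_X) (simp add: X_def)
    then show "range x \<subseteq> {m \<in> carrier M. \<exists>r. val m r}" using x M''M by blast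
  qed
  then have ex: "\<exists>r. val m r" if "m \<in> M''" for m using that by blast
  define \<theta> where "\<theta> m = (SOME r. val m r)" for m
  have \<theta>: "val m (\<theta> m)" if "m \<in> M''" for m unfolding \<theta>_def by (rule someI_ex[OF ex[OF that]])
  have \<theta>eq: "\<theta> m = r" if "m \<in> M''" "val m r" for m r by (rule val_unique[OF \<theta>[OF that(1)] that(2)])
  have "\<theta> \<in> linear_maps R M\<^sub>2 R\<^sub>1"
  proof (rule linear_mapsI; simp)
    fix m assume m: "m \<in> M''"
    then show "\<theta> m \<in> carrier R" using \<theta> by (simp add: val_def)
    show "\<theta> (a \<odot>\<^bsub>M\<^esub> m) = a \<otimes>\<^bsub>R\<^esub> \<theta> m" if "a \<in> carrier R" for a
      using m that M''M by (intro \<theta>eq val_smult \<theta> M.submoduleE(4)[OF M'']) auto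
    show "\<theta> (m \<oplus>\<^bsub>M\<^esub> m') = \<theta> m \<oplus>\<^bsub>R\<^esub> \<theta> m'" if "m' \<in> M''" for m'
      using m that M''M by (intro \<theta>eq val_add \<theta> M.submoduleE(5)[OF M'']) auto
  qed
  moreover have "\<theta> p = l p" using val_X[of p 0] p by (intro \<theta>eq) (auto simp: X_def ls0)
  moreover have "\<forall>m\<in>M'. \<theta> m = \<zero>\<^bsub>R\<^esub>" using val_M' M'M'' by (intro ballI \<theta>eq) auto
  ultimately show ?thesis by blast
qed

end

section \<open>Extending a lift along a countably generated extension\<close>

locale countably_generated_lifting = countably_generated_extension R S h M N' K \<sigma> M'' x
  for R :: "('r, 'c) ring_scheme" and S :: "('s, 'd) ring_scheme" and h :: "'r \<Rightarrow> 's"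
    and M :: "('r, 'm, 'e) module_scheme" and N' K \<sigma> M'' x +
  fixes Q :: "('r, 'q, 'x) module_scheme" and B :: "('r, 'b, 'y) module_scheme"
    and g :: "'q \<Rightarrow> 'b" and f :: "'m \<Rightarrow> 'b" and t :: "'m \<Rightarrow> 'q"
  assumes Q: "module R Q" and B: "module R B"
    and g: "g \<in> linear_maps R Q B" and g_surj: "g ` carrier Q = carrier B"
    and f: "f \<in> linear_maps R M B"
    and t: "t \<in> linear_maps R (M\<lparr>carrier := M'\<rparr>) Q" and t_lifts: "\<And>m. m \<in> M' \<Longrightarrow> g (t m) = f m"
begin

sublocale Q: module R Q by (rule Q)
sublocale B: module R B by (rule B)

lemmas gD = linear_mapsD[OF g] and fD = linear_mapsD[OF f] and tD = linear_mapsD[OF t, simplified]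

lemmas M''D = M.submoduleE(4,5)[OF M''] and M'D = M.submoduleE(4,5)[OF M'_submodule]
lemmas M''0 = submodule_zero_closed[OF M''] and M'0 = submodule_zero_closed[OF M'_submodule]

lemma M''_carrier: "m \<in> M'' \<Longrightarrow> m \<in> carrier M" using M''M by blast
lemma M'_M'': "m \<in> M' \<Longrightarrow> m \<in> M''" using M'M'' by blast

text \<open>All that matters about an endomorphism \<open>\<Theta>\<close> of finite rank is that \<open>f \<circ> \<Theta>\<close> lifts along \<open>g\<close>, because it
  factors through a free module. The lift \<open>\<tau>\<close> takes the place of the factorization.\<close>

definition liftable :: "('m \<Rightarrow> 'm) \<Rightarrow> ('m \<Rightarrow> 'q) \<Rightarrow> bool" where
  "liftable \<Theta> \<tau> \<longleftrightarrow> \<Theta> \<in> linear_maps R M\<^sub>2 M\<^sub>2 \<and> \<tau> \<in> linear_maps R M\<^sub>2 Q \<and>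
    (\<forall>m\<in>M'. \<Theta> m = \<zero>\<^bsub>M\<^esub> \<and> \<tau> m = \<zero>\<^bsub>Q\<^esub>) \<and> (\<forall>m\<in>M''. g (\<tau> m) = f (\<Theta> m))"

lemma liftable_zero: "liftable (\<lambda>_. \<zero>\<^bsub>M\<^esub>) (\<lambda>_. \<zero>\<^bsub>Q\<^esub>)"
  unfolding liftable_def
  using M''0 linear_maps_zero[OF g Q B] linear_maps_zero[OF f M B] by (auto intro!: linear_mapsI)

lemma liftable_add:
  assumes "liftable \<Theta> \<tau>" "liftable \<Theta>' \<tau>'"
  shows "liftable (\<lambda>m. \<Theta> m \<oplus>\<^bsub>M\<^esub> \<Theta>' m) (\<lambda>m. \<tau> m \<oplus>\<^bsub>Q\<^esub> \<tau>' m)"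
proof -
  note a = assms[unfolded liftable_def]
  have l: "\<Theta> \<in> linear_maps R M\<^sub>2 M\<^sub>2" "\<tau> \<in> linear_maps R M\<^sub>2 Q"
    "\<Theta>' \<in> linear_maps R M\<^sub>2 M\<^sub>2" "\<tau>' \<in> linear_maps R M\<^sub>2 Q" using a by auto
  note d = l[THEN linear_mapsD(1), simplified] l[THEN linear_mapsD(2), simplified]
    l[THEN linear_mapsD(3), simplified]
  show ?thesis
    unfolding liftable_def
    using a d M''D M''_carrier
    by (auto intro!: linear_mapsI simp: gD fD M.M.a_ac Q.M.a_ac M.smult_r_distr Q.smult_r_distr)
qed

lemma liftable_smult:
  assumes "liftable \<Theta> \<tau>" "r \<in> carrier R"
  shows "liftable (\<lambda>m. r \<odot>\<^bsub>M\<^esub> \<Theta> m) (\<lambda>m. r \<odot>\<^bsub>Q\<^esub> \<tau> m)"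
proof -
  note a = assms(1)[unfolded liftable_def]
  have l: "\<Theta> \<in> linear_maps R M\<^sub>2 M\<^sub>2" "\<tau> \<in> linear_maps R M\<^sub>2 Q" using a by auto
  note d = l[THEN linear_mapsD(1), simplified] l[THEN linear_mapsD(2), simplified]
    l[THEN linear_mapsD(3), simplified]
  show ?thesis
    unfolding liftable_def
    using a d M''D M''_carrier assms(2)
    by (auto intro!: linear_mapsI simp: gD fD M.smult_r_distr Q.smult_r_distr
        M.smult_assoc1[symmetric] Q.smult_assoc1[symmetric] R.m_comm)
qed

lemma liftable_rank_one:
  assumes \<theta>: "\<theta> \<in> linear_maps R M\<^sub>2 R\<^sub>1" "\<And>m. m \<in> M' \<Longrightarrow> \<theta> m = \<zero>\<^bsub>R\<^esub>" and y: "y \<in> M''"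
  shows "\<exists>\<tau>. liftable (\<lambda>m. \<theta> m \<odot>\<^bsub>M\<^esub> y) \<tau>"
proof -
  have yM: "y \<in> carrier M" by (rule M''_carrier[OF y])
  have "f y \<in> g ` carrier Q" using fD(1)[OF yM] by (simp add: g_surj)
  then obtain a where a: "a \<in> carrier Q" "g a = f y" by auto
  note d = linear_mapsD[OF \<theta>(1), simplified]
  have "liftable (\<lambda>m. \<theta> m \<odot>\<^bsub>M\<^esub> y) (\<lambda>m. \<theta> m \<odot>\<^bsub>Q\<^esub> a)"
    unfolding liftable_def
    using d \<theta>(2) y yM a M''D
    by (auto intro!: linear_mapsI simp: gD fD M.smult_l_distr Q.smult_l_distr M.smult_assoc1 Q.smult_assoc1)
  then show ?thesis by blast
qed

text \<open>This is the trace property of \<open>M'' / M'\<close>. The image of \<open>p\<close> is modulo \<open>N'\<close> a combination of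
  elements of \<open>K\<close> with coefficients that are values of functionals at \<open>p\<close>. By \<open>functional_descends\<close>
  these are \<open>S\<close>-combinations of values at \<open>p\<close> of admissible functions, which extend to functionals on \<open>M''\<close>. Hence the image of \<open>p\<close> is in the span of the submodule \<open>L\<close>
  of the elements that are modulo \<open>M'\<close> values at \<open>p\<close> of liftable maps, and \<open>p \<in> L\<close>.\<close>

lemma finite_rank_fixing:
  assumes p: "p \<in> M''"
  shows "\<exists>\<Theta> \<tau> d. liftable \<Theta> \<tau> \<and> d \<in> M' \<and> p = \<Theta> p \<oplus>\<^bsub>M\<^esub> d"
proof -
  interpret N: module S "bc M" by (rule bc_module[OF M])
  interpret BF: module S "bc F" by (rule bc_module[OF F])
  define L where "L = {m \<in> M''. \<exists>\<Theta> \<tau> d. liftable \<Theta> \<tau> \<and> d \<in> M' \<and> m = \<Theta> p \<oplus>\<^bsub>M\<^esub> d}"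
  have pM: "p \<in> carrier M" by (rule M''_carrier[OF p])
  have \<Theta>p: "\<Theta> p \<in> carrier M" if "liftable \<Theta> \<tau>" for \<Theta> \<tau>
    using that linear_mapsD(1)[of \<Theta> R M\<^sub>2 M\<^sub>2 p] p M''_carrier by (simp add: liftable_def)
  have M'L: "M' \<subseteq> L"
  proof
    fix m assume "m \<in> M'"
    then show "m \<in> L"
      using liftable_zero M'_M''[of m] M''_carrier[of m] unfolding L_def by fastforce
  qed
  have L: "submodule L R M"
  proof (rule submoduleI_smult[OF M])
    show "L \<subseteq> carrier M" using M''M by (auto simp: L_def)
    show "\<zero>\<^bsub>M\<^esub> \<in> L" using M'L M'0 by auto
    fix a assume "a \<in> L"
    then obtain \<Theta> \<tau> d where a: "a \<in> M''" "liftable \<Theta> \<tau>" "d \<in> M'" "a = \<Theta> p \<oplus>\<^bsub>M\<^esub> d"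
      by (auto simp: L_def)
    have dM: "d \<in> carrier M" using a(3) M'_M'' M''_carrier by blast
    show "r \<odot>\<^bsub>M\<^esub> a \<in> L" if r: "r \<in> carrier R" for r
    proof -
      have "r \<odot>\<^bsub>M\<^esub> a = r \<odot>\<^bsub>M\<^esub> \<Theta> p \<oplus>\<^bsub>M\<^esub> r \<odot>\<^bsub>M\<^esub> d"
        using r a(4) dM \<Theta>p[OF a(2)] by (simp add: M.smult_r_distr)
      then show ?thesis
        using liftable_smult[OF a(2) r] M'D(1)[OF r a(3)] M''D(1)[OF r a(1)] unfolding L_def by blast
    qed
    fix b assume "b \<in> L"
    then obtain \<Theta>' \<tau>' d' where b: "b \<in> M''" "liftable \<Theta>' \<tau>'" "d' \<in> M'" "b = \<Theta>' p \<oplus>\<^bsub>M\<^esub> d'"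
      by (auto simp: L_def)
    have d'M: "d' \<in> carrier M" using b(3) M'_M'' M''_carrier by blast
    have "a \<oplus>\<^bsub>M\<^esub> b = (\<Theta> p \<oplus>\<^bsub>M\<^esub> \<Theta>' p) \<oplus>\<^bsub>M\<^esub> (d \<oplus>\<^bsub>M\<^esub> d')"
      using a(4) b(4) dM d'M \<Theta>p[OF a(2)] \<Theta>p[OF b(2)] by (simp add: M.M.a_ac)
    then show "a \<oplus>\<^bsub>M\<^esub> b \<in> L"
      using liftable_add[OF a(2) b(2)] M'D(2)[OF a(3) b(3)] M''D(2)[OF a(1) b(1)] unfolding L_def by blast
  qed
  have LM: "L \<subseteq> carrier M" by (rule M.submoduleE(1)[OF L])
  note SL = bc_span_submodule[OF M LM]
  note SLE = N.submoduleE(4,5)[OF SL]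
  have value_smult: "h (l p) \<odot>\<^bsub>bc M\<^esub> k \<in> bc_span M L"
    if l: "l \<in> admissible {p}" and k: "k \<in> bc_span M M''" for l k
  proof -
    have lF: "l \<in> carrier F" using l by (simp add: admissible_def)
    have lp: "l p \<in> carrier R" by (rule F_closed[OF lF])
    obtain \<theta> where \<theta>: "\<theta> \<in> linear_maps R M\<^sub>2 R\<^sub>1" "\<theta> p = l p" "\<And>m. m \<in> M' \<Longrightarrow> \<theta> m = \<zero>\<^bsub>R\<^esub>"
      using extend_to_functional[OF p l] by blast
    have yL: "l p \<odot>\<^bsub>M\<^esub> y \<in> L" if y: "y \<in> M''" for y
    proof -
      obtain \<tau> where \<tau>: "liftable (\<lambda>m. \<theta> m \<odot>\<^bsub>M\<^esub> y) \<tau>" using liftable_rank_one[OF \<theta>(1,3) y] by blast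
      have "l p \<odot>\<^bsub>M\<^esub> y = \<theta> p \<odot>\<^bsub>M\<^esub> y \<oplus>\<^bsub>M\<^esub> \<zero>\<^bsub>M\<^esub>" using lp M''_carrier[OF y] by (simp add: \<theta>(2))
      then show ?thesis using \<tau> M'0 M''D(1)[OF lp y] unfolding L_def by blast
    qed
    have "submodule {k \<in> carrier (bc M). h (l p) \<odot>\<^bsub>bc M\<^esub> k \<in> bc_span M L} S (bc M)"
    proof (rule submoduleI_smult[OF bc_module[OF M]])
      show "\<zero>\<^bsub>bc M\<^esub> \<in> {k \<in> carrier (bc M). h (l p) \<odot>\<^bsub>bc M\<^esub> k \<in> bc_span M L}"
        using lp submodule_zero_closed[OF SL] by simp
      fix a assume a: "a \<in> {k \<in> carrier (bc M). h (l p) \<odot>\<^bsub>bc M\<^esub> k \<in> bc_span M L}"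
      show "s \<odot>\<^bsub>bc M\<^esub> a \<in> {k \<in> carrier (bc M). h (l p) \<odot>\<^bsub>bc M\<^esub> k \<in> bc_span M L}" if s: "s \<in> carrier S" for s
      proof -
        have "h (l p) \<odot>\<^bsub>bc M\<^esub> (s \<odot>\<^bsub>bc M\<^esub> a) = s \<odot>\<^bsub>bc M\<^esub> (h (l p) \<odot>\<^bsub>bc M\<^esub> a)"
          using a s lp by (simp add: N.smult_assoc1[symmetric] S.m_comm)
        then show ?thesis using a s SLE(1) by simp
      qed
      fix b assume "b \<in> {k \<in> carrier (bc M). h (l p) \<odot>\<^bsub>bc M\<^esub> k \<in> bc_span M L}"
      with a show "a \<oplus>\<^bsub>bc M\<^esub> b \<in> {k \<in> carrier (bc M). h (l p) \<odot>\<^bsub>bc M\<^esub> k \<in> bc_span M L}"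
        using lp SLE(2) by (simp add: N.smult_r_distr)
    qed auto
    note W = this
    have "h (l p) \<odot>\<^bsub>bc M\<^esub> iota M y \<in> bc_span M L" if y: "y \<in> M''" for y
      using iota_in_span[OF yL[OF y], of M] by (simp add: iotaD(3)[OF M lp M''_carrier[OF y]])
    with bc_span_least[OF M W M''M] show ?thesis
      using k iota_closed[OF M''_carrier] by auto
  qed
  have coeff_smult: "\<sigma> (iota M p) k \<odot>\<^bsub>bc M\<^esub> k \<in> bc_span M L" if k: "k \<in> bc_span M M''" for k
  proof -
    have kN: "k \<in> carrier (bc M)" using k bc_span_closed[OF M''M] by blast
    have "\<sigma> n k \<in> carrier S" if "n \<in> carrier (bc M)" for n
      using linear_mapsD(1)[OF \<sigma> that] by (auto simp: free_module_simps)
    then have "(\<lambda>n. \<sigma> n k) \<in> functionals"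
      unfolding functionals_def using linear_mapsD(2,3)[OF \<sigma>] \<sigma>_zero
      by (auto intro!: linear_mapsI simp: free_module_simps)
    from functional_descends[OF this, of "{p}"] pM
    obtain n where n: "n \<in> bc_span F (admissible {p})" "eval_at p n = \<sigma> (iota M p) k" by auto
    have AF: "admissible {p} \<subseteq> carrier F" by (auto simp: admissible_def)
    note ed = linear_mapsD[OF eval_at_linear[of p], simplified]
    have "submodule {n \<in> carrier (bc F). eval_at p n \<odot>\<^bsub>bc M\<^esub> k \<in> bc_span M L} S (bc F)"
    proof (rule submoduleI_smult[OF bc_module[OF F]])
      show "\<zero>\<^bsub>bc F\<^esub> \<in> {n \<in> carrier (bc F). eval_at p n \<odot>\<^bsub>bc M\<^esub> k \<in> bc_span M L}"
        using linear_maps_zero[OF eval_at_linear bc_module[OF F] V] submodule_zero_closed[OF SL] kN by simp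
    qed (use ed SLE kN in \<open>auto simp: N.smult_l_distr N.smult_assoc1\<close>)
    from bc_span_least[OF F this AF] have "eval_at p n \<odot>\<^bsub>bc M\<^esub> k \<in> bc_span M L"
      using n(1) value_smult[OF _ k] AF iota_closed[of _ F] bc_lift_iota[OF F V eval_at_semilinear]
      by (auto simp: subset_iff)
    then show ?thesis by (simp add: n(2))
  qed
  have ip: "iota M p \<in> carrier (bc M)" by (rule iota_closed[OF pM])
  define c where "c = lincomb S (bc M) (\<lambda>k. k) (\<sigma> (iota M p))"
  have "c \<in> bc_span M L"
    unfolding c_def lincomb_def
    by (rule submodule_finsum_closed[OF bc_module[OF M] SL]) (use coeff_smult support[OF p] in auto)
  moreover have "iota M p \<ominus>\<^bsub>bc M\<^esub> c \<in> bc_span M L"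
    using \<sigma>_dual[OF ip] N'_span bc_span_mono[OF M'L] unfolding c_def M'_def by blast
  ultimately have "(iota M p \<ominus>\<^bsub>bc M\<^esub> c) \<oplus>\<^bsub>bc M\<^esub> c \<in> bc_span M L" using SLE(2) by blast
  moreover have "(iota M p \<ominus>\<^bsub>bc M\<^esub> c) \<oplus>\<^bsub>bc M\<^esub> c = iota M p"
    using ip \<open>c \<in> bc_span M L\<close> bc_span_closed[OF LM] by (auto simp: a_minus_def N.M.a_assoc N.M.l_neg)
  ultimately have "p \<in> L" using descend_membership[OF M L pM] by simp
  then show ?thesis by (auto simp: L_def)
qed

text \<open>Correcting the identity of \<open>M''\<close> successively by endomorphisms of finite rank kills the
  generators one at a time modulo \<open>M'\<close>, so that the corrections form a locally finite sum. The lift of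
  this sum together with \<open>t\<close> on what remains is a lift of \<open>f\<close>.\<close>

theorem lift_extends:
  "\<exists>t'\<in>linear_maps R M\<^sub>2 Q. (\<forall>m\<in>M''. g (t' m) = f m) \<and> (\<forall>m\<in>M'. t' m = t m)"
proof -
  (* eta is what remains of the identity, and tau lifts f composed with the corrections made so far. *)
  define P where "P = (\<lambda>(\<eta>, \<tau>). \<eta> \<in> linear_maps R M\<^sub>2 M\<^sub>2 \<and> \<tau> \<in> linear_maps R M\<^sub>2 Q \<and>
    (\<forall>m\<in>M'. \<eta> m = m \<and> \<tau> m = \<zero>\<^bsub>Q\<^esub>) \<and> (\<forall>m\<in>M''. g (\<tau> m) \<oplus>\<^bsub>B\<^esub> f (\<eta> m) = f m))"
  have "\<exists>s. \<forall>n. P (s n) \<and> (fst (s (Suc n)) (x n) \<in> M' \<and>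
      (\<forall>m\<in>M''. fst (s n) m \<in> M' \<longrightarrow> fst (s (Suc n)) m = fst (s n) m \<and> snd (s (Suc n)) m = snd (s n) m))"
  proof (rule dependent_nat_choice)
    have "P (\<lambda>m. m, \<lambda>_. \<zero>\<^bsub>Q\<^esub>)"
      using linear_maps_zero[OF g Q B] fD(1) M''_carrier
      by (auto simp: P_def intro!: linear_mapsI)
    then show "\<exists>s. P s" by blast
  next
    fix s n assume P: "P s"
    obtain \<eta> \<tau> where s: "s = (\<eta>, \<tau>)" by (cases s)
    have \<eta>: "\<eta> \<in> linear_maps R M\<^sub>2 M\<^sub>2" and \<tau>: "\<tau> \<in> linear_maps R M\<^sub>2 Q"
      and M'id: "\<And>m. m \<in> M' \<Longrightarrow> \<eta> m = m" "\<And>m. m \<in> M' \<Longrightarrow> \<tau> m = \<zero>\<^bsub>Q\<^esub>"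
      and gf: "\<And>m. m \<in> M'' \<Longrightarrow> g (\<tau> m) \<oplus>\<^bsub>B\<^esub> f (\<eta> m) = f m" using P by (auto simp: P_def s)
    note \<eta>D = linear_mapsD[OF \<eta>, simplified] and \<tau>D = linear_mapsD[OF \<tau>, simplified]
    obtain \<Theta> \<upsilon> d where \<Theta>: "liftable \<Theta> \<upsilon>" and d: "d \<in> M'" "\<eta> (x n) = \<Theta> (\<eta> (x n)) \<oplus>\<^bsub>M\<^esub> d"
      using finite_rank_fixing[OF \<eta>D(1)[OF x]] by blast
    have \<Theta>l: "\<Theta> \<in> linear_maps R M\<^sub>2 M\<^sub>2" "\<upsilon> \<in> linear_maps R M\<^sub>2 Q"
      and \<Theta>0: "\<And>m. m \<in> M' \<Longrightarrow> \<Theta> m = \<zero>\<^bsub>M\<^esub>" "\<And>m. m \<in> M' \<Longrightarrow> \<upsilon> m = \<zero>\<^bsub>Q\<^esub>"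
      and g\<upsilon>: "\<And>m. m \<in> M'' \<Longrightarrow> g (\<upsilon> m) = f (\<Theta> m)" using \<Theta> by (auto simp: liftable_def)
    note \<Theta>D = linear_mapsD[OF \<Theta>l(1), simplified] and \<upsilon>D = linear_mapsD[OF \<Theta>l(2), simplified]
    define \<eta>' where "\<eta>' m = \<eta> m \<ominus>\<^bsub>M\<^esub> \<Theta> (\<eta> m)" for m
    define \<tau>' where "\<tau>' m = \<tau> m \<oplus>\<^bsub>Q\<^esub> \<upsilon> (\<eta> m)" for m
    have c: "\<eta> m \<in> M''" "\<eta> m \<in> carrier M" "\<Theta> (\<eta> m) \<in> M''" "\<Theta> (\<eta> m) \<in> carrier M" "\<tau> m \<in> carrier Q"
      "\<upsilon> (\<eta> m) \<in> carrier Q" "f (\<eta> m) \<in> carrier B" "f (\<Theta> (\<eta> m)) \<in> carrier B" "g (\<tau> m) \<in> carrier B"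
      if "m \<in> M''" for m
      using that \<eta>D(1) \<Theta>D(1) \<tau>D(1) \<upsilon>D(1) M''_carrier fD(1) gD(1) by simp_all
    have \<eta>': "\<eta>' \<in> linear_maps R M\<^sub>2 M\<^sub>2"
    proof (rule linear_mapsI; simp)
      fix m assume m: "m \<in> M''"
      show "\<eta>' m \<in> M''" unfolding \<eta>'_def by (rule submodule_minus_closed[OF M M'' c(1,3)[OF m]])
      show "\<eta>' (r \<odot>\<^bsub>M\<^esub> m) = r \<odot>\<^bsub>M\<^esub> \<eta>' m" if "r \<in> carrier R" for r
        using m that c[OF m] by (simp add: \<eta>'_def \<eta>D \<Theta>D a_minus_def M.smult_r_distr M.smult_r_minus)
      show "\<eta>' (m \<oplus>\<^bsub>M\<^esub> m') = \<eta>' m \<oplus>\<^bsub>M\<^esub> \<eta>' m'" if m': "m' \<in> M''" for m'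
        using m m' c[OF m] c[OF m']
        by (simp add: \<eta>'_def \<eta>D \<Theta>D a_minus_def M.M.minus_add M.M.a_ac)
    qed
    have \<tau>': "\<tau>' \<in> linear_maps R M\<^sub>2 Q"
    proof (rule linear_mapsI; simp)
      fix m assume m: "m \<in> M''"
      show "\<tau>' m \<in> carrier Q" using c[OF m] by (simp add: \<tau>'_def)
      show "\<tau>' (r \<odot>\<^bsub>M\<^esub> m) = r \<odot>\<^bsub>Q\<^esub> \<tau>' m" if "r \<in> carrier R" for r
        using m that c[OF m] by (simp add: \<tau>'_def \<eta>D \<tau>D \<upsilon>D Q.smult_r_distr)
      show "\<tau>' (m \<oplus>\<^bsub>M\<^esub> m') = \<tau>' m \<oplus>\<^bsub>Q\<^esub> \<tau>' m'" if m': "m' \<in> M''" for m'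
        using m m' c[OF m] c[OF m'] by (simp add: \<tau>'_def \<eta>D \<tau>D \<upsilon>D Q.M.a_ac)
    qed
    have M'c: "m \<in> carrier M" if "m \<in> M'" for m using that M'_M'' M''_carrier by blast
    have gf': "g (\<tau>' m) \<oplus>\<^bsub>B\<^esub> f (\<eta>' m) = f m" if m: "m \<in> M''" for m
    proof -
      have "f (\<eta>' m) = f (\<eta> m) \<ominus>\<^bsub>B\<^esub> f (\<Theta> (\<eta> m))"
        unfolding \<eta>'_def by (rule linear_maps_minus[OF M B f c(2,4)[OF m]])
      moreover have "g (\<tau>' m) = g (\<tau> m) \<oplus>\<^bsub>B\<^esub> f (\<Theta> (\<eta> m))"
        unfolding \<tau>'_def using gD(2)[OF c(5,6)[OF m]] g\<upsilon>[OF c(1)[OF m]] by simp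
      ultimately show ?thesis
        using c[OF m] gf[OF m] by (simp add: a_minus_def B.M.a_ac B.M.r_neg B.M.r_neg1 B.M.r_neg2)
    qed
    have zero: "p \<ominus>\<^bsub>M\<^esub> \<zero>\<^bsub>M\<^esub> = p" if "p \<in> carrier M" for p
      using that M.M.r_neg[of "\<zero>\<^bsub>M\<^esub>"] by (simp add: a_minus_def)
    have "P (\<eta>', \<tau>')"
      unfolding P_def using \<eta>' \<tau>' gf' M'id \<Theta>0 M'c by (simp add: \<eta>'_def \<tau>'_def zero)
    moreover have "\<eta>' (x n) \<in> M'"
    proof -
      have "\<eta>' (x n) = d"
        using d(2) c[OF x, of n] M'c[OF d(1)] unfolding \<eta>'_def a_minus_def
        by (metis M.M.a_comm M.M.r_neg1 M.M.a_closed M.M.a_inv_closed)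
      with d(1) show ?thesis by simp
    qed
    moreover have "\<eta>' m = \<eta> m \<and> \<tau>' m = \<tau> m" if "m \<in> M''" "\<eta> m \<in> M'" for m
      using that c[OF that(1)] \<Theta>0 by (simp add: \<eta>'_def \<tau>'_def zero)
    ultimately show "\<exists>s'. P s' \<and> (fst s' (x n) \<in> M' \<and>
      (\<forall>m\<in>M''. fst s m \<in> M' \<longrightarrow> fst s' m = fst s m \<and> snd s' m = snd s m))"
      by (intro exI[of _ "(\<eta>', \<tau>')"]) (simp add: s)
  qed
  then obtain s where sP: "\<And>n. P (s n)" and sx: "\<And>n. fst (s (Suc n)) (x n) \<in> M'"
    and sS: "\<And>n m. m \<in> M'' \<Longrightarrow> fst (s n) m \<in> M' \<Longrightarrow>
      fst (s (Suc n)) m = fst (s n) m \<and> snd (s (Suc n)) m = snd (s n) m" by blast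
  define \<eta> where "\<eta> n = fst (s n)" for n
  define \<tau> where "\<tau> n = snd (s n)" for n
  have \<eta>: "\<eta> n \<in> linear_maps R M\<^sub>2 M\<^sub>2" and \<tau>: "\<tau> n \<in> linear_maps R M\<^sub>2 Q"
    and M'id: "m \<in> M' \<Longrightarrow> \<eta> n m = m" "m \<in> M' \<Longrightarrow> \<tau> n m = \<zero>\<^bsub>Q\<^esub>"
    and gf: "m \<in> M'' \<Longrightarrow> g (\<tau> n m) \<oplus>\<^bsub>B\<^esub> f (\<eta> n m) = f m" for n m
    using sP[of n] by (auto simp: P_def \<eta>_def \<tau>_def split: prod.splits)
  note \<eta>D = linear_mapsD[OF \<eta>, simplified] and \<tau>D = linear_mapsD[OF \<tau>, simplified]
  have stable: "\<eta> n m = \<eta> k m \<and> \<tau> n m = \<tau> k m" if "k \<le> n" "m \<in> M''" "\<eta> k m \<in> M'" for n k m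
    using that
  proof (induction n rule: dec_induct)
    case (step n)
    then show ?case using sS[of m n] by (auto simp: \<eta>_def \<tau>_def)
  qed simp
  (* Once eta n m is in M', it is no longer changed, and the lift of f at m can be read off. *)
  define val where "val m a \<longleftrightarrow> (\<exists>k. \<forall>n\<ge>k. \<eta> n m \<in> M' \<and> a = t (\<eta> n m) \<oplus>\<^bsub>Q\<^esub> \<tau> n m)" for m a
  have valI: "val m (t (\<eta> k m) \<oplus>\<^bsub>Q\<^esub> \<tau> k m)" if "m \<in> M''" "\<eta> k m \<in> M'" for m k
    unfolding val_def by (intro exI[of _ k]) (use stable that in auto)
  have val_unique: "a = b" if "val m a" "val m b" for m a b
  proof -
    obtain k k' where "\<And>n. n \<ge> k \<Longrightarrow> a = t (\<eta> n m) \<oplus>\<^bsub>Q\<^esub> \<tau> n m" "\<And>n. n \<ge> k' \<Longrightarrow> b = t (\<eta> n m) \<oplus>\<^bsub>Q\<^esub> \<tau> n m"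
      using \<open>val m a\<close> \<open>val m b\<close> unfolding val_def by blast
    from this(1)[of "max k k'"] this(2)[of "max k k'"] show ?thesis by simp
  qed
  have val_add: "val (m \<oplus>\<^bsub>M\<^esub> m') (a \<oplus>\<^bsub>Q\<^esub> b)" if "val m a" "val m' b" "m \<in> M''" "m' \<in> M''" for m m' a b
  proof -
    obtain k k' where k: "\<And>n. n \<ge> k \<Longrightarrow> \<eta> n m \<in> M' \<and> a = t (\<eta> n m) \<oplus>\<^bsub>Q\<^esub> \<tau> n m"
      and k': "\<And>n. n \<ge> k' \<Longrightarrow> \<eta> n m' \<in> M' \<and> b = t (\<eta> n m') \<oplus>\<^bsub>Q\<^esub> \<tau> n m'"
      using \<open>val m a\<close> \<open>val m' b\<close> unfolding val_def by blast
    have "\<eta> n (m \<oplus>\<^bsub>M\<^esub> m') \<in> M' \<and> a \<oplus>\<^bsub>Q\<^esub> b = t (\<eta> n (m \<oplus>\<^bsub>M\<^esub> m')) \<oplus>\<^bsub>Q\<^esub> \<tau> n (m \<oplus>\<^bsub>M\<^esub> m')" if n: "n \<ge> max k k'" for n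
    proof -
      have *: "\<eta> n m \<in> M'" "a = t (\<eta> n m) \<oplus>\<^bsub>Q\<^esub> \<tau> n m" "\<eta> n m' \<in> M'" "b = t (\<eta> n m') \<oplus>\<^bsub>Q\<^esub> \<tau> n m'"
        using k[of n] k'[of n] n by auto
      show ?thesis
        unfolding *(2,4) using *(1,3) that \<open>m \<in> M''\<close> \<open>m' \<in> M''\<close>
        by (simp add: \<eta>D \<tau>D tD M'D Q.M.a_ac)
    qed
    then show ?thesis unfolding val_def by blast
  qed
  have val_smult: "val (r \<odot>\<^bsub>M\<^esub> m) (r \<odot>\<^bsub>Q\<^esub> a)" if "val m a" "m \<in> M''" "r \<in> carrier R" for m a r
  proof -
    obtain k where k: "\<And>n. n \<ge> k \<Longrightarrow> \<eta> n m \<in> M' \<and> a = t (\<eta> n m) \<oplus>\<^bsub>Q\<^esub> \<tau> n m"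
      using \<open>val m a\<close> unfolding val_def by blast
    have "\<eta> n (r \<odot>\<^bsub>M\<^esub> m) \<in> M' \<and> r \<odot>\<^bsub>Q\<^esub> a = t (\<eta> n (r \<odot>\<^bsub>M\<^esub> m)) \<oplus>\<^bsub>Q\<^esub> \<tau> n (r \<odot>\<^bsub>M\<^esub> m)" if n: "n \<ge> k" for n
    proof -
      have *: "\<eta> n m \<in> M'" "a = t (\<eta> n m) \<oplus>\<^bsub>Q\<^esub> \<tau> n m" using k[of n] n by auto
      show ?thesis
        unfolding *(2) using *(1) \<open>r \<in> carrier R\<close> \<open>m \<in> M''\<close>
        by (simp add: \<eta>D \<tau>D tD M'D Q.smult_r_distr)
    qed
    then show ?thesis unfolding val_def by blast
  qed
  have val_M': "val m (t m)" if "m \<in> M'" for m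
    using valI[of m 0] that M'id[OF that] M'_M''[OF that] tD(1)[OF that] by simp
  have "submodule {m \<in> M''. \<exists>a. val m a} R M"
  proof (rule submoduleI_smult[OF M])
    show "{m \<in> M''. \<exists>a. val m a} \<subseteq> carrier M" using M''M by auto
    show "\<zero>\<^bsub>M\<^esub> \<in> {m \<in> M''. \<exists>a. val m a}" using val_M'[OF M'0] M''0 by auto
  qed (use val_add val_smult M''D in blast)+
  then have "M'' \<subseteq> {m \<in> M''. \<exists>a. val m a}"
  proof (rule generated)
    show "M' \<subseteq> {m \<in> M''. \<exists>a. val m a}" using val_M' M'M'' by blast
    have "val (x i) (t (\<eta> (Suc i) (x i)) \<oplus>\<^bsub>Q\<^esub> \<tau> (Suc i) (x i))" for i
      by (rule valI[OF x]) (simp add: \<eta>_def sx)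
    then show "range x \<subseteq> {m \<in> M''. \<exists>a. val m a}" using x by blast
  qed
  then have ex: "\<exists>a. val m a" if "m \<in> M''" for m using that by blast
  define t' where "t' m = (SOME a. val m a)" for m
  have t': "val m (t' m)" if "m \<in> M''" for m unfolding t'_def by (rule someI_ex[OF ex[OF that]])
  have t'eq: "t' m = a" if "m \<in> M''" "val m a" for m a by (rule val_unique[OF t'[OF that(1)] that(2)])
  have t'val: "\<exists>n. \<eta> n m \<in> M' \<and> t' m = t (\<eta> n m) \<oplus>\<^bsub>Q\<^esub> \<tau> n m" if "m \<in> M''" for m
    using t'[OF that] unfolding val_def by blast
  have "t' \<in> linear_maps R M\<^sub>2 Q"
  proof (rule linear_mapsI; simp)
    fix m assume m: "m \<in> M''"
    then show "t' m \<in> carrier Q" using t'val[OF m] tD(1) \<tau>D(1)[OF m] by auto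
    show "t' (r \<odot>\<^bsub>M\<^esub> m) = r \<odot>\<^bsub>Q\<^esub> t' m" if "r \<in> carrier R" for r
      using m that by (intro t'eq val_smult t' M''D(1)) auto
    show "t' (m \<oplus>\<^bsub>M\<^esub> m') = t' m \<oplus>\<^bsub>Q\<^esub> t' m'" if "m' \<in> M''" for m'
      using m that by (intro t'eq val_add t' M''D(2)) auto
  qed
  moreover have "g (t' m) = f m" if m: "m \<in> M''" for m
  proof -
    obtain n where n: "\<eta> n m \<in> M'" "t' m = t (\<eta> n m) \<oplus>\<^bsub>Q\<^esub> \<tau> n m" using t'val[OF m] by blast
    have "g (t' m) = f (\<eta> n m) \<oplus>\<^bsub>B\<^esub> g (\<tau> n m)"
      unfolding n(2) gD(2)[OF tD(1)[OF n(1)] \<tau>D(1)[OF m]] using t_lifts[OF n(1)] by simp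
    also have "\<dots> = f m"
      using gf[OF m, of n] fD(1)[OF M''_carrier[OF \<eta>D(1)[OF m, of n]]] gD(1)[OF \<tau>D(1)[OF m, of n]]
      by (simp add: B.M.a_comm)
    finally show ?thesis .
  qed
  moreover have "\<forall>m\<in>M'. t' m = t m"
    using val_M' M'_M'' by (intro ballI t'eq) auto
  ultimately show ?thesis by blast
qed

end

section \<open>Devissage\<close>

text \<open>The section \<open>s\<close> of the free cover of \<open>S \<otimes> M\<close> by its elements makes \<open>S \<otimes> M\<close> projective, and \<open>s n k\<close> is
  the coordinate of \<open>n\<close> at the generator \<open>k\<close>.\<close>

locale split_base_change = faithfully_flat_ring_change R S h
  for R :: "('r, 'c) ring_scheme" and S :: "('s, 'd) ring_scheme" and h :: "'r \<Rightarrow> 's" +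
  fixes M :: "('r, 'm, 'e) module_scheme"
    and s :: "('s \<times> 'm \<Rightarrow>\<^sub>0 int) set \<Rightarrow> (('s \<times> 'm \<Rightarrow>\<^sub>0 int) set \<Rightarrow> 's)"
  assumes M: "module R M"
    and s: "s \<in> linear_maps S (bc M) (free_module S (carrier (bc M)))"
    and s_section: "n \<in> carrier (bc M) \<Longrightarrow> lincomb S (bc M) (\<lambda>k. k) (s n) = n"
begin

sublocale M: module R M by (rule M)
sublocale N: module S "bc M" by (rule bc_module[OF M])

lemmas sD = linear_mapsD[OF s, simplified free_module_simps, simplified]

lemma s_closed: "n \<in> carrier (bc M) \<Longrightarrow> s n k \<in> carrier S"
  using linear_mapsD(1)[OF s, of n] by (auto simp: free_module_simps)

lemma s_zero: "s \<zero>\<^bsub>bc M\<^esub> = (\<lambda>_. \<zero>\<^bsub>S\<^esub>)"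
  using linear_maps_zero[OF s bc_module[OF M] free_module_module[OF S.is_cring]] by (simp add: free_module_simps(3))

definition supported :: "('s \<times> 'm \<Rightarrow>\<^sub>0 int) set set \<Rightarrow> ('s \<times> 'm \<Rightarrow>\<^sub>0 int) set set" where
  "supported J = {n \<in> carrier (bc M). \<forall>k. s n k \<noteq> \<zero>\<^bsub>S\<^esub> \<longrightarrow> k \<in> J}"

definition part :: "('s \<times> 'm \<Rightarrow>\<^sub>0 int) set set \<Rightarrow> 'm set" where
  "part J = {m \<in> carrier M. iota M m \<in> supported J}"

text \<open>By the first condition the generators in \<open>J\<close> have coordinates in \<open>J\<close>, so that \<open>supported J\<close> is their
  span and is a direct summand of \<open>S \<otimes> M\<close>, with complementary coordinates \<open>outside J\<close>. By the second
  one this summand is the base change of \<open>part J\<close>.\<close>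

definition splits :: "('s \<times> 'm \<Rightarrow>\<^sub>0 int) set set \<Rightarrow> bool" where
  "splits J \<longleftrightarrow> J \<subseteq> supported J \<and> J \<subseteq> bc_span M (part J)"

lemma supported_submodule: "submodule (supported J) S (bc M)"
proof (rule submoduleI_smult[OF bc_module[OF M]])
  fix a b assume a: "a \<in> supported J" and b: "b \<in> supported J"
  have "s (a \<oplus>\<^bsub>bc M\<^esub> b) k = s a k \<oplus>\<^bsub>S\<^esub> s b k" for k
    using a b by (simp add: supported_def sD)
  moreover have "s a k \<oplus>\<^bsub>S\<^esub> s b k = \<zero>\<^bsub>S\<^esub>" if "k \<notin> J" for k
  proof -
    have "s a k = \<zero>\<^bsub>S\<^esub>" "s b k = \<zero>\<^bsub>S\<^esub>" using a b that by (auto simp: supported_def)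
    then show ?thesis by simp
  qed
  ultimately show "a \<oplus>\<^bsub>bc M\<^esub> b \<in> supported J"
    using a b by (auto simp: supported_def)
next
  fix r a assume r: "r \<in> carrier S" and a: "a \<in> supported J"
  have "s (r \<odot>\<^bsub>bc M\<^esub> a) k = r \<otimes>\<^bsub>S\<^esub> s a k" for k
    using a r by (simp add: supported_def sD)
  moreover have "r \<otimes>\<^bsub>S\<^esub> s a k = \<zero>\<^bsub>S\<^esub>" if "k \<notin> J" for k
  proof -
    have "s a k = \<zero>\<^bsub>S\<^esub>" using a that by (auto simp: supported_def)
    then show ?thesis using r by simp
  qed
  ultimately show "r \<odot>\<^bsub>bc M\<^esub> a \<in> supported J"
    using a r by (auto simp: supported_def)
qed (auto simp: supported_def s_zero)

lemma part_submodule: "submodule (part J) R M"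
  unfolding part_def by (rule iota_preimage_submodule[OF M supported_submodule])

lemma part_closed: "part J \<subseteq> carrier M" by (auto simp: part_def)

lemma supported_mono: "J \<subseteq> J' \<Longrightarrow> supported J \<subseteq> supported J'" by (auto simp: supported_def)

lemma part_mono: "J \<subseteq> J' \<Longrightarrow> part J \<subseteq> part J'" using supported_mono by (auto simp: part_def)

lemma lincomb_mem:
  assumes W: "submodule W S (bc M)" and c: "c \<in> carrier (free_module S (carrier (bc M)))"
    and k: "\<And>k. c k \<noteq> \<zero>\<^bsub>S\<^esub> \<Longrightarrow> k \<in> W"
  shows "lincomb S (bc M) (\<lambda>k. k) c \<in> W"
proof -
  have "c k \<in> carrier S" for k using c by (auto simp: free_module_simps)
  then show ?thesis
    unfolding lincomb_def using k N.submoduleE(4)[OF W]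
    by (intro submodule_finsum_closed[OF bc_module[OF M] W]) auto
qed

lemma mem_of_support:
  assumes W: "submodule W S (bc M)" and n: "n \<in> supported J" and J: "J \<subseteq> W"
  shows "n \<in> W"
proof -
  have nN: "n \<in> carrier (bc M)" using n by (simp add: supported_def)
  have "lincomb S (bc M) (\<lambda>k. k) (s n) \<in> W"
    by (rule lincomb_mem[OF W linear_mapsD(1)[OF s nN]]) (use n J in \<open>auto simp: supported_def\<close>)
  then show ?thesis by (simp add: s_section[OF nN])
qed

lemma part_empty: "part {} = {\<zero>\<^bsub>M\<^esub>}"
proof
  have "m = \<zero>\<^bsub>M\<^esub>" if m: "m \<in> part {}" for m
  proof -
    have mM: "m \<in> carrier M" using m by (simp add: part_def)
    note Z = bc_span_submodule[OF M, of "{\<zero>\<^bsub>M\<^esub>}"]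
    have "iota M m \<in> bc_span M {\<zero>\<^bsub>M\<^esub>}"
      by (rule mem_of_support[OF Z]) (use m in \<open>auto simp: part_def\<close>)
    then show ?thesis using descend_membership[OF M zero_submodule[OF M] mM] by simp
  qed
  then show "part {} \<subseteq> {\<zero>\<^bsub>M\<^esub>}" by blast
  show "{\<zero>\<^bsub>M\<^esub>} \<subseteq> part {}" using submodule_zero_closed[OF part_submodule] by blast
qed

definition outside :: "('s \<times> 'm \<Rightarrow>\<^sub>0 int) set set \<Rightarrow> ('s \<times> 'm \<Rightarrow>\<^sub>0 int) set \<Rightarrow> ('s \<times> 'm \<Rightarrow>\<^sub>0 int) set \<Rightarrow> 's" where
  "outside J n = (\<lambda>k. if k \<in> J then \<zero>\<^bsub>S\<^esub> else s n k)"

lemma splits_relative_dual_basis: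
  assumes J: "splits J"
  shows "relative_dual_basis R S h M (supported J) (carrier (bc M) - J) (outside J)"
proof (rule relative_dual_basis.intro[OF faithfully_flat_ring_change_axioms relative_dual_basis_axioms.intro])
  have JS: "J \<subseteq> supported J" and Jspan: "J \<subseteq> bc_span M (part J)" using J by (auto simp: splits_def)
  show "module R M" by (rule M)
  show "submodule (supported J) S (bc M)" by (rule supported_submodule)
  show "supported J \<subseteq> bc_span M {m \<in> carrier M. iota M m \<in> supported J}"
    using mem_of_support[OF bc_span_submodule[OF M part_closed] _ Jspan] by (auto simp: part_def)
  have cutF: "outside J n \<in> carrier (free_module S (carrier (bc M) - J))" if n: "n \<in> carrier (bc M)" for n
  proof -
    have f: "finite {k. s n k \<noteq> \<zero>\<^bsub>S\<^esub>}" "{k. s n k \<noteq> \<zero>\<^bsub>S\<^esub>} \<subseteq> carrier (bc M)"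
      using linear_mapsD(1)[OF s n] by (auto simp: free_module_simps)
    have "{k. outside J n k \<noteq> \<zero>\<^bsub>S\<^esub>} = {k. s n k \<noteq> \<zero>\<^bsub>S\<^esub>} - J" by (auto simp: outside_def)
    moreover have "range (outside J n) \<subseteq> carrier S" using s_closed[OF n] by (auto simp: outside_def)
    ultimately show ?thesis using f unfolding free_module_simps(1) by auto
  qed
  show "outside J \<in> linear_maps S (bc M) (free_module S (carrier (bc M) - J))"
    by (rule linear_mapsI[OF cutF]) (auto simp: free_module_simps(2,4) outside_def sD fun_eq_iff)
  show "outside J n = \<zero>\<^bsub>free_module S (carrier (bc M) - J)\<^esub>" if "n \<in> supported J" for n
    using that by (auto simp: outside_def supported_def free_module_simps(3) fun_eq_iff)
  fix n assume n: "n \<in> carrier (bc M)"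
  let ?F = "free_module S (carrier (bc M))" and ?l = "lincomb S (bc M) (\<lambda>k. k)"
  define c where "c = (\<lambda>k. if k \<in> J then s n k else \<zero>\<^bsub>S\<^esub>)"
  have c: "c \<in> carrier ?F"
  proof -
    have f: "finite {k. s n k \<noteq> \<zero>\<^bsub>S\<^esub>}" "{k. s n k \<noteq> \<zero>\<^bsub>S\<^esub>} \<subseteq> carrier (bc M)"
      using linear_mapsD(1)[OF s n] by (auto simp: free_module_simps)
    have "{k. c k \<noteq> \<zero>\<^bsub>S\<^esub>} = {k. s n k \<noteq> \<zero>\<^bsub>S\<^esub>} \<inter> J" by (auto simp: c_def)
    moreover have "range c \<subseteq> carrier S" using s_closed[OF n] by (auto simp: c_def)
    ultimately show ?thesis using f unfolding free_module_simps(1) by auto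
  qed
  have c': "outside J n \<in> carrier ?F" using cutF[OF n] free_module_mono[of "carrier (bc M) - J" "carrier (bc M)" S] by auto
  have "s n = c \<oplus>\<^bsub>?F\<^esub> outside J n"
    using s_closed[OF n] by (auto simp: free_module_simps(2) c_def outside_def fun_eq_iff)
  note lin = lincomb_linear[OF bc_module[OF M], of "carrier (bc M)" "\<lambda>k. k"]
  have n_eq: "n = ?l c \<oplus>\<^bsub>bc M\<^esub> ?l (outside J n)"
    using s_section[OF n] \<open>s n = _\<close> linear_mapsD(2)[OF lin c c'] by simp
  have "(?l c \<oplus>\<^bsub>bc M\<^esub> ?l (outside J n)) \<ominus>\<^bsub>bc M\<^esub> ?l (outside J n) = ?l c"
    using linear_mapsD(1)[OF lin c] linear_mapsD(1)[OF lin c'] by (simp add: a_minus_def N.M.a_assoc N.M.r_neg)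
  then have "n \<ominus>\<^bsub>bc M\<^esub> ?l (outside J n) = ?l c" unfolding n_eq[symmetric] .
  moreover have "?l c \<in> supported J"
    by (rule lincomb_mem[OF supported_submodule c]) (use JS in \<open>auto simp: c_def split: if_splits\<close>)
  ultimately show "n \<ominus>\<^bsub>bc M\<^esub> ?l (outside J n) \<in> supported J" by simp
qed auto

text \<open>Add to \<open>J\<close> the smallest set \<open>C\<close> of generators which contains the image of \<open>p\<close> and, with each
  generator \<open>j\<close>, the support of its coordinates and the images of finitely many elements \<open>f j\<close> of \<open>M\<close>
  that span \<open>j\<close>. Each generator requires only finitely many others, so \<open>C\<close> is countable.\<close>

lemma splits_extend:
  assumes J: "splits J" and p: "p \<in> carrier M"
  shows "\<exists>J' (x :: nat \<Rightarrow> 'm). splits J' \<and> J \<subseteq> J' \<and> p \<in> part J' \<and> (\<forall>i. x i \<in> part J') \<and>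
    (\<forall>L. submodule L R M \<longrightarrow> part J \<subseteq> L \<longrightarrow> range x \<subseteq> L \<longrightarrow> part J' \<subseteq> L)"
proof -
  have "\<exists>f. \<forall>j\<in>carrier (bc M). finite (f j) \<and> f j \<subseteq> carrier M \<and> j \<in> bc_span M (f j)"
  proof (intro bchoice ballI)
    fix j assume "j \<in> carrier (bc M)"
    then obtain z where z: "z \<in> frags (carrier M)" "j = cls M z" unfolding carrier_bc by (rule bc_spanE)
    have "z \<in> frags (snd ` Poly_Mapping.keys z)" using z(1) by force
    then have "j \<in> bc_span M (snd ` Poly_Mapping.keys z)" unfolding z(2) by (rule cls_in_span)
    with z(1) show "\<exists>X. finite X \<and> X \<subseteq> carrier M \<and> j \<in> bc_span M X"
      by (intro exI[of _ "snd ` Poly_Mapping.keys z"]) auto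
  qed
  then obtain f where f: "\<And>j. j \<in> carrier (bc M) \<Longrightarrow> finite (f j)"
    "\<And>j. j \<in> carrier (bc M) \<Longrightarrow> f j \<subseteq> carrier M" "\<And>j. j \<in> carrier (bc M) \<Longrightarrow> j \<in> bc_span M (f j)" by blast
  define E where "E = {(j, k). j \<in> carrier (bc M) \<and> k \<in> carrier (bc M) \<and> (s j k \<noteq> \<zero>\<^bsub>S\<^esub> \<or> k \<in> iota M ` f j)}"
  define C where "C = E\<^sup>* `` {iota M p}"
  have ip: "iota M p \<in> carrier (bc M)" by (rule iota_closed[OF p])
  have C_closed: "k \<in> C" if "j \<in> C" "(j, k) \<in> E" for j k
    using that unfolding C_def by (auto intro: rtrancl_into_rtrancl)
  have CN: "C \<subseteq> carrier (bc M)"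
  proof
    fix k assume "k \<in> C"
    then have "(iota M p, k) \<in> E\<^sup>*" by (simp add: C_def)
    then show "k \<in> carrier (bc M)" by (cases rule: rtranclE) (use ip in \<open>auto simp: E_def\<close>)
  qed
  have supp: "finite {k. s j k \<noteq> \<zero>\<^bsub>S\<^esub>}" "{k. s j k \<noteq> \<zero>\<^bsub>S\<^esub>} \<subseteq> carrier (bc M)" if "j \<in> carrier (bc M)" for j
    using linear_mapsD(1)[OF s that] by (auto simp: free_module_simps)
  have "countable (E `` Y)" if "countable Y" for Y
  proof -
    have "E `` {j} \<subseteq> {k. j \<in> carrier (bc M) \<and> s j k \<noteq> \<zero>\<^bsub>S\<^esub>} \<union> (if j \<in> carrier (bc M) then iota M ` f j else {})" for j
      by (auto simp: E_def)
    moreover have "finite ({k. j \<in> carrier (bc M) \<and> s j k \<noteq> \<zero>\<^bsub>S\<^esub>} \<union> (if j \<in> carrier (bc M) then iota M ` f j else {}))" for j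
      using supp(1) f(1) by (cases "j \<in> carrier (bc M)") auto
    ultimately have "countable (E `` {j})" for j by (rule countable_finite[OF finite_subset])
    then have "countable (\<Union>j\<in>Y. E `` {j})" using that by auto
    moreover have "E `` Y = (\<Union>j\<in>Y. E `` {j})" by auto
    ultimately show ?thesis by simp
  qed
  from countable_rtrancl[OF this, of "{iota M p}"] have countC: "countable C" by (simp add: C_def)
  (* Zero is included only to make the set nonempty, so that it can be enumerated. *)
  define X where "X = insert \<zero>\<^bsub>M\<^esub> (\<Union>j\<in>C. f j)"
  have "countable (f j)" if "j \<in> C" for j using f(1) CN that by (intro countable_finite) auto
  then have countX: "countable X" unfolding X_def using countC by simp
  define x where "x = from_nat_into X"
  have x: "range x = X" unfolding x_def by (rule range_from_nat_into) (use countX in \<open>auto simp: X_def\<close>)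
  have iC: "iota M m \<in> C" if "j \<in> C" "m \<in> f j" for j m
  proof (rule C_closed[OF that(1)])
    have "j \<in> carrier (bc M)" using that CN by auto
    then show "(j, iota M m) \<in> E" using that(2) f(2) iota_closed[of m M] by (auto simp: E_def)
  qed
  have C_supported: "C \<subseteq> supported C"
  proof
    fix j assume j: "j \<in> C"
    then have jN: "j \<in> carrier (bc M)" using CN by blast
    have "k \<in> C" if "s j k \<noteq> \<zero>\<^bsub>S\<^esub>" for k
      by (rule C_closed[OF j]) (use that jN supp(2)[OF jN] in \<open>auto simp: E_def\<close>)
    then show "j \<in> supported C" using jN by (simp add: supported_def)
  qed
  define J' where "J' = J \<union> C"
  have JJ': "J \<subseteq> J'" and CJ': "C \<subseteq> J'" by (auto simp: J'_def)
  have fpart: "f j \<subseteq> part J'" if "j \<in> C" for j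
    using iC[OF that] C_supported supported_mono[OF CJ'] f(2)[of j] that CN by (auto simp: part_def)
  have "splits J'"
    unfolding splits_def
  proof
    show "J' \<subseteq> supported J'"
      using J C_supported supported_mono[OF JJ'] supported_mono[OF CJ'] by (auto simp: J'_def splits_def)
    have "C \<subseteq> bc_span M (part J')"
      using f(3) CN bc_span_mono[OF fpart] by blast
    moreover have "J \<subseteq> bc_span M (part J')"
      using J bc_span_mono[OF part_mono[OF JJ']] by (auto simp: splits_def)
    ultimately show "J' \<subseteq> bc_span M (part J')" by (simp add: J'_def)
  qed
  moreover have "p \<in> part J'"
    using p C_supported supported_mono[OF CJ'] by (auto simp: part_def C_def)
  moreover have "x i \<in> part J'" for i
  proof -
    have "x i \<in> X" using x by auto
    then show ?thesis using fpart submodule_zero_closed[OF part_submodule] by (auto simp: X_def)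
  qed
  moreover have "part J' \<subseteq> L" if L: "submodule L R M" "part J \<subseteq> L" "range x \<subseteq> L" for L
  proof
    fix m assume m: "m \<in> part J'"
    have LM: "L \<subseteq> carrier M" by (rule M.submoduleE(1)[OF L(1)])
    have "C \<subseteq> bc_span M L"
    proof
      fix j assume j: "j \<in> C"
      then have "f j \<subseteq> L" using L(3) unfolding x X_def by auto
      with j show "j \<in> bc_span M L" using f(3) CN bc_span_mono by blast
    qed
    moreover have "J \<subseteq> bc_span M L" using J bc_span_mono[OF L(2)] by (auto simp: splits_def)
    ultimately have "iota M m \<in> bc_span M L"
      using m by (intro mem_of_support[OF bc_span_submodule[OF M LM], of _ J']) (auto simp: part_def J'_def)
    then show "m \<in> L" using descend_membership[OF M L(1)] m by (simp add: part_def)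
  qed
  ultimately show ?thesis
    using JJ' by (intro exI[of _ J'] exI[of _ x] conjI allI impI)
qed

text \<open>Coordinates have finite support, which is contained in a single member of the chain.\<close>

lemma part_Union:
  assumes C: "\<C> \<noteq> {}" and chain: "\<And>J J'. J \<in> \<C> \<Longrightarrow> J' \<in> \<C> \<Longrightarrow> J \<subseteq> J' \<or> J' \<subseteq> J" and m: "m \<in> part (\<Union>\<C>)"
  shows "\<exists>J\<in>\<C>. m \<in> part J"
proof -
  have mM: "m \<in> carrier M" and sup: "{k. s (iota M m) k \<noteq> \<zero>\<^bsub>S\<^esub>} \<subseteq> \<Union>\<C>"
    using m by (auto simp: part_def supported_def)
  have "finite {k. s (iota M m) k \<noteq> \<zero>\<^bsub>S\<^esub>}"
    using linear_mapsD(1)[OF s iota_closed[OF mM]] by (simp add: free_module_simps)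
  moreover have "subset.chain UNIV \<C>"
    using chain by (auto simp: subset.chain_def)
  ultimately have "\<exists>J\<in>\<C>. {k. s (iota M m) k \<noteq> \<zero>\<^bsub>S\<^esub>} \<subseteq> J"
    using finite_subset_Union_chain[OF _ sup C] by metis
  then show ?thesis using mM iota_closed by (auto simp: part_def supported_def)
qed

lemma splits_Union:
  assumes "\<And>J. J \<in> \<C> \<Longrightarrow> splits J"
  shows "splits (\<Union>\<C>)"
proof -
  have "J \<subseteq> supported (\<Union>\<C>)" "J \<subseteq> bc_span M (part (\<Union>\<C>))" if "J \<in> \<C>" for J
  proof -
    have J: "J \<subseteq> \<Union>\<C>" using that by blast
    show "J \<subseteq> supported (\<Union>\<C>)"
      using assms[OF that] supported_mono[OF J] unfolding splits_def by (elim conjE) (rule subset_trans)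
    show "J \<subseteq> bc_span M (part (\<Union>\<C>))"
      using assms[OF that] bc_span_mono[OF part_mono[OF J]] unfolding splits_def by (elim conjE) (rule subset_trans)
  qed
  then show ?thesis unfolding splits_def by (intro conjI Sup_least)
qed

end

section \<open>Descent of projectivity\<close>

locale lifting_problem = split_base_change R S h M s
  for R :: "('r, 'c) ring_scheme" and S :: "('s, 'd) ring_scheme" and h :: "'r \<Rightarrow> 's"
    and M :: "('r, 'm, 'e) module_scheme" and s +
  fixes Q :: "('r, 'q, 'x) module_scheme" and B :: "('r, 'b, 'y) module_scheme"
    and g :: "'q \<Rightarrow> 'b" and f :: "'m \<Rightarrow> 'b"
  assumes Q: "module R Q" and B: "module R B"
    and g: "g \<in> linear_maps R Q B" and g_surj: "g ` carrier Q = carrier B"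
    and f: "f \<in> linear_maps R M B"
begin

definition partial_lift :: "('s \<times> 'm \<Rightarrow>\<^sub>0 int) set set \<Rightarrow> ('m \<Rightarrow> 'q) \<Rightarrow> bool" where
  "partial_lift J t \<longleftrightarrow> splits J \<and> t \<in> linear_maps R (M\<lparr>carrier := part J\<rparr>) Q \<and> (\<forall>m\<in>part J. g (t m) = f m)"

lemma partial_lift_cong:
  assumes "partial_lift J t" "\<And>m. m \<in> part J \<Longrightarrow> t m = t' m"
  shows "partial_lift J t'"
proof -
  note E = M.submoduleE(4,5)[OF part_submodule[of J]]
  show ?thesis
    using assms E linear_mapsD[of t R "M\<lparr>carrier := part J\<rparr>" Q]
    by (auto simp: partial_lift_def intro!: linear_mapsI)
qed

lemma partial_lift_extend:
  assumes J: "partial_lift J t" and p: "p \<in> carrier M"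
  shows "\<exists>J' t'. partial_lift J' t' \<and> J \<subseteq> J' \<and> p \<in> part J' \<and> (\<forall>m\<in>part J. t' m = t m)"
proof -
  have splits: "splits J" using J by (simp add: partial_lift_def)
  obtain J' x where J': "splits J'" "J \<subseteq> J'" "p \<in> part J'" "\<And>i :: nat. x i \<in> part J'"
    "\<And>L. submodule L R M \<Longrightarrow> part J \<subseteq> L \<Longrightarrow> range x \<subseteq> L \<Longrightarrow> part J' \<subseteq> L"
    using splits_extend[OF splits p] by metis
  interpret rel: relative_dual_basis R S h M "supported J" "carrier (bc M) - J" "outside J"
    by (rule splits_relative_dual_basis[OF splits])
  have M': "rel.M' = part J" by (simp add: rel.M'_def part_def)
  interpret countably_generated_lifting R S h M "supported J" "carrier (bc M) - J" "outside J" "part J'" x Q B g f t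
  proof (rule countably_generated_lifting.intro[OF countably_generated_extension.intro[OF
        rel.relative_dual_basis_axioms countably_generated_extension_axioms.intro]
        countably_generated_lifting_axioms.intro], unfold M')
    show "submodule (part J') R M" by (rule part_submodule)
    show "part J \<subseteq> part J'" by (rule part_mono[OF J'(2)])
    show "k \<in> bc_span M (part J')" if "q \<in> part J'" "outside J (iota M q) k \<noteq> \<zero>\<^bsub>S\<^esub>" for q k
    proof -
      have "k \<in> J'" using that by (auto simp: outside_def part_def supported_def split: if_splits)
      then show ?thesis using J'(1) by (auto simp: splits_def)
    qed
    show "t \<in> linear_maps R (M\<lparr>carrier := part J\<rparr>) Q" "\<And>m. m \<in> part J \<Longrightarrow> g (t m) = f m"
      using J by (auto simp: partial_lift_def)
  qed (use J'(4,5) Q B g g_surj f in blast)+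
  show ?thesis
    using lift_extends J' unfolding M' partial_lift_def by blast
qed

text \<open>Partial lifts are ordered by extension, and chains have unions; a partial lift that is
  maximal is defined everywhere.\<close>

theorem lift_exists: "\<exists>t\<in>linear_maps R M Q. \<forall>m\<in>carrier M. g (t m) = f m"
proof -
  interpret Q: module R Q by (rule Q)
  define ext where "ext = (\<lambda>(J, t) (J', t'). J \<subseteq> J' \<and> (\<forall>m\<in>part J. t' m = (t m :: 'q)))"
  (* Values outside the domain are fixed, as otherwise extension would not be antisymmetric. *)
  define lifts where "lifts = {(J, t). partial_lift J t \<and> t \<in> extensional (part J)}"
  have restrict_lift: "(J, restrict t (part J)) \<in> lifts" if "partial_lift J t" for J t
    using partial_lift_cong[OF that, of "restrict t (part J)"] by (simp add: lifts_def)
  have po: "partial_order_on lifts (relation_of ext lifts)"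
  proof (rule partial_order_on_relation_ofI)
    fix a b c assume "ext a b" "ext b c"
    then show "ext a c"
      using part_mono[of "fst a" "fst b"] by (cases a, cases b, cases c) (auto simp: ext_def)
  next
    fix a b assume ab: "a \<in> lifts" "b \<in> lifts" "ext a b" "ext b a"
    obtain J t J' t' where a: "a = (J, t)" and b: "b = (J', t')" by (cases a, cases b)
    have "J = J'" using ab by (auto simp: ext_def a b)
    moreover have "t = t'"
      by (rule extensionalityI[of _ "part J"]) (use ab \<open>J = J'\<close> in \<open>auto simp: ext_def lifts_def a b\<close>)
    ultimately show "a = b" by (simp add: a b)
  qed (auto simp: ext_def)
  have "\<exists>u\<in>lifts. \<forall>a\<in>\<C>. ext a u" if \<C>: "\<C> \<in> Chains (relation_of ext lifts)" for \<C>
  proof (cases "\<C> = {}")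
    case True
    (* The zero map on the zero module bounds the empty chain. *)
    have "partial_lift {} (\<lambda>_. \<zero>\<^bsub>Q\<^esub>)"
      unfolding partial_lift_def part_empty
      using linear_maps_zero[OF g Q B] linear_maps_zero[OF f M B]
      by (auto simp: splits_def intro!: linear_mapsI)
    from restrict_lift[OF this] True show ?thesis by blast
  next
    case False
    have \<C>l: "\<C> \<subseteq> lifts" and tot: "\<And>a b. a \<in> \<C> \<Longrightarrow> b \<in> \<C> \<Longrightarrow> ext a b \<or> ext b a"
      using \<C> by (auto simp: Chains_def relation_of_def)
    have lift: "partial_lift J t" if "(J, t) \<in> \<C>" for J t using \<C>l that by (auto simp: lifts_def)
    define U where "U = \<Union>(fst ` \<C>)"
    have agree: "t m = t' m" if "(J, t) \<in> \<C>" "(J', t') \<in> \<C>" "m \<in> part J" "m \<in> part J'" for J t J' t' m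
      using tot[OF that(1,2)] that(3,4) by (auto simp: ext_def)
    have cover: "\<exists>J t. (J, t) \<in> \<C> \<and> m \<in> part J" if "m \<in> part U" for m
    proof -
      have "\<exists>J\<in>fst ` \<C>. m \<in> part J"
      proof (rule part_Union)
        fix J J' assume "J \<in> fst ` \<C>" "J' \<in> fst ` \<C>"
        then show "J \<subseteq> J' \<or> J' \<subseteq> J" using tot by (fastforce simp: ext_def)
      qed (use False that in \<open>auto simp: U_def\<close>)
      then show ?thesis by force
    qed
    have sub: "J \<subseteq> U" "part J \<subseteq> part U" if "(J, t) \<in> \<C>" for J t
    proof -
      show "J \<subseteq> U" using that by (force simp: U_def)
      then show "part J \<subseteq> part U" by (rule part_mono)
    qed
    define tU where "tU m = (SOME q. \<exists>J t. (J, t) \<in> \<C> \<and> m \<in> part J \<and> q = t m)" for m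
    have tU: "tU m = t m" if "(J, t) \<in> \<C>" "m \<in> part J" for J t m
    proof -
      have "\<exists>J t. (J, t) \<in> \<C> \<and> m \<in> part J \<and> tU m = t m"
        unfolding tU_def by (rule someI[of _ "t m"]) (use that in blast)
      then show ?thesis using agree[OF that(1) _ that(2)] by metis
    qed
    have cover2: "\<exists>J t. (J, t) \<in> \<C> \<and> m \<in> part J \<and> m' \<in> part J" if m: "m \<in> part U" "m' \<in> part U" for m m'
    proof -
      obtain J t J' t' where J: "(J, t) \<in> \<C>" "m \<in> part J" "(J', t') \<in> \<C>" "m' \<in> part J'"
        using cover[OF m(1)] cover[OF m(2)] by blast
      have "J \<subseteq> J' \<or> J' \<subseteq> J" using tot[OF J(1,3)] by (auto simp: ext_def)
      then show ?thesis using J part_mono[of J J'] part_mono[of J' J] by blast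
    qed
    have "partial_lift U tU"
      unfolding partial_lift_def
    proof (intro conjI ballI)
      show "splits U" unfolding U_def by (rule splits_Union) (use lift in \<open>auto simp: partial_lift_def\<close>)
      show "g (tU m) = f m" if m: "m \<in> part U" for m
      proof -
        obtain J t where J: "(J, t) \<in> \<C>" "m \<in> part J" using cover[OF m] by blast
        then show ?thesis using lift[OF J(1)] tU[OF J] by (simp add: partial_lift_def)
      qed
      show "tU \<in> linear_maps R (M\<lparr>carrier := part U\<rparr>) Q"
      proof (rule linear_mapsI; simp)
        fix m assume m: "m \<in> part U"
        obtain J t where J: "(J, t) \<in> \<C>" "m \<in> part J" using cover[OF m] by blast
        have t: "t \<in> linear_maps R (M\<lparr>carrier := part J\<rparr>) Q" using lift[OF J(1)] by (simp add: partial_lift_def)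
        note tD = linear_mapsD[OF t, simplified]
        show "tU m \<in> carrier Q" using tD(1)[OF J(2)] tU[OF J] by simp
        show "tU (r \<odot>\<^bsub>M\<^esub> m) = r \<odot>\<^bsub>Q\<^esub> tU m" if "r \<in> carrier R" for r
          using tD(3)[OF that J(2)] tU[OF J] tU[OF J(1) M.submoduleE(4)[OF part_submodule that J(2)]] by simp
      next
        fix m m' assume m: "m \<in> part U" "m' \<in> part U"
        obtain J t where J: "(J, t) \<in> \<C>" "m \<in> part J" "m' \<in> part J" using cover2[OF m] by blast
        have t: "t \<in> linear_maps R (M\<lparr>carrier := part J\<rparr>) Q" using lift[OF J(1)] by (simp add: partial_lift_def)
        note tD = linear_mapsD[OF t, simplified]
        show "tU (m \<oplus>\<^bsub>M\<^esub> m') = tU m \<oplus>\<^bsub>Q\<^esub> tU m'"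
          using tD(2)[OF J(2,3)] tU[OF J(1)] J(2,3) M.submoduleE(5)[OF part_submodule J(2,3)] by simp
      qed
    qed
    from restrict_lift[OF this] show ?thesis
    proof (rule rev_bexI)
      show "\<forall>a\<in>\<C>. ext a (U, restrict tU (part U))"
        using sub tU by (auto simp: ext_def subset_iff)
    qed
  qed
  from predicate_Zorn[OF po this] obtain z where z: "z \<in> lifts" "\<forall>a\<in>lifts. ext z a \<longrightarrow> a = z" by blast
  obtain J t where "z = (J, t)" by (cases z)
  with z have Jt: "(J, t) \<in> lifts"
    and max: "\<And>J' t'. (J', t') \<in> lifts \<Longrightarrow> ext (J, t) (J', t') \<Longrightarrow> (J', t') = (J, t)" by blast+
  have lift: "partial_lift J t" using Jt by (simp add: lifts_def)
  have "carrier M \<subseteq> part J"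
  proof
    fix p assume "p \<in> carrier M"
    from partial_lift_extend[OF lift this] obtain J' t' where J': "partial_lift J' t'" "J \<subseteq> J'" "p \<in> part J'"
      "\<forall>m\<in>part J. t' m = t m" by blast
    have "ext (J, t) (J', restrict t' (part J'))"
      using J' part_mono[OF J'(2)] by (auto simp: ext_def)
    from max[OF restrict_lift[OF J'(1)] this] show "p \<in> part J" using J'(3) by simp
  qed
  then have "part J = carrier M" using part_closed by blast
  moreover have "M\<lparr>carrier := carrier M\<rparr> = M" by simp
  ultimately have "t \<in> linear_maps R M Q" "\<forall>m\<in>carrier M. g (t m) = f m"
    using lift by (simp_all add: partial_lift_def)
  then show ?thesis by blast
qed

end

theorem theorem1:
  fixes R :: "('r, 'c) ring_scheme" and S :: "('s, 'd) ring_scheme"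
    and h :: "'r \<Rightarrow> 's" and P :: "('r, 'p, 'e) module_scheme"
  assumes "cring R" and "cring S"
    and "faithfully_flat_ring_hom R S h"
    and "module R P"
  shows "projective_module R P \<longleftrightarrow> projective_module S (base_change R S h P)"
proof -
  interpret R: cring R by fact
  interpret S: cring S by fact
  interpret faithfully_flat_ring_change R S h
    using assms(3) by unfold_locales (auto simp: faithfully_flat_ring_hom_def)
  show ?thesis
  proof
    assume "projective_module R P"
    then show "projective_module S (base_change R S h P)" by (rule base_change_projective)
  next
    assume "projective_module S (base_change R S h P)"
    from projective_module_section[OF this]
    obtain s where s: "s \<in> linear_maps S (bc P) (free_module S (carrier (bc P)))"
      "\<forall>n\<in>carrier (bc P). lincomb S (bc P) (\<lambda>k. k) (s n) = n" by (elim bexE)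
    show "projective_module R P"
      unfolding projective_module_def
    proof (intro conjI allI impI assms(4))
      fix Q :: "('r, 'p \<Rightarrow> 'r) module" and B :: "('r, 'p) module" and g f
      assume "module R Q \<and> module R B \<and> g \<in> linear_maps R Q B \<and> g ` carrier Q = carrier B \<and>
        f \<in> linear_maps R P B"
      then interpret lifting_problem R S h P s Q B g f
        using s assms(4)
        by (intro lifting_problem.intro split_base_change.intro faithfully_flat_ring_change_axioms
            split_base_change_axioms.intro lifting_problem_axioms.intro) auto
      show "\<exists>t\<in>linear_maps R P Q. \<forall>x\<in>carrier P. g (t x) = f x" by (rule lift_exists)
    qed
  qed
qed

end
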